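(* Let $d\ge 3$, let $0\le \mu\in C^{0,1}(\mathbb{R}^d)$ (bounded and Lipschitz), and let $p,q:\mathbb{R}^d\times[0,\infty)\to\mathbb{R}$ be Carathéodory functions. Put $p^-=\operatorname{ess\,inf}p$, $p^+=\operatorname{ess\,sup}p$, $q^-=\operatorname{ess\,inf}q$, $q^+=\operatorname{ess\,sup}q$ (over $\mathbb{R}^d\times[0,\infty)$) and assume: (a) $2\le p^-\le p^+<d$, $2\le q^-\le q^+<\infty$, and $p(x,t)<q(x,t)<p^-_*:=\frac{dp^-}{d-p^-}$ for a.a. $x\in\mathbb{R}^d$ and all $t\ge 0$; (b) $p(x,\cdot)$ and $q(x,\cdot)$ are constant on $[0,1]$ and nondecreasing on $[1,\infty)$; (c) there are $c_p,c_q>0$ with $|p(x,t)-p(y,t)|\le c_p|x-y|$ and $|q(x,t)-q(y,t)|\le c_q|x-y|$ for all $t\ge0$ and a.a. $x,y\in\mathbb{R}^d$; (d) $\frac{q^+}{p^-}<1+\frac1d$. Let $\mathcal{H}(x,t)=\int_0^t\big(s^{p(x,s)-1}+\mu(x)s^{q(x,s)-1}\big)\,ds$. Let $V\in C(\mathbb{R}^d,\mathbb{R})$ satisfy $V(x)\ge V_0$ for all $x\in\mathbb R^d$ and some constant $V_0>0$, and suppose that for each $L>0$ the set $\{x\in\mathbb{R}^d:V(x)<L\}$ has finite Lebesgue measure. Then the embedding $W^{1,\mathcal{H}}_V(\mathbb{R}^d)\hookrightarrow L^{\mathcal{H}}(\mathbb{R}^d)$ is compact.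
   Context: $L^{\mathcal H}(\mathbb{R}^d)$ is the set of measurable $u:\mathbb{R}^d\to\mathbb{R}$ with $\int_{\mathbb{R}^d}\mathcal H(x,\lambda|u|)\,dx<\infty$ for some $\lambda>0$, with Luxemburg norm $\|u\|_{L^{\mathcal H}}=\inf\{\lambda>0:\int\mathcal H(x,|u|/\lambda)\,dx\le1\}$. $W^{1,\mathcal H}(\mathbb{R}^d)=\{u\in L^{\mathcal H}:|\nabla u|\in L^{\mathcal H}\}$ with norm $\|u\|_{L^{\mathcal H}}+\||\nabla u|\|_{L^{\mathcal H}}$. $W^{1,\mathcal{H}}_V(\mathbb{R}^d)=\{u\in W^{1,\mathcal{H}}(\mathbb{R}^d):\int_{\mathbb{R}^d}V(x)\mathcal{H}(x,|u|)\,dx<\infty\}$ with norm $\|u\|_{W^{1,\mathcal H}_V}=\||\nabla u|\|_{L^{\mathcal{H}}}+\|u\|_{L^{\mathcal{H}}_V}$, where $\|u\|_{L^{\mathcal{H}}_V}=\inf\{\lambda>0:\int_{\mathbb{R}^d}V(x)\mathcal{H}(x,|u|/\lambda)\,dx\le1\}$. *)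

theory Defs
  imports "HOL-Analysis.Analysis" "HOL-Probability.Essential_Supremum"
begin

text \<open>
  The space \<open>\<real>\<^sup>d\<close> is a type \<open>'a::euclidean_space\<close> with \<open>d = DIM('a)\<close>.  A function on
  \<open>\<real>\<^sup>d \<times> [0,\<infinity>)\<close> is a curried function \<open>'a \<Rightarrow> real \<Rightarrow> real\<close> whose values at negative second
  arguments are never used.  Measurability and almost-everywhere statements refer to Lebesgue measure.
  Members of the function spaces are functions rather than classes modulo a.e. equality, so the
  Luxemburg norms below are seminorms on functions.
\<close>

section \<open>Exponents\<close>

definition caratheodory :: "('a::euclidean_space \<Rightarrow> real \<Rightarrow> real) \<Rightarrow> bool" where
  "caratheodory f \<longleftrightarrow>
     (\<forall>t\<ge>0. (\<lambda>x. f x t) \<in> borel_measurable lebesgue) \<and>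
     (AE x in lebesgue. continuous_on {0..} (f x))"

text \<open>The library's \<open>esssup\<close> is \<open>\<infinity>\<close> by convention on non-measurable functions; Caratheodory
  functions are jointly Lebesgue measurable, so this does not matter here.\<close>

definition ess_sup_exp :: "('a::euclidean_space \<Rightarrow> real \<Rightarrow> real) \<Rightarrow> ereal" where
  "ess_sup_exp f = esssup (lebesgue_on (UNIV \<times> {0..})) (\<lambda>(x, t). ereal (f x t))"

definition ess_inf_exp :: "('a::euclidean_space \<Rightarrow> real \<Rightarrow> real) \<Rightarrow> ereal" where
  "ess_inf_exp f = - esssup (lebesgue_on (UNIV \<times> {0..})) (\<lambda>(x, t). - ereal (f x t))"

definition sobolev_conjugate :: "ereal \<Rightarrow> ereal \<Rightarrow> ereal" where
  "sobolev_conjugate d r = d * r / (d - r)"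

definition double_phase ::
  "('a::euclidean_space \<Rightarrow> real \<Rightarrow> real) \<Rightarrow> ('a \<Rightarrow> real \<Rightarrow> real) \<Rightarrow> ('a \<Rightarrow> real) \<Rightarrow> 'a \<Rightarrow> real \<Rightarrow> real" where
  "double_phase p q \<mu> x t =
     (LINT s:{0..t}|lborel. s powr (p x s - 1) + \<mu> x * s powr (q x s - 1))"

section \<open>Weak gradients\<close>

primrec C_k :: "nat \<Rightarrow> ('a::euclidean_space \<Rightarrow> real) \<Rightarrow> bool" where
  "C_k 0 f \<longleftrightarrow> continuous_on UNIV f"
| "C_k (Suc k) f \<longleftrightarrow>
     f differentiable_on UNIV \<and> (\<forall>b\<in>Basis. C_k k (\<lambda>x. frechet_derivative f (at x) b))"

definition test_function :: "('a::euclidean_space \<Rightarrow> real) \<Rightarrow> bool" where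
  "test_function \<phi> \<longleftrightarrow> (\<forall>k. C_k k \<phi>) \<and> compact (closure {x. \<phi> x \<noteq> 0})"

definition locally_integrable ::
  "('a::euclidean_space \<Rightarrow> 'b::{banach, second_countable_topology}) \<Rightarrow> bool" where
  "locally_integrable f \<longleftrightarrow> (\<forall>K. compact K \<longrightarrow> set_integrable lebesgue K f)"

definition has_weak_gradient :: "('a::euclidean_space \<Rightarrow> real) \<Rightarrow> ('a \<Rightarrow> 'a) \<Rightarrow> bool" where
  "has_weak_gradient u g \<longleftrightarrow>
     locally_integrable u \<and> locally_integrable g \<and>
     (\<forall>\<phi>. test_function \<phi> \<longrightarrow> (\<forall>b\<in>Basis.
        (LINT x|lebesgue. u x * frechet_derivative \<phi> (at x) b)
          = - (LINT x|lebesgue. (g x \<bullet> b) * \<phi> x)))"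

text \<open>Weak gradients are unique up to null sets; this picks a representative.\<close>

definition weak_gradient :: "('a::euclidean_space \<Rightarrow> real) \<Rightarrow> 'a \<Rightarrow> 'a" where
  "weak_gradient u = (SOME g. has_weak_gradient u g)"

section \<open>Musielak--Orlicz and Musielak--Orlicz Sobolev spaces\<close>

definition L_space :: "('a::euclidean_space \<Rightarrow> real \<Rightarrow> real) \<Rightarrow> ('a \<Rightarrow> real) set" where
  "L_space H = {u. u \<in> borel_measurable lebesgue \<and>
     (\<exists>\<tau>>0. (\<integral>\<^sup>+ x. ennreal (H x (\<tau> * \<bar>u x\<bar>)) \<partial>lebesgue) < \<infinity>)}"

definition L_norm :: "('a::euclidean_space \<Rightarrow> real \<Rightarrow> real) \<Rightarrow> ('a \<Rightarrow> real) \<Rightarrow> real" where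
  "L_norm H u = Inf {\<tau>. \<tau> > 0 \<and> (\<integral>\<^sup>+ x. ennreal (H x (\<bar>u x\<bar> / \<tau>)) \<partial>lebesgue) \<le> 1}"

definition W1_space :: "('a::euclidean_space \<Rightarrow> real \<Rightarrow> real) \<Rightarrow> ('a \<Rightarrow> real) set" where
  "W1_space H = {u \<in> L_space H.
     (\<exists>g. has_weak_gradient u g) \<and> (\<lambda>x. norm (weak_gradient u x)) \<in> L_space H}"

definition W1V_space ::
  "('a::euclidean_space \<Rightarrow> real) \<Rightarrow> ('a \<Rightarrow> real \<Rightarrow> real) \<Rightarrow> ('a \<Rightarrow> real) set" where
  "W1V_space V H = {u \<in> W1_space H. (\<integral>\<^sup>+ x. ennreal (V x * H x \<bar>u x\<bar>) \<partial>lebesgue) < \<infinity>}"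

definition LV_norm ::
  "('a::euclidean_space \<Rightarrow> real) \<Rightarrow> ('a \<Rightarrow> real \<Rightarrow> real) \<Rightarrow> ('a \<Rightarrow> real) \<Rightarrow> real" where
  "LV_norm V H u =
     Inf {\<tau>. \<tau> > 0 \<and> (\<integral>\<^sup>+ x. ennreal (V x * H x (\<bar>u x\<bar> / \<tau>)) \<partial>lebesgue) \<le> 1}"

definition W1V_norm ::
  "('a::euclidean_space \<Rightarrow> real) \<Rightarrow> ('a \<Rightarrow> real \<Rightarrow> real) \<Rightarrow> ('a \<Rightarrow> real) \<Rightarrow> real" where
  "W1V_norm V H u = L_norm H (\<lambda>x. norm (weak_gradient u x)) + LV_norm V H u"

section \<open>Compact embeddings\<close>

text \<open>The inclusion \<open>X \<subseteq> Y\<close> is bounded, and every sequence bounded in \<open>X\<close> has a subsequence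
  converging in \<open>Y\<close>.\<close>

definition compact_embedding ::
  "('a \<Rightarrow> real) set \<Rightarrow> (('a \<Rightarrow> real) \<Rightarrow> real) \<Rightarrow> ('a \<Rightarrow> real) set \<Rightarrow> (('a \<Rightarrow> real) \<Rightarrow> real) \<Rightarrow> bool" where
  "compact_embedding X normX Y normY \<longleftrightarrow>
     X \<subseteq> Y \<and>
     (\<exists>C. \<forall>u\<in>X. normY u \<le> C * normX u) \<and>
     (\<forall>u :: nat \<Rightarrow> 'a \<Rightarrow> real. (\<forall>n. u n \<in> X) \<and> (\<exists>B. \<forall>n. normX (u n) \<le> B) \<longrightarrow>
        (\<exists>r v. strict_mono r \<and> v \<in> Y \<and> (\<lambda>n. normY (\<lambda>x. u (r n) x - v x)) \<longlonglongrightarrow> 0))"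

end

theory Submission
  imports Defs "HOL-Complex_Analysis.Great_Picard"
begin

text \<open>
  A weakly differentiable \<open>u\<close> satisfies \<open>|u(x + h) - u(x)| \<le> |h| \<integral>\<^sub>0\<^sup>1 |\<nabla>u(x + s h)| ds\<close> for almost every
  \<open>x\<close>, and nothing else about weak gradients is needed.  First, this bounds the \<open>L\<^sup>1\<close> translations of
  \<open>f = (|u| - 1)\<^sub>+\<^sup>P\<close>, where \<open>P\<close> is the lower bound of \<open>p\<close>; comparing \<open>f\<close> with its means over
  small balls gives \<open>\<integral>\<^bsub>f > t\<^esub> f \<le> C t\<^bsup>-1/d\<^esup>\<close>, so that \<open>u\<close> is bounded in \<open>L\<^sup>r\<close> on
  \<open>{|u| > 2}\<close> for every \<open>r < P (1 + 1/d)\<close>; by the hypothesis on the ratio some such \<open>r\<close> exceeds the upper bound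
  \<open>Q\<close> of \<open>q\<close>.  Second, ball means of a bounded sequence are equicontinuous and uniformly close to the sequence in
  local \<open>L\<^sup>1\<close>, so a subsequence converges almost everywhere.  Where \<open>V \<ge> L\<close> the modular of the
  differences is of order \<open>1/L\<close>; the set \<open>{V < L}\<close> has finite measure, and there dominated convergence below
  a height \<open>T\<close> and the \<open>L\<^sup>r\<close> bound above it finish the proof.
\<close>

section \<open>Smooth bump functions\<close>

text \<open>The obstacle is that the exponents of \<open>double_phase\<close> may grow with the
  height, so a bound on the modular of \<open>u\<close> does not bound that of \<open>2 * u\<close>,
  while norm convergence asks for small modulars at every scale \<open>\<rho>\<close>. For large
  values a power \<open>r\<close> strictly above \<open>Q\<close> takes over: there
  \<open>D x t\<close> is at most \<open>(1 + M) * t powr Q\<close>, and the surplus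
  \<open>r - Q\<close> makes tails small uniformly along the sequence. The number
  \<open>1 + 1 / d\<close> comes from scaling. A ball of measure \<open>C / t\<close> has radius of
  order \<open>t powr (- 1 / d)\<close>, and this radius is what a function with Lipschitz
  translations in L^1 loses against its ball means. Summing over dyadic heights then gives
  integrability of \<open>f powr (1 + \<delta>)\<close> for every \<open>\<delta> < 1 / d\<close>,
  and \<open>f\<close> behaves like the \<open>P\<close>-th power of \<open>u\<close> at large
  heights. The gain is smaller than Sobolev's, but it is just what the ratio hypothesis asks for.
  The limit only has to lie in \<open>L_space\<close>; Fatou's lemma provides its bounds, and no
  weak gradient of it is constructed.\<close>

definition flat :: "nat \<Rightarrow> real \<Rightarrow> real" where
  "flat k t = (if t > 0 then (1 / t) ^ k * exp (- (1 / t)) else 0)"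

lemma flat_nonneg: "flat k t \<ge> 0"
  by (simp add: flat_def)

lemma flat_tendsto_0: "(flat k \<longlongrightarrow> 0) (at 0)"
proof -
  have "((\<lambda>t::real. inverse t ^ k / exp (inverse t)) \<longlongrightarrow> 0) (at_right 0)"
    by (rule filterlim_compose[OF tendsto_power_div_exp_0 filterlim_inverse_at_top_right])
  then have R: "(flat k \<longlongrightarrow> 0) (at_right 0)"
    by (rule Lim_transform_eventually)
       (auto simp: flat_def eventually_at_filter exp_minus field_simps)
  have "((\<lambda>t::real. 0::real) \<longlongrightarrow> 0) (at_left 0)" by simp
  then have L: "(flat k \<longlongrightarrow> 0) (at_left 0)"
    by (rule Lim_transform_eventually) (auto simp: flat_def eventually_at_filter)
  show ?thesis using L R by (simp add: filterlim_at_split)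
qed

text \<open>The factors \<open>(1 / t) ^ k\<close> are carried along because with them the family is
  closed under differentiation up to linear combinations, which \<open>exp (- (1 / t))\<close> alone
  is not.\<close>

lemma flat_has_derivative:
  "(flat k has_real_derivative (flat (k + 2) t - k * flat (Suc k) t)) (at t)"
proof (cases "t = 0")
  case True
  \<comment> \<open>Away from 0 the difference quotient of \<open>flat k\<close> at 0 is
    \<open>flat (Suc k)\<close>, so the limit already proved applies at the next index.\<close>
  have "((\<lambda>y. (flat k y - flat k 0) / (y - 0)) \<longlongrightarrow> 0) (at 0)"
    by (rule Lim_transform_eventually[OF flat_tendsto_0[of "Suc k"]])
       (auto simp: flat_def eventually_at_filter)
  then show ?thesis unfolding True has_field_derivative_iff by (simp add: flat_def)
next
  case False
  show ?thesis
  proof (cases "t > 0")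
    case True
    have "((\<lambda>t. (1 / t) ^ k * exp (- (1 / t))) has_real_derivative
       (flat (k + 2) t - k * flat (Suc k) t)) (at t)"
      using True
    proof (cases k)
      case 0
      then show ?thesis
        using True by (auto intro!: derivative_eq_intros simp: flat_def power2_eq_square divide_simps)
    next
      case (Suc m)
      show ?thesis
        unfolding Suc using True
        by (auto intro!: derivative_eq_intros simp: flat_def power_divide field_simps
              simp del: power_Suc) (simp_all add: algebra_simps)
    qed
    moreover have "\<forall>\<^sub>F y in nhds t. flat k y = (1 / y) ^ k * exp (- (1 / y))"
      using eventually_nhds_in_open[of "{0<..}" t] True
      by (auto simp: flat_def elim!: eventually_mono)
    ultimately show ?thesis
      by (subst DERIV_cong_ev[OF refl _ refl])
  next
    case f: False
    have "\<forall>\<^sub>F y in nhds t. flat k y = 0"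
      using eventually_nhds_in_open[of "{..<0}" t] f False
      by (auto simp: flat_def elim!: eventually_mono)
    moreover have "((\<lambda>y. 0) has_real_derivative (flat (k + 2) t - k * flat (Suc k) t)) (at t)"
      using f by (simp add: flat_def)
    ultimately show ?thesis
      by (subst DERIV_cong_ev[OF refl _ refl])
  qed
qed

text \<open>An algebra closed under directional derivatives: membership yields every
  \<open>C_k\<close> by induction, with no formula for higher derivatives of products.\<close>

inductive_set flat_alg :: "('a::euclidean_space \<Rightarrow> real) set" where
  flat_alg_const: "(\<lambda>_. c) \<in> flat_alg"
| flat_alg_base: "(\<lambda>x. flat k (a + x \<bullet> v)) \<in> flat_alg"
| flat_alg_add: "f \<in> flat_alg \<Longrightarrow> g \<in> flat_alg \<Longrightarrow> (\<lambda>x. f x + g x) \<in> flat_alg"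
| flat_alg_mult: "f \<in> flat_alg \<Longrightarrow> g \<in> flat_alg \<Longrightarrow> (\<lambda>x. f x * g x) \<in> flat_alg"

lemma flat_alg_derivative:
  "f \<in> flat_alg \<Longrightarrow> \<exists>f'. (\<forall>x. (f has_derivative f' x) (at x)) \<and> (\<forall>b. (\<lambda>x. f' x b) \<in> flat_alg)"
proof (induction rule: flat_alg.induct)
  case (flat_alg_const c)
  show ?case by (rule exI[of _ "\<lambda>_ _. 0"]) (auto intro: flat_alg.intros)
next
  case (flat_alg_base k a v)
  let ?f' = "\<lambda>x b. (flat (k + 2) (a + x \<bullet> v) + (- real k) * flat (Suc k) (a + x \<bullet> v)) * (b \<bullet> v)"
  have "((\<lambda>x. flat k (a + x \<bullet> v)) has_derivative ?f' x) (at x)" for x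
  proof -
    have "((\<lambda>x. a + x \<bullet> v) has_derivative (\<lambda>b. b \<bullet> v)) (at x)"
      by (auto intro!: derivative_eq_intros)
    from DERIV_compose_FDERIV[OF flat_has_derivative this]
    show ?thesis by (simp add: mult.commute)
  qed
  moreover have "(\<lambda>x. ?f' x b) \<in> flat_alg" for b
    by (intro flat_alg.intros)
  ultimately show ?case by (intro exI[of _ ?f']) auto
next
  case (flat_alg_add f g)
  then obtain f' g' where "\<And>x. (f has_derivative f' x) (at x)" "\<And>b. (\<lambda>x. f' x b) \<in> flat_alg"
    "\<And>x. (g has_derivative g' x) (at x)" "\<And>b. (\<lambda>x. g' x b) \<in> flat_alg" by metis
  then show ?case
    by (intro exI[of _ "\<lambda>x b. f' x b + g' x b"]) (auto intro!: has_derivative_add flat_alg.intros)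
next
  case (flat_alg_mult f g)
  then obtain f' g' where "\<And>x. (f has_derivative f' x) (at x)" "\<And>b. (\<lambda>x. f' x b) \<in> flat_alg"
    "\<And>x. (g has_derivative g' x) (at x)" "\<And>b. (\<lambda>x. g' x b) \<in> flat_alg" by metis
  then show ?case
    using flat_alg_mult.hyps
    by (intro exI[of _ "\<lambda>x b. f x * g' x b + f' x b * g x"])
       (auto intro!: has_derivative_mult flat_alg.intros)
qed

lemma flat_alg_C_k: "f \<in> flat_alg \<Longrightarrow> C_k k f"
proof (induction k arbitrary: f)
  case 0
  then show ?case
    using flat_alg_derivative[of f] has_derivative_continuous
    by (force intro!: continuous_at_imp_continuous_on)
next
  case (Suc k)
  then obtain f' where f': "\<And>x. (f has_derivative f' x) (at x)" "\<And>b. (\<lambda>x. f' x b) \<in> flat_alg"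
    using flat_alg_derivative by metis
  have "frechet_derivative f (at x) = f' x" for x
    using f'(1) frechet_derivative_at by metis
  then show ?case
    using f' Suc.IH by (auto simp: differentiable_on_def differentiable_def has_derivative_at_withinI)
qed

text \<open>Inside the box each factor is an exponential of \<open>- e\<close> over a positive
  distance, so these smooth functions increase to the indicator of the box as \<open>e\<close>
  decreases to 0. They make integrals over boxes limits of integrals against test functions.\<close>

definition bump :: "real \<Rightarrow> 'a::euclidean_space \<Rightarrow> 'a \<Rightarrow> 'a \<Rightarrow> real" where
  "bump e l u x = (\<Prod>b\<in>Basis. flat 0 ((x \<bullet> b - l \<bullet> b) / e) * flat 0 ((u \<bullet> b - x \<bullet> b) / e))"

lemma flat_alg_prod:
  assumes "finite B" "\<And>b. b \<in> B \<Longrightarrow> f b \<in> flat_alg"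
  shows "(\<lambda>x. \<Prod>b\<in>B. f b x) \<in> flat_alg"
  using assms by (induction B rule: finite_induct) (auto intro!: flat_alg.intros)

lemma bump_in_flat_alg: "bump e l u \<in> flat_alg"
proof -
  have "(\<lambda>x. flat 0 ((x \<bullet> b - l \<bullet> b) / e)) \<in> flat_alg" for b
    using flat_alg_base[of 0 "- (l \<bullet> b) / e" "b /\<^sub>R e"] by (simp add: field_simps diff_divide_distrib)
  moreover have "(\<lambda>x. flat 0 ((u \<bullet> b - x \<bullet> b) / e)) \<in> flat_alg" for b
    using flat_alg_base[of 0 "(u \<bullet> b) / e" "- b /\<^sub>R e"] by (simp add: field_simps diff_divide_distrib)
  ultimately show ?thesis
    unfolding bump_def[abs_def] by (intro flat_alg_prod flat_alg.intros) auto
qed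

lemma bump_outside: "e > 0 \<Longrightarrow> x \<notin> box l u \<Longrightarrow> bump e l u x = 0"
  unfolding bump_def by (rule prod_zero) (auto simp: box_def flat_def zero_less_divide_iff)

lemma flat_le_1: "flat 0 t \<le> 1"
  by (simp add: flat_def)

lemma bump_bounds: "0 \<le> bump e l u x" "bump e l u x \<le> 1"
  unfolding bump_def by (auto intro!: prod_nonneg prod_le_1 mult_nonneg_nonneg mult_le_one simp: flat_nonneg flat_le_1)

lemma test_function_bump: "e > 0 \<Longrightarrow> test_function (bump e l u)"
  unfolding test_function_def
proof safe
  show "C_k k (bump e l u)" for k by (rule flat_alg_C_k[OF bump_in_flat_alg])
  assume "e > 0"
  then have "{x. bump e l u x \<noteq> 0} \<subseteq> cbox l u" using bump_outside box_subset_cbox by blast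
  then show "compact (closure {x. bump e l u x \<noteq> 0})"
    using compact_closure bounded_cbox bounded_subset by blast
qed

lemma bump_tendsto_indicator:
  "(\<lambda>n. bump (1 / Suc n) l u x) \<longlonglongrightarrow> indicator (box l u) x"
proof (cases "x \<in> box l u")
  case False
  then show ?thesis by (simp add: bump_outside)
next
  case True
  have *: "(\<lambda>n. flat 0 (t / (1 / Suc n))) \<longlonglongrightarrow> 1" if "t > 0" for t
  proof -
    have "(\<lambda>n. exp (- (1 / t * inverse (real (Suc n))))) \<longlonglongrightarrow> exp (- (1 / t * 0))"
      by (intro tendsto_intros LIMSEQ_inverse_real_of_nat)
    moreover have "t + t * real n > 0" for n
      using that by (simp add: add_pos_nonneg)
    ultimately show ?thesis using that by (simp add: flat_def field_simps)
  qed
  have "(\<lambda>n. bump (1 / Suc n) l u x) \<longlonglongrightarrow> (\<Prod>b\<in>(Basis::'a set). 1 * 1)"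
    unfolding bump_def using True by (intro tendsto_intros *) (auto simp: box_def)
  then show ?thesis using True by simp
qed

section \<open>Translation estimates for weak gradients\<close>

lemma nn_integral_lborel_translate:
  fixes f :: "'a::euclidean_space \<Rightarrow> ennreal"
  assumes [measurable]: "f \<in> borel_measurable borel"
  shows "(\<integral>\<^sup>+x. f (x + a) \<partial>lborel) = (\<integral>\<^sup>+x. f x \<partial>lborel)"
proof -
  have "(\<integral>\<^sup>+x. f x \<partial>lborel) = (\<integral>\<^sup>+x. f x \<partial>distr lborel borel ((+) a))"
    by (simp add: lborel_distr_plus)
  also have "\<dots> = (\<integral>\<^sup>+x. f (x + a) \<partial>lborel)"
    by (subst nn_integral_distr) (auto simp: add.commute)
  finally show ?thesis by simp
qed

lemma integral_lborel_translate:
  fixes f :: "'a::euclidean_space \<Rightarrow> real"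
  assumes [measurable]: "f \<in> borel_measurable borel"
  shows "(LINT x|lborel. f (x + a)) = (LINT x|lborel. f x)"
proof -
  have "(LINT x|lborel. f x) = (LINT x|distr lborel borel ((+) a). f x)"
    by (simp add: lborel_distr_plus)
  also have "\<dots> = (LINT x|lborel. f (x + a))"
    by (subst integral_distr) (auto simp: add.commute)
  finally show ?thesis by simp
qed

lemma integrable_lborel_translate:
  fixes f :: "'a::euclidean_space \<Rightarrow> real"
  assumes "integrable lborel f"
  shows "integrable lborel (\<lambda>x. f (x + a))"
proof -
  have "integrable (distr lborel borel ((+) a)) f"
    using assms by (simp add: lborel_distr_plus)
  then show ?thesis
    by (subst (asm) integrable_distr_eq) (use assms in \<open>auto simp: add.commute borel_measurable_integrable\<close>)
qed

text \<open>Boxes generate the Borel sets, are stable under intersection and exhaust the space, so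
  both densities define the same measure. Finiteness on boxes makes it sigma-finite, and then its
  density is unique almost everywhere.\<close>

lemma density_eq_if_integral_box_eq:
  fixes f g :: "'a::euclidean_space \<Rightarrow> ennreal"
  assumes [measurable]: "f \<in> borel_measurable borel" "g \<in> borel_measurable borel"
    and fin: "\<And>l u. (\<integral>\<^sup>+x\<in>box l u. f x \<partial>lborel) < \<infinity>"
    and eq: "\<And>l u. (\<integral>\<^sup>+x\<in>box l u. f x \<partial>lborel) = (\<integral>\<^sup>+x\<in>box l u. g x \<partial>lborel)"
  shows "AE x in lborel. f x = g x"
proof -
  let ?E = "range (\<lambda>(a, b). box a b::'a set)"
  let ?A = "\<lambda>n::nat. box (- (real n *\<^sub>R One)) (real n *\<^sub>R One) :: 'a set"
  have em: "emeasure (density lborel f) (box l u) = (\<integral>\<^sup>+x\<in>box l u. f x \<partial>lborel)"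
    "emeasure (density lborel g) (box l u) = (\<integral>\<^sup>+x\<in>box l u. g x \<partial>lborel)" for l u
    by (auto simp: emeasure_density)
  have A: "range ?A \<subseteq> ?E" "(\<Union>i. ?A i) = UNIV" unfolding UN_box_eq_UNIV by auto
  have "density lborel f = density lborel g"
  proof (rule measure_eqI_generator_eq[OF _ _ _ _ _ A])
    show "Int_stable ?E" by (auto simp: Int_stable_def box_Int_box)
    show "?E \<subseteq> Pow UNIV" "sets (density lborel f) = sigma_sets UNIV ?E"
      "sets (density lborel g) = sigma_sets UNIV ?E"
      by (simp_all add: borel_eq_box)
    show "emeasure (density lborel f) X = emeasure (density lborel g) X" if "X \<in> ?E" for X
      using that em eq by auto
    show "emeasure (density lborel f) (?A i) \<noteq> \<infinity>" for i using em fin by (auto simp: less_top)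
  qed
  moreover have "sigma_finite_measure (density lborel f)"
    by (rule sigma_finite_measure.intro, rule exI[of _ "range ?A"])
       (use A em fin in \<open>auto simp: less_top[symmetric]\<close>)
  ultimately show ?thesis
    by (subst (asm) sigma_finite_density_unique) auto
qed

lemma enn2real_eqD: "enn2real a = enn2real b \<Longrightarrow> a < \<infinity> \<Longrightarrow> b < \<infinity> \<Longrightarrow> a = b"
  by (metis ennreal_enn2real infinity_ennreal_def)

text \<open>Bumps tending to the indicator of a box turn the hypothesis into vanishing integrals
  over boxes. Since \<open>ennreal\<close> cuts off at 0, \<open>ennreal (w x)\<close> and
  \<open>ennreal (- w x)\<close> are the positive and negative parts; they have equal integrals over
  boxes and so agree almost everywhere.\<close>

lemma fundamental_lemma_calculus_of_variations:
  fixes w :: "'a::euclidean_space \<Rightarrow> real"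
  assumes [measurable]: "w \<in> borel_measurable borel"
    and int: "\<And>K. compact K \<Longrightarrow> set_integrable lborel K w"
    and zero: "\<And>\<phi>. test_function \<phi> \<Longrightarrow> (LINT x|lborel. w x * \<phi> x) = 0"
  shows "AE x in lborel. w x = 0"
proof -
  have box_int: "set_integrable lborel (box l u) w" for l u
    by (rule set_integrable_subset[OF int[OF compact_cbox, of l u] _ box_subset_cbox]) simp
  have [measurable]: "bump e l u \<in> borel_measurable borel" for e and l u :: 'a
    using flat_alg_C_k[OF bump_in_flat_alg, of 0 e l u] by (auto intro: borel_measurable_continuous_onI)
  have box0: "(LINT x|lborel. indicator (box l u) x * w x) = 0" for l u
  proof -
    have "(\<lambda>n. LINT x|lborel. w x * bump (1 / Suc n) l u x) \<longlonglongrightarrow> (LINT x|lborel. w x * indicator (box l u) x)"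
    proof (rule integral_dominated_convergence)
      show "integrable lborel (\<lambda>x. norm (indicator (box l u) x *\<^sub>R w x))"
        using box_int[of l u] unfolding set_integrable_def by (rule integrable_norm)
      show "AE x in lborel. (\<lambda>n. w x * bump (1 / Suc n) l u x) \<longlonglongrightarrow> w x * indicator (box l u) x"
        by (intro AE_I2 tendsto_intros bump_tendsto_indicator)
      show "AE x in lborel. norm (w x * bump (1 / Suc n) l u x) \<le> norm (indicator (box l u) x *\<^sub>R w x)" for n
      proof (rule AE_I2, goal_cases)
        case (1 x)
        show ?case
        proof (cases "x \<in> box l u")
          case True
          then show ?thesis
            using bump_bounds[of "1 / Suc n" l u x] by (simp add: abs_mult mult_left_le)
        qed (simp add: bump_outside)
      qed
    qed measurable
    moreover have "(LINT x|lborel. w x * bump (1 / Suc n) l u x) = 0" for n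
      by (rule zero[OF test_function_bump]) simp
    ultimately have "(LINT x|lborel. w x * indicator (box l u) x) = 0"
      by (simp add: LIMSEQ_const_iff)
    then show ?thesis by (simp add: mult.commute)
  qed
  have fin: "(\<integral>\<^sup>+x\<in>box l u. ennreal (w x) \<partial>lborel) < \<infinity>" "(\<integral>\<^sup>+x\<in>box l u. ennreal (- w x) \<partial>lborel) < \<infinity>" for l u
  proof -
    have *: "(\<integral>\<^sup>+x. ennreal (norm (indicator (box l u) x *\<^sub>R w x)) \<partial>lborel) < \<infinity>"
      using box_int[of l u] unfolding set_integrable_def by (simp add: integrable_iff_bounded)
    show "(\<integral>\<^sup>+x\<in>box l u. ennreal (w x) \<partial>lborel) < \<infinity>"
      by (rule le_less_trans[OF nn_integral_mono *]) (auto simp: indicator_def)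
    show "(\<integral>\<^sup>+x\<in>box l u. ennreal (- w x) \<partial>lborel) < \<infinity>"
      by (rule le_less_trans[OF nn_integral_mono *]) (auto simp: indicator_def)
  qed
  have "AE x in lborel. ennreal (w x) = ennreal (- w x)"
  proof (rule density_eq_if_integral_box_eq[of "\<lambda>x. ennreal (w x)" "\<lambda>x. ennreal (- w x)"])
    show "(\<lambda>x. ennreal (w x)) \<in> borel_measurable borel" by measurable
    show "(\<lambda>x. ennreal (- w x)) \<in> borel_measurable borel" by measurable
    fix l u
    let ?f = "\<lambda>x. indicator (box l u) x * w x"
    have "integrable lborel ?f" using box_int[of l u] unfolding set_integrable_def by simp
    note real_lebesgue_integral_def[OF this]
    then have diff: "enn2real (\<integral>\<^sup>+x. ennreal (?f x) \<partial>lborel) = enn2real (\<integral>\<^sup>+x. ennreal (- ?f x) \<partial>lborel)"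
      unfolding box0 by linarith
    have A: "(\<integral>\<^sup>+x. ennreal (?f x) \<partial>lborel) = (\<integral>\<^sup>+x\<in>box l u. ennreal (w x) \<partial>lborel)"
      by (rule nn_integral_cong) (simp add: indicator_def)
    have B: "(\<integral>\<^sup>+x. ennreal (- ?f x) \<partial>lborel) = (\<integral>\<^sup>+x\<in>box l u. ennreal (- w x) \<partial>lborel)"
      by (rule nn_integral_cong) (simp add: indicator_def)
    show "(\<integral>\<^sup>+x\<in>box l u. ennreal (w x) \<partial>lborel) = (\<integral>\<^sup>+x\<in>box l u. ennreal (- w x) \<partial>lborel)"
      using diff unfolding A B by (rule enn2real_eqD) (use fin in auto)
    show "(\<integral>\<^sup>+x\<in>box l u. ennreal (w x) \<partial>lborel) < \<infinity>" by (rule fin(1))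
  qed
  then show ?thesis
  proof (rule AE_mp, intro AE_I2 impI)
    fix x assume "ennreal (w x) = ennreal (- w x)"
    then show "w x = 0" by (cases "w x \<ge> 0") (auto simp: ennreal_neg)
  qed
qed

section \<open>Translates and directional derivatives of test functions\<close>

lemma has_derivative_translate:
  assumes "f differentiable (at (x - a))"
  shows "((\<lambda>x. f (x - a)) has_derivative frechet_derivative f (at (x - a))) (at x)"
proof -
  have "((\<lambda>x. x - a) has_derivative (\<lambda>h. h)) (at x)"
    by (auto intro!: derivative_eq_intros)
  moreover have "(f has_derivative frechet_derivative f (at (x - a))) (at (x - a))"
    using assms by (simp add: frechet_derivative_works)
  ultimately show ?thesis by (rule has_derivative_compose)
qed

lemma frechet_derivative_translate:
  assumes "f differentiable (at (x - a))"
  shows "frechet_derivative (\<lambda>x. f (x - a)) (at x) = frechet_derivative f (at (x - a))"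
  using frechet_derivative_at[OF has_derivative_translate[OF assms]] by simp

lemma C_k_translate:
  "C_k k f \<Longrightarrow> C_k k (\<lambda>x. f (x - a))"
proof (induction k arbitrary: f)
  case 0
  then have "continuous_on UNIV f" by simp
  then have "continuous_on UNIV (\<lambda>x. f (x - a))"
    by (rule continuous_on_compose2) (auto intro!: continuous_intros)
  then show ?case by simp
next
  case (Suc k)
  have diff: "f differentiable (at x)" for x using Suc.prems by (simp add: differentiable_on_def)
  have "(\<lambda>x. f (x - a)) differentiable_on UNIV"
    using has_derivative_translate[OF diff] unfolding differentiable_on_def differentiable_def by blast
  moreover have "C_k k (\<lambda>x. frechet_derivative f (at (x - a)) b)" if "b \<in> Basis" for b
    using Suc.prems that by (intro Suc.IH[of "\<lambda>x. frechet_derivative f (at x) b"]) simp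
  ultimately show ?case
    by (simp add: frechet_derivative_translate[OF diff])
qed

lemma test_function_translate:
  assumes "test_function \<phi>"
  shows "test_function (\<lambda>x. \<phi> (x - a))"
proof -
  have "{x. \<phi> (x - a) \<noteq> 0} \<subseteq> (+) a ` closure {x. \<phi> x \<noteq> 0}"
  proof
    fix x assume "x \<in> {x. \<phi> (x - a) \<noteq> 0}"
    then have "x - a \<in> closure {x. \<phi> x \<noteq> 0}" using closure_subset[of "{x. \<phi> x \<noteq> 0}"] by auto
    then show "x \<in> (+) a ` closure {x. \<phi> x \<noteq> 0}" by (intro image_eqI[of _ _ "x - a"]) auto
  qed
  moreover have "compact ((+) a ` closure {x. \<phi> x \<noteq> 0})"
    using assms unfolding test_function_def
    by (intro compact_continuous_image continuous_intros) simp
  ultimately have "bounded {x. \<phi> (x - a) \<noteq> 0}"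
    by (meson bounded_subset compact_imp_bounded)
  then have "compact (closure {x. \<phi> (x - a) \<noteq> 0})" by simp
  moreover have "C_k k (\<lambda>x. \<phi> (x - a))" for k
    using assms by (intro C_k_translate) (simp add: test_function_def)
  ultimately show ?thesis unfolding test_function_def by blast
qed

lemma frechet_derivative_basis_sum:
  fixes f :: "'a::euclidean_space \<Rightarrow> real"
  assumes "f differentiable (at x)"
  shows "frechet_derivative f (at x) h = (\<Sum>b\<in>Basis. (h \<bullet> b) * frechet_derivative f (at x) b)"
proof -
  have lin: "linear (frechet_derivative f (at x))" using assms by (rule linear_frechet_derivative)
  have "frechet_derivative f (at x) h = frechet_derivative f (at x) (\<Sum>b\<in>Basis. (h \<bullet> b) *\<^sub>R b)"
    by (simp add: euclidean_representation)
  then show ?thesis by (simp add: linear_sum[OF lin] linear_cmul[OF lin])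
qed

lemma test_functionD:
  assumes "test_function \<phi>"
  shows test_function_differentiable: "\<phi> differentiable (at x)"
    and test_function_continuous: "continuous_on UNIV \<phi>"
    and test_function_derivative_continuous: "continuous_on UNIV (\<lambda>x. frechet_derivative \<phi> (at x) h)"
    and test_function_support: "\<exists>R>0. \<forall>x. x \<notin> cball 0 R \<longrightarrow> \<phi> x = 0 \<and> frechet_derivative \<phi> (at x) h = 0"
proof -
  have C1: "C_k (Suc 0) \<phi>" using assms by (simp add: test_function_def del: C_k.simps)
  then show diff: "\<phi> differentiable (at x)" for x by (simp add: differentiable_on_def)
  show "continuous_on UNIV \<phi>"
    using diff by (intro continuous_at_imp_continuous_on ballI differentiable_imp_continuous_within)
  have "frechet_derivative \<phi> (at x) h = (\<Sum>b\<in>Basis. (h \<bullet> b) * frechet_derivative \<phi> (at x) b)" for x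
    using diff by (rule frechet_derivative_basis_sum)
  then show "continuous_on UNIV (\<lambda>x. frechet_derivative \<phi> (at x) h)"
    using C1 by (auto intro!: continuous_intros)
  obtain R where R: "R > 0" "closure {x. \<phi> x \<noteq> 0} \<subseteq> ball 0 R"
    using assms unfolding test_function_def by (meson bounded_subset_ballD compact_imp_bounded)
  have "\<phi> x = 0 \<and> frechet_derivative \<phi> (at x) h = 0" if "x \<notin> cball 0 R" for x
  proof
    show "\<phi> x = 0" using that R closure_subset[of "{x. \<phi> x \<noteq> 0}"] by fastforce
    have "open (- cball 0 R)" by auto
    moreover have "\<phi> y = 0" if "y \<in> - cball 0 R" for y
      using that R closure_subset[of "{x. \<phi> x \<noteq> 0}"] by fastforce
    ultimately have "(\<phi> has_derivative (\<lambda>_. 0)) (at x)"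
      using that by (intro has_derivative_transform_within_open[OF has_derivative_const[of 0], of "- cball 0 R"]) auto
    then show "frechet_derivative \<phi> (at x) h = 0" using frechet_derivative_at by metis
  qed
  then show "\<exists>R>0. \<forall>x. x \<notin> cball 0 R \<longrightarrow> \<phi> x = 0 \<and> frechet_derivative \<phi> (at x) h = 0" using R(1) by blast
qed

lemma continuous_support_bounded:
  fixes f :: "'a::euclidean_space \<Rightarrow> real"
  assumes "continuous_on UNIV f" "\<And>x. x \<notin> cball 0 R \<Longrightarrow> f x = 0"
  obtains B where "B \<ge> 0" "\<And>x. \<bar>f x\<bar> \<le> B * indicator (cball 0 R) x"
proof -
  have "bounded (f ` cball 0 R)"
    using assms(1) by (intro compact_imp_bounded compact_continuous_image) (auto intro: continuous_on_subset)
  then obtain B where B: "B > 0" "\<And>x. x \<in> cball 0 R \<Longrightarrow> \<bar>f x\<bar> \<le> B"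
    by (auto simp: bounded_pos)
  show ?thesis
  proof (rule that[of B])
    show "\<bar>f x\<bar> \<le> B * indicator (cball 0 R) x" for x
      using B assms(2)[of x] by (cases "x \<in> cball 0 R") auto
  qed (use B in auto)
qed

text \<open>Licence for Fubini: a shift by \<open>s *\<^sub>R h\<close> with \<open>s\<close> in the
  unit interval moves the support of \<open>\<theta>\<close> into the ball of radius
  \<open>R + norm h\<close>, so the inner integral is bounded by the same local L^1 norm of
  \<open>k\<close> for every \<open>s\<close>.\<close>

lemma segment_integral_finite:
  fixes k :: "'a::euclidean_space \<Rightarrow> real"
  assumes [measurable]: "k \<in> borel_measurable borel"
    and int: "\<And>K. compact K \<Longrightarrow> set_integrable lborel K k"
    and [measurable]: "\<theta> \<in> borel_measurable borel"
    and \<theta>: "\<And>x. \<bar>\<theta> x\<bar> \<le> B * indicator (cball 0 R) x" and "B \<ge> 0"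
  shows "integrable (lborel \<Otimes>\<^sub>M lborel) (\<lambda>(x, s::real). indicator {0..1} s * k (x + s *\<^sub>R h) * \<theta> x)"
proof (rule integrableI_bounded)
  define K where "K = cball (0::'a) (R + norm h)"
  have [measurable]: "K \<in> sets borel" by (simp add: K_def)
  have fin: "(\<integral>\<^sup>+x. ennreal (norm (indicator K x *\<^sub>R k x)) \<partial>lborel) < \<infinity>"
    using int[OF compact_cball, of 0 "R + norm h"] unfolding set_integrable_def K_def by (simp add: integrable_iff_bounded)
  have inner: "(\<integral>\<^sup>+x. ennreal (norm (indicator {0..1} s * k (x + s *\<^sub>R h) * \<theta> x)) \<partial>lborel)
      \<le> indicator {0..1} s * (ennreal B * (\<integral>\<^sup>+x. ennreal (norm (indicator K x *\<^sub>R k x)) \<partial>lborel))" for s :: real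
  proof (cases "s \<in> {0..1}")
    case True
    have "(\<integral>\<^sup>+x. ennreal (norm (indicator {0..1} s * k (x + s *\<^sub>R h) * \<theta> x)) \<partial>lborel)
       \<le> (\<integral>\<^sup>+x. (\<lambda>y. ennreal B * ennreal (norm (indicator K y *\<^sub>R k y))) (x + s *\<^sub>R h) \<partial>lborel)"
    proof (rule nn_integral_mono, goal_cases)
      case (1 x)
      have "\<bar>\<theta> x\<bar> \<le> B * indicator K (x + s *\<^sub>R h)"
      proof (cases "x \<in> cball 0 R")
        case xR: True
        have "norm (x + s *\<^sub>R h) \<le> norm x + s * norm h" using True norm_triangle_ineq[of x "s *\<^sub>R h"] by simp
        also have "\<dots> \<le> R + norm h" using xR True by (intro add_mono) (auto intro: mult_left_le_one_le)
        finally show ?thesis using \<theta>[of x] xR by (simp add: K_def)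
      next
        case False
        then show ?thesis using \<theta>[of x] \<open>B \<ge> 0\<close> by (simp add: K_def)
      qed
      then have "\<bar>k (x + s *\<^sub>R h)\<bar> * \<bar>\<theta> x\<bar> \<le> \<bar>k (x + s *\<^sub>R h)\<bar> * (B * indicator K (x + s *\<^sub>R h))"
        by (intro mult_left_mono) auto
      then show ?case
        using True \<open>B \<ge> 0\<close> by (simp add: abs_mult ennreal_mult[symmetric] ac_simps ennreal_leI)
    qed
    also have "\<dots> = (\<integral>\<^sup>+x. ennreal B * ennreal (norm (indicator K x *\<^sub>R k x)) \<partial>lborel)"
      by (rule nn_integral_lborel_translate[of "\<lambda>y. ennreal B * ennreal (norm (indicator K y *\<^sub>R k y))"]) measurable
    also have "\<dots> = ennreal B * (\<integral>\<^sup>+x. ennreal (norm (indicator K x *\<^sub>R k x)) \<partial>lborel)"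
      by (rule nn_integral_cmult) measurable
    finally show ?thesis using True by simp
  qed simp
  have "(\<integral>\<^sup>+z. ennreal (norm (case z of (x, s) \<Rightarrow> indicator {0..1} s * k (x + s *\<^sub>R h) * \<theta> x)) \<partial>(lborel \<Otimes>\<^sub>M (lborel::real measure)))
     = (\<integral>\<^sup>+s. \<integral>\<^sup>+x. ennreal (norm (indicator {0..1} s * k (x + s *\<^sub>R h) * \<theta> x)) \<partial>lborel \<partial>lborel)"
    by (subst lborel_pair.nn_integral_snd[symmetric]) auto
  also have "\<dots> \<le> (\<integral>\<^sup>+s. indicator {0..1} (s::real) * (ennreal B * (\<integral>\<^sup>+x. ennreal (norm (indicator K x *\<^sub>R k x)) \<partial>lborel)) \<partial>lborel)"
    by (rule nn_integral_mono) (rule inner)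
  also have "\<dots> = ennreal B * (\<integral>\<^sup>+x. ennreal (norm (indicator K x *\<^sub>R k x)) \<partial>lborel)"
    by (subst nn_integral_multc) auto
  also have "\<dots> < \<infinity>" using fin by (simp add: ennreal_mult_less_top)
  finally show "(\<integral>\<^sup>+z. ennreal (norm (case z of (x, s) \<Rightarrow> indicator {0..1} s * k (x + s *\<^sub>R h) * \<theta> x)) \<partial>(lborel \<Otimes>\<^sub>M (lborel::real measure))) < \<infinity>" .
qed measurable

lemma locally_integrable_mult_bounded:
  fixes k \<theta> :: "'a::euclidean_space \<Rightarrow> real"
  assumes "set_integrable lborel (cball 0 R) k"
    and [measurable]: "k \<in> borel_measurable borel" "\<theta> \<in> borel_measurable borel"
    and \<theta>: "\<And>x. \<bar>\<theta> x\<bar> \<le> B * indicator (cball 0 R) x" "B \<ge> 0"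
  shows "integrable lborel (\<lambda>x. k x * \<theta> x)"
proof (rule Bochner_Integration.integrable_bound)
  show "integrable lborel (\<lambda>x. B * (indicator (cball 0 R) x *\<^sub>R k x))"
    using assms(1) unfolding set_integrable_def by (rule integrable_mult_right)
  show "AE x in lborel. norm (k x * \<theta> x) \<le> norm (B * (indicator (cball 0 R) x *\<^sub>R k x))"
  proof (rule AE_I2)
    fix x show "norm (k x * \<theta> x) \<le> norm (B * (indicator (cball 0 R) x *\<^sub>R k x))"
      using mult_left_mono[OF \<theta>(1)[of x], of "\<bar>k x\<bar>"] \<theta>(2) by (simp add: abs_mult ac_simps)
  qed
qed measurable

lemma locally_integrable_lborel:
  fixes f :: "'a::euclidean_space \<Rightarrow> 'b::{banach, second_countable_topology}"
  assumes "locally_integrable f" and [measurable]: "f \<in> borel_measurable borel" and "compact K"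
  shows "set_integrable lborel K f"
proof -
  have [measurable]: "K \<in> sets borel" using assms by (simp add: compact_imp_closed borel_closed)
  have "integrable lebesgue (\<lambda>x. indicator K x *\<^sub>R f x)"
    using assms by (simp add: locally_integrable_def set_integrable_def)
  then show ?thesis unfolding set_integrable_def by (subst (asm) integrable_completion) auto
qed

text \<open>Tested against \<open>\<phi>\<close>, the increment along \<open>h\<close> becomes the integral over \<open>s \<in> [0, 1]\<close> of
  \<open>- u\<close> times the derivative of the translate \<open>\<phi>(\<cdot> - s h)\<close>, to which the definition of the weak gradient applies.\<close>

lemma weak_gradient_segment:
  fixes u :: "'a::euclidean_space \<Rightarrow> real" and g :: "'a \<Rightarrow> 'a" and h :: 'a
  assumes [measurable]: "u \<in> borel_measurable borel" "g \<in> borel_measurable borel"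
    and wg: "has_weak_gradient u g"
  shows "AE x in lborel. u (x + h) - u x = (LINT s|lborel. indicator {0..1} s * (g (x + s *\<^sub>R h) \<bullet> h))"
proof -
  have u_int: "set_integrable lborel K u" and g_int: "set_integrable lborel K g" if "compact K" for K
    using wg that by (auto simp: has_weak_gradient_def intro: locally_integrable_lborel)
  define k where "k x = g x \<bullet> h" for x
  have [measurable]: "k \<in> borel_measurable borel" unfolding k_def by measurable
  have k_int: "set_integrable lborel K k" if "compact K" for K
    using integrable_inner_left[OF g_int[OF that, unfolded set_integrable_def], of h]
    unfolding set_integrable_def k_def by simp
  define G where "G x = (LINT s|lborel. indicator {0..1} s * k (x + s *\<^sub>R h))" for x
  have [measurable]: "G \<in> borel_measurable borel"
    unfolding G_def[abs_def] by measurable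
  have Gint: "integrable lborel (\<lambda>x. G x * \<theta> x)"
    and Geq: "(LINT x|lborel. G x * \<theta> x) = (LINT s|lborel. indicator {0..1} s * (LINT x|lborel. k (x + s *\<^sub>R h) * \<theta> x))"
    if [measurable]: "\<theta> \<in> borel_measurable borel" and "\<And>x. \<bar>\<theta> x\<bar> \<le> B * indicator (cball 0 R) x" "B \<ge> 0" for \<theta> B R
  proof -
    note I = segment_integral_finite[OF _ k_int that, where h = h, simplified]
    have *: "(LINT s|lborel. indicator {0..1} s * k (x + s *\<^sub>R h) * \<theta> x) = G x * \<theta> x" for x
      unfolding G_def by (simp add: integral_mult_left_zero)
    show "integrable lborel (\<lambda>x. G x * \<theta> x)"
      using lborel_pair.integrable_fst'[OF I] by (simp add: * del: integral_mult_left_zero)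
    have "(LINT x|lborel. indicator {0..1} s * k (x + s *\<^sub>R h) * \<theta> x) = indicator {0..1} s * (LINT x|lborel. k (x + s *\<^sub>R h) * \<theta> x)" for s :: real
      by (simp add: mult.assoc)
    then show "(LINT x|lborel. G x * \<theta> x) = (LINT s|lborel. indicator {0..1} s * (LINT x|lborel. k (x + s *\<^sub>R h) * \<theta> x))"
      using lborel_pair.Fubini_integral[OF I] unfolding * by simp
  qed
  \<comment> \<open>The definition of the weak gradient speaks of basis directions only; expanding
    \<open>h\<close> in the basis extends it to the direction \<open>h\<close>.\<close>
  have weak: "(LINT x|lborel. u x * frechet_derivative \<phi> (at x) h) = - (LINT x|lborel. k x * \<phi> x)"
    if \<phi>: "test_function \<phi>" for \<phi>
  proof -
    have [measurable]: "\<phi> \<in> borel_measurable borel" "(\<lambda>x. frechet_derivative \<phi> (at x) b) \<in> borel_measurable borel" for b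
      using test_functionD[OF \<phi>] by (auto intro: borel_measurable_continuous_onI)
    have eq: "(LINT x|lborel. u x * frechet_derivative \<phi> (at x) b) = - (LINT x|lborel. (g x \<bullet> b) * \<phi> x)" if "b \<in> Basis" for b
      using wg \<phi> that unfolding has_weak_gradient_def by (auto simp: integral_completion)
    have i1: "integrable lborel (\<lambda>x. u x * frechet_derivative \<phi> (at x) b)" for b
    proof -
      obtain R where "\<And>x. x \<notin> cball 0 R \<Longrightarrow> frechet_derivative \<phi> (at x) b = 0"
        using test_function_support[OF \<phi>] by metis
      then obtain B where "B \<ge> 0" "\<And>x. \<bar>frechet_derivative \<phi> (at x) b\<bar> \<le> B * indicator (cball 0 R) x"
        using continuous_support_bounded[OF test_function_derivative_continuous[OF \<phi>, of b]] by blast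
      then show ?thesis by (intro locally_integrable_mult_bounded[OF u_int[OF compact_cball], where R = R and B = B]) auto
    qed
    have i2: "integrable lborel (\<lambda>x. (g x \<bullet> b) * \<phi> x)" for b
    proof -
      obtain R where "\<And>x. x \<notin> cball 0 R \<Longrightarrow> \<phi> x = 0"
        using test_function_support[OF \<phi>] by metis
      then obtain B where B: "B \<ge> 0" "\<And>x. \<bar>\<phi> x\<bar> \<le> B * indicator (cball 0 R) x"
        using continuous_support_bounded[OF test_function_continuous[OF \<phi>]] by blast
      have "set_integrable lborel (cball 0 R) (\<lambda>x. g x \<bullet> b)"
        using integrable_inner_left[OF g_int[OF compact_cball, unfolded set_integrable_def], of 0 R b]
        by (simp add: set_integrable_def)
      then show ?thesis using B by (intro locally_integrable_mult_bounded[where R = R and B = B]) auto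
    qed
    have D: "frechet_derivative \<phi> (at x) h = (\<Sum>b\<in>Basis. (h \<bullet> b) * frechet_derivative \<phi> (at x) b)" for x
      using test_function_differentiable[OF \<phi>] by (rule frechet_derivative_basis_sum)
    have kx: "k x = (\<Sum>b\<in>Basis. (h \<bullet> b) * (g x \<bullet> b))" for x
      unfolding k_def by (subst euclidean_inner) (simp add: mult.commute)
    have "(LINT x|lborel. u x * frechet_derivative \<phi> (at x) h)
       = (LINT x|lborel. (\<Sum>b\<in>Basis. (h \<bullet> b) * (u x * frechet_derivative \<phi> (at x) b)))"
      unfolding D by (simp add: sum_distrib_left ac_simps)
    also have "\<dots> = (\<Sum>b\<in>Basis. (h \<bullet> b) * (LINT x|lborel. u x * frechet_derivative \<phi> (at x) b))"
      using i1 by (subst Bochner_Integration.integral_sum) auto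
    also have "\<dots> = - (\<Sum>b\<in>Basis. (h \<bullet> b) * (LINT x|lborel. (g x \<bullet> b) * \<phi> x))"
      by (simp add: eq sum_negf)
    also have "(\<Sum>b\<in>Basis. (h \<bullet> b) * (LINT x|lborel. (g x \<bullet> b) * \<phi> x)) = (LINT x|lborel. (\<Sum>b\<in>Basis. (h \<bullet> b) * ((g x \<bullet> b) * \<phi> x)))"
      using i2 by (subst Bochner_Integration.integral_sum) auto
    also have "\<dots> = (LINT x|lborel. k x * \<phi> x)"
      unfolding kx by (simp add: sum_distrib_right sum_distrib_left ac_simps)
    finally show ?thesis .
  qed
  have main: "(LINT x|lborel. (u (x + h) - u x - G x) * \<phi> x) = 0" if \<phi>: "test_function \<phi>" for \<phi>
  proof -
    have [measurable]: "\<phi> \<in> borel_measurable borel" "(\<lambda>x. frechet_derivative \<phi> (at x) b) \<in> borel_measurable borel" for b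
      using test_functionD[OF \<phi>] by (auto intro: borel_measurable_continuous_onI)
    define \<psi> where "\<psi> x = frechet_derivative \<phi> (at x) h" for x
    have [measurable]: "\<psi> \<in> borel_measurable borel" unfolding \<psi>_def by measurable
    have \<psi>_cont: "continuous_on UNIV \<psi>" unfolding \<psi>_def using test_function_derivative_continuous[OF \<phi>] .
    obtain R where R: "R > 0" "\<And>x. x \<notin> cball 0 R \<Longrightarrow> \<phi> x = 0" "\<And>x. x \<notin> cball 0 R \<Longrightarrow> \<psi> x = 0"
      using test_function_support[OF \<phi>] unfolding \<psi>_def by metis
    obtain B where B: "B \<ge> 0" "\<And>x. \<bar>\<phi> x\<bar> \<le> B * indicator (cball 0 R) x"
      using continuous_support_bounded[OF test_function_continuous[OF \<phi>] R(2)] by blast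
    obtain B' where B': "B' \<ge> 0" "\<And>x. \<bar>\<psi> x\<bar> \<le> B' * indicator (cball 0 R) x"
      using continuous_support_bounded[OF \<psi>_cont R(3)] by blast
    have shift: "\<bar>\<theta> (x - s *\<^sub>R h)\<bar> \<le> C * indicator (cball 0 (R + norm h)) x"
      if \<theta>: "\<And>x. \<bar>\<theta> x\<bar> \<le> C * indicator (cball 0 R) x" "C \<ge> 0" and s: "s \<in> {0..1}" for \<theta> :: "'a \<Rightarrow> real" and C s x
    proof (cases "x - s *\<^sub>R h \<in> cball 0 R")
      case True
      have "norm x \<le> norm (x - s *\<^sub>R h) + norm (s *\<^sub>R h)" using norm_triangle_sub[of x "s *\<^sub>R h"] by (simp add: add.commute)
      also have "norm (s *\<^sub>R h) = s * norm h" using s by simp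
      also have "norm (x - s *\<^sub>R h) + s * norm h \<le> R + norm h" using s True by (intro add_mono) (auto intro: mult_left_le_one_le)
      finally show ?thesis using \<theta>(1)[of "x - s *\<^sub>R h"] True by simp
    next
      case False
      then show ?thesis using \<theta>(1)[of "x - s *\<^sub>R h"] \<theta>(2) by simp
    qed
    \<comment> \<open>The fundamental theorem of calculus is applied to the smooth
      \<open>\<phi>\<close>, onto which the increment of \<open>u\<close> is moved.\<close>
    have FTC: "\<phi> (x - h) - \<phi> x = (LINT s|lborel. - (indicator {0..1} s * \<psi> (x - s *\<^sub>R h)))" for x
    proof -
      have "((\<lambda>s. \<phi> (x - s *\<^sub>R h)) has_vector_derivative - \<psi> (x - s *\<^sub>R h)) (at s within {0..1})" for s
      proof -
        have "((\<lambda>s. x - s *\<^sub>R h) has_derivative (\<lambda>s. - (s *\<^sub>R h))) (at s within {0..1})"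
          by (auto intro!: derivative_eq_intros)
        moreover have D: "(\<phi> has_derivative frechet_derivative \<phi> (at (x - s *\<^sub>R h))) (at (x - s *\<^sub>R h))"
          using test_function_differentiable[OF \<phi>] by (simp add: frechet_derivative_works)
        ultimately have "((\<lambda>s. \<phi> (x - s *\<^sub>R h)) has_derivative (\<lambda>t. frechet_derivative \<phi> (at (x - s *\<^sub>R h)) (- (t *\<^sub>R h)))) (at s within {0..1})"
          by (rule has_derivative_compose)
        moreover have "linear (frechet_derivative \<phi> (at (x - s *\<^sub>R h)))"
          using test_function_differentiable[OF \<phi>] by (rule linear_frechet_derivative)
        ultimately show ?thesis
          unfolding has_vector_derivative_def \<psi>_def by (simp add: linear_neg linear_cmul)
      qed
      moreover have "continuous_on {0..1} (\<lambda>s. - \<psi> (x - s *\<^sub>R h))"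
        by (intro continuous_intros continuous_on_compose2[OF \<psi>_cont]) auto
      ultimately have "(LINT s|lborel. indicator {0..1} s *\<^sub>R - \<psi> (x - s *\<^sub>R h)) = \<phi> (x - 1 *\<^sub>R h) - \<phi> (x - 0 *\<^sub>R h)"
        by (intro integral_FTC_atLeastAtMost) auto
      then show ?thesis by simp
    qed
    have "integrable lborel (\<lambda>x. u x * \<phi> (x - h))"
      using shift[OF B(2,1), of 1] B by (intro locally_integrable_mult_bounded[OF u_int[OF compact_cball], where R = "R + norm h" and B = B]) auto
    from integrable_lborel_translate[OF this, of h]
    have I1: "integrable lborel (\<lambda>x. u (x + h) * \<phi> x)" by simp
    have I2: "integrable lborel (\<lambda>x. u x * \<phi> x)" using B by (intro locally_integrable_mult_bounded[OF u_int[OF compact_cball], where R = R and B = B]) auto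
    have I3: "integrable lborel (\<lambda>x. G x * \<phi> x)" using B by (intro Gint[of _ B R]) auto
    have I4: "integrable (lborel \<Otimes>\<^sub>M lborel) (\<lambda>(x, s::real). indicator {0..1} s * u x * \<psi> (x - s *\<^sub>R h))"
    proof (rule Bochner_Integration.integrable_bound)
      \<comment> \<open>The majorant is the instance of \<open>segment_integral_finite\<close> with
        shift 0, which is where the idle term \<open>s *\<^sub>R 0\<close> comes from.\<close>
      show "integrable (lborel \<Otimes>\<^sub>M lborel) (\<lambda>(x, s::real). indicator {0..1} s * u (x + s *\<^sub>R 0) * (B' * indicator (cball 0 (R + norm h)) x))"
        using B'(1) u_int by (intro segment_integral_finite[of u _ B' "R + norm h"]) (auto intro!: borel_measurable_times borel_measurable_indicator)
      show "AE z in lborel \<Otimes>\<^sub>M lborel. norm (case z of (x, s::real) \<Rightarrow> indicator {0..1} s * u x * \<psi> (x - s *\<^sub>R h))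
        \<le> norm (case z of (x, s) \<Rightarrow> indicator {0..1} s * u (x + s *\<^sub>R 0) * (B' * indicator (cball 0 (R + norm h)) x))"
      proof (rule AE_I2, clarify)
        fix x :: 'a and s :: real
        show "norm (indicator {0..1} s * u x * \<psi> (x - s *\<^sub>R h))
        \<le> norm (indicator {0..1} s * u (x + s *\<^sub>R 0) * (B' * indicator (cball 0 (R + norm h)) x))"
        proof (cases "s \<in> {0..1}")
          case True
          from mult_left_mono[OF shift[OF B'(2,1) this, of x], of "\<bar>u x\<bar>"]
          show ?thesis using True B'(1) by (simp add: abs_mult)
        qed simp
      qed
    qed measurable
    have "(LINT x|lborel. (u (x + h) - u x) * \<phi> x) = (LINT x|lborel. u (x + h) * \<phi> x) - (LINT x|lborel. u x * \<phi> x)"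
      using I1 I2 by (simp add: left_diff_distrib)
    also have "(LINT x|lborel. u (x + h) * \<phi> x) = (LINT x|lborel. u x * \<phi> (x - h))"
      using integral_lborel_translate[of "\<lambda>x. u x * \<phi> (x - h)" h] by simp
    also have "(LINT x|lborel. u x * \<phi> (x - h)) - (LINT x|lborel. u x * \<phi> x) = (LINT x|lborel. u x * (\<phi> (x - h) - \<phi> x))"
      using \<open>integrable lborel (\<lambda>x. u x * \<phi> (x - h))\<close> I2 by (simp add: right_diff_distrib)
    also have "\<dots> = - (LINT x|lborel. LINT s|lborel. indicator {0..1} s * u x * \<psi> (x - s *\<^sub>R h))"
    proof -
      have "u x * (\<phi> (x - h) - \<phi> x) = - (LINT s|lborel. indicator {0..1} s * u x * \<psi> (x - s *\<^sub>R h))" for x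
        unfolding FTC by (simp add: integral_mult_right_zero[symmetric] ac_simps del: integral_mult_right_zero)
      then show ?thesis by simp
    qed
    also have "(LINT x|lborel. LINT s|lborel. indicator {0..1} s * u x * \<psi> (x - s *\<^sub>R h))
      = (LINT s|lborel. LINT x|lborel. indicator {0..1} s * u x * \<psi> (x - s *\<^sub>R h))"
      by (rule lborel_pair.Fubini_integral[OF I4, symmetric])
    also have "\<dots> = (LINT s|lborel. - (indicator {0..1} s * (LINT x|lborel. k (x + s *\<^sub>R h) * \<phi> x)))"
    proof (rule Bochner_Integration.integral_cong[OF refl])
      fix s :: real
      \<comment> \<open>For fixed \<open>s\<close> the translate of \<open>\<phi>\<close> is again a
        test function, so the weak gradient identity is available slice by slice.\<close>
      have "frechet_derivative (\<lambda>x. \<phi> (x - s *\<^sub>R h)) (at x) h = \<psi> (x - s *\<^sub>R h)" for x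
        unfolding \<psi>_def by (subst frechet_derivative_translate) (auto intro: test_function_differentiable[OF \<phi>])
      then have "(LINT x|lborel. u x * \<psi> (x - s *\<^sub>R h)) = - (LINT x|lborel. k x * \<phi> (x - s *\<^sub>R h))"
        using weak[OF test_function_translate[OF \<phi>, of "s *\<^sub>R h"]] by simp
      also have "(LINT x|lborel. k x * \<phi> (x - s *\<^sub>R h)) = (LINT x|lborel. k (x + s *\<^sub>R h) * \<phi> x)"
        using integral_lborel_translate[of "\<lambda>x. k x * \<phi> (x - s *\<^sub>R h)" "s *\<^sub>R h"] by simp
      finally show "(LINT x|lborel. indicator {0..1} s * u x * \<psi> (x - s *\<^sub>R h)) = - (indicator {0..1} s * (LINT x|lborel. k (x + s *\<^sub>R h) * \<phi> x))"
        by (simp add: mult.assoc)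
    qed
    also have "- \<dots> = (LINT x|lborel. G x * \<phi> x)"
      using Geq[of \<phi> B R] B by simp
    finally show ?thesis
      using I1 I2 I3 by (simp add: left_diff_distrib)
  qed
  have "AE x in lborel. u (x + h) - u x - G x = 0"
  proof (rule fundamental_lemma_calculus_of_variations[OF _ _ main])
    fix K :: "'a set" assume K: "compact K"
    then have Kb [measurable]: "K \<in> sets borel" by (simp add: compact_imp_closed borel_closed)
    obtain R where R: "K \<subseteq> cball 0 R" using K compact_imp_bounded[of K] unfolding bounded_pos
      by (auto simp: subset_iff)
    have "compact ((+) h ` K)" using K by (auto intro!: compact_continuous_image continuous_intros)
    from integrable_lborel_translate[OF u_int[OF this, unfolded set_integrable_def], of h]
    have "integrable lborel (\<lambda>x. indicator ((+) h ` K) (x + h) *\<^sub>R u (x + h))" .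
    moreover have "indicator ((+) h ` K) (x + h) = (indicator K x :: real)" for x
      by (auto simp: indicator_def image_iff add.commute)
    ultimately have 1: "integrable lborel (\<lambda>x. indicator K x * u (x + h))" by simp
    have 2: "integrable lborel (\<lambda>x. indicator K x * u x)"
      using u_int[OF K] by (simp add: set_integrable_def)
    have 3: "integrable lborel (\<lambda>x. G x * indicator K x)"
      using R by (intro Gint[of _ 1 R]) (auto simp: indicator_def)
    show "set_integrable lborel K (\<lambda>x. u (x + h) - u x - G x)"
      using 1 2 3 by (auto simp: set_integrable_def right_diff_distrib mult.commute[of "G _"] intro!: Bochner_Integration.integrable_diff)
  qed measurable
  then show ?thesis by (rule AE_mp) (auto simp: G_def k_def)
qed

abbreviation segment_integral :: "('a::euclidean_space \<Rightarrow> ennreal) \<Rightarrow> 'a \<Rightarrow> 'a \<Rightarrow> ennreal" where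
  "segment_integral k h x \<equiv> (\<integral>\<^sup>+s\<in>{0..1}. k (x + s *\<^sub>R h) \<partial>lborel)"

lemma weak_gradient_translation:
  fixes u :: "'a::euclidean_space \<Rightarrow> real" and g :: "'a \<Rightarrow> 'a" and h :: 'a
  assumes [measurable]: "u \<in> borel_measurable borel" "g \<in> borel_measurable borel"
    and wg: "has_weak_gradient u g"
  shows "AE x in lborel. ennreal \<bar>u (x + h) - u x\<bar>
     \<le> ennreal (norm h) * segment_integral (\<lambda>y. ennreal (norm (g y))) h x"
  using weak_gradient_segment[OF assms, of h]
proof (rule AE_mp, intro AE_I2 impI)
  fix x
  let ?f = "\<lambda>s. indicator {0..1} s * (g (x + s *\<^sub>R h) \<bullet> h)"
  assume eq: "u (x + h) - u x = (LINT s|lborel. ?f s)"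
  have "ennreal \<bar>LINT s|lborel. ?f s\<bar> \<le> (\<integral>\<^sup>+s. ennreal (norm (?f s)) \<partial>lborel)"
  \<comment> \<open>Without integrability the Bochner integral is 0 by convention and the bound is
    trivial.\<close>
  proof (cases "integrable lborel ?f")
    case True
    from integral_norm_bound_ennreal[OF this] show ?thesis by simp
  qed (simp add: not_integrable_integral_eq)
  also have "\<dots> \<le> (\<integral>\<^sup>+s. ennreal (norm h) * (ennreal (norm (g (x + s *\<^sub>R h))) * indicator {0..1} s) \<partial>lborel)"
  proof (rule nn_integral_mono, goal_cases)
    case (1 s)
    have "\<bar>g (x + s *\<^sub>R h) \<bullet> h\<bar> \<le> norm h * norm (g (x + s *\<^sub>R h))"
      using Cauchy_Schwarz_ineq2[of "g (x + s *\<^sub>R h)" h] by (simp add: mult.commute)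
    then show ?case
      by (auto simp: indicator_def ennreal_mult[symmetric] ennreal_leI)
  qed
  also have "\<dots> = ennreal (norm h) * segment_integral (\<lambda>y. ennreal (norm (g y))) h x"
    by (rule nn_integral_cmult) measurable
  finally show "ennreal \<bar>u (x + h) - u x\<bar> \<le> ennreal (norm h) * segment_integral (\<lambda>y. ennreal (norm (g y))) h x"
    by (simp add: eq)
qed

section \<open>Higher integrability\<close>

lemma powr_diff_le:
  fixes a b P :: real
  assumes "0 \<le> a" "0 \<le> b" "P \<ge> 1"
  shows "\<bar>a powr P - b powr P\<bar> \<le> P * \<bar>a - b\<bar> * max a b powr (P - 1)"
proof -
  have *: "\<bar>y powr P - x powr P\<bar> \<le> P * \<bar>y - x\<bar> * y powr (P - 1)" if "0 \<le> x" "x < y" for x y :: real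
  proof -
    have "continuous_on {x..y} (\<lambda>t. t powr P)"
      using assms that by (intro continuous_on_powr' continuous_intros) auto
    moreover have "(\<lambda>t. t powr P) differentiable (at t)" if "x < t" "t < y" for t
      using that \<open>0 \<le> x\<close> by (auto intro!: derivative_eq_intros simp: real_differentiable_def)
    ultimately have "\<exists>l z. x < z \<and> z < y \<and> DERIV (\<lambda>t. t powr P) z :> l \<and> y powr P - x powr P = (y - x) * l"
      using MVT[of x y "\<lambda>t. t powr P"] \<open>x < y\<close> by simp
    then obtain l z where z: "x < z" "z < y" "DERIV (\<lambda>t. t powr P) z :> l" "y powr P - x powr P = (y - x) * l"
      by blast
    have "DERIV (\<lambda>t. t powr P) z :> P * z powr (P - 1)"
      using z that by (intro has_real_derivative_powr) auto
    then have l: "l = P * z powr (P - 1)" using z(3) DERIV_unique by blast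
    have "z powr (P - 1) \<le> y powr (P - 1)" using z that assms by (intro powr_mono2) auto
    then have "(y - x) * (P * z powr (P - 1)) \<le> (y - x) * (P * y powr (P - 1))"
      using that assms by (intro mult_left_mono) auto
    moreover have "0 \<le> (y - x) * (P * z powr (P - 1))" using that assms by simp
    ultimately show ?thesis using z(4) that by (simp add: l ac_simps)
  qed
  consider "a < b" | "a = b" | "b < a" by linarith
  then show ?thesis
  proof cases
    case 1
    then show ?thesis using *[of a b] assms by (simp add: abs_minus_commute max_def)
  next
    case 3
    then show ?thesis using *[of b a] assms by (simp add: max_def)
  qed simp
qed

text \<open>Crude form of Young's inequality with constant 1: replacing the smaller of
  \<open>x\<close> and \<open>y\<close> by the larger one produces one of the two summands. It will
  separate the gradient from the power of the function.\<close>

lemma mult_powr_le_add_powr: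
  fixes x y P :: real
  assumes "0 \<le> x" "0 \<le> y" "P \<ge> 1"
  shows "x * y powr (P - 1) \<le> x powr P + y powr P"
proof (cases "x = 0 \<or> y = 0")
  case False
  have e: "z * z powr (P - 1) = z powr P" if "z > 0" for z :: real
    using that powr_add[of z 1 "P - 1"] by simp
  show ?thesis
  proof (cases "x \<le> y")
    case True
    have "x * y powr (P - 1) \<le> y * y powr (P - 1)" using True by (intro mult_right_mono) auto
    then show ?thesis using e[of y] False assms powr_ge_zero[of x P] by linarith
  next
    case f: False
    have "x * y powr (P - 1) \<le> x * x powr (P - 1)" using f assms by (intro mult_left_mono powr_mono2) auto
    then show ?thesis using e[of x] False assms powr_ge_zero[of y P] by linarith
  qed
qed (auto simp: powr_def)

text \<open>Compare \<open>f\<close> with its mean over the ball of measure \<open>C / t\<close>: that mean is at most \<open>t\<close>, hence at most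
  half of \<open>f\<close> on the superlevel set.\<close>

lemma superlevel_integral_le:
  fixes f :: "'a::euclidean_space \<Rightarrow> real"
  assumes [measurable]: "f \<in> borel_measurable borel" and nonneg: "\<And>x. f x \<ge> 0"
    and C: "(\<integral>\<^sup>+x. ennreal (f x) \<partial>lborel) \<le> ennreal C" "C > 0"
    and K: "\<And>h. (\<integral>\<^sup>+x. ennreal \<bar>f (x + h) - f x\<bar> \<partial>lborel) \<le> ennreal (K * norm h)" "K \<ge> 0"
    and t: "t > 0"
  defines "d \<equiv> real DIM('a)"
  shows "(\<integral>\<^sup>+x. ennreal (f x) * indicator {x. f x \<ge> 2 * t} x \<partial>lborel)
     \<le> ennreal (2 * K * (C / (unit_ball_vol d * t)) powr (1 / d))"
proof -
  \<comment> \<open>Radius of the ball of measure \<open>C / t\<close>, so that the mean of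
    \<open>f\<close> over any ball of this radius is at most \<open>t\<close>.\<close>
  define \<epsilon> where "\<epsilon> = (C / (unit_ball_vol d * t)) powr (1 / d)"
  have d: "d > 0" by (simp add: d_def)
  have v: "unit_ball_vol d > 0" unfolding d_def by simp
  have \<epsilon>: "\<epsilon> > 0" unfolding \<epsilon>_def using C t v by simp
  have "\<epsilon> ^ DIM('a) = C / (unit_ball_vol d * t)"
  proof -
    have z: "C / (unit_ball_vol d * t) > 0" using C t v by simp
    then have "\<epsilon> ^ DIM('a) = \<epsilon> powr d" using \<epsilon> by (simp add: d_def powr_realpow)
    also have "\<dots> = C / (unit_ball_vol d * t)" unfolding \<epsilon>_def powr_powr using d z abs_of_pos[OF z] by (simp del: abs_divide)
    finally show ?thesis .
  qed
  then have m: "emeasure lborel (ball 0 \<epsilon> :: 'a set) = ennreal (C / t)"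
    using \<epsilon> v by (simp add: emeasure_ball flip: d_def)
  have [measurable]: "(ball 0 \<epsilon> :: 'a set) \<in> sets borel" by simp
  define D where "D x = (\<integral>\<^sup>+h\<in>ball 0 \<epsilon>. ennreal \<bar>f (x + h) - f x\<bar> \<partial>lborel)" for x
  have [measurable]: "D \<in> borel_measurable borel" unfolding D_def[abs_def] by measurable
  have ptw: "ennreal (f x) * indicator {x. f x \<ge> 2 * t} x \<le> ennreal (2 * t / C) * D x" for x
  \<comment> \<open>In the remaining cases the left side is 0 or the right side is infinite.\<close>
  proof (cases "f x \<ge> 2 * t \<and> D x < \<infinity>")
    case True
    have "ennreal (f x * (C / t)) = (\<integral>\<^sup>+h\<in>ball 0 \<epsilon>. ennreal (f x) \<partial>(lborel :: 'a measure))"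
      using m C t nonneg[of x] by (subst nn_integral_cmult_indicator) (auto simp: ennreal_mult[symmetric])
    also have "\<dots> \<le> (\<integral>\<^sup>+h. ennreal \<bar>f (x + h) - f x\<bar> * indicator (ball 0 \<epsilon>) h + ennreal (f (h + x)) \<partial>lborel)"
    proof (rule nn_integral_mono, goal_cases)
      case (1 h)
      have "ennreal (f x) \<le> ennreal \<bar>f (x + h) - f x\<bar> + ennreal (f (h + x))"
        using nonneg[of "x + h"] by (simp add: add.commute[of h x] ennreal_leI flip: ennreal_plus)
      then show ?case
        by (simp add: indicator_def)
    qed
    also have "\<dots> = D x + (\<integral>\<^sup>+h. ennreal (f (h + x)) \<partial>lborel)"
      unfolding D_def by (rule nn_integral_add) measurable
    also have "(\<integral>\<^sup>+h. ennreal (f (h + x)) \<partial>lborel) = (\<integral>\<^sup>+h. ennreal (f h) \<partial>lborel)"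
      by (rule nn_integral_lborel_translate[of "\<lambda>h. ennreal (f h)"]) measurable
    also have "D x + \<dots> \<le> D x + ennreal C" using C by (intro add_left_mono) auto
    finally have le: "ennreal (f x * (C / t)) \<le> D x + ennreal C" .
    obtain r where r: "D x = ennreal r" "r \<ge> 0" using True by (cases "D x") auto
    define X where "X = f x * (C / t)"
    have "X \<le> r + C"
      using le C r nonneg[of x] t by (simp add: r(1) X_def flip: ennreal_plus)
    \<comment> \<open>On the superlevel set \<open>C\<close> is at most half of \<open>X\<close>, so
      it is absorbed: \<open>X \<le> r + C\<close> becomes \<open>X \<le> 2 * r\<close>.\<close>
    moreover have "2 * C \<le> X"
      using mult_right_mono[of "2 * t" "f x" "C / t"] True C t by (simp add: field_simps X_def)
    ultimately have "X \<le> 2 * r" by linarith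
    then have "f x \<le> (2 * t / C) * r" using C t by (simp add: field_simps X_def)
    then show ?thesis using True C t r by (simp add: ennreal_mult[symmetric] ennreal_leI)
  next
    case False
    then show ?thesis
      using C t by (cases "f x \<ge> 2 * t") (auto simp: not_less ennreal_mult_top top_unique)
  qed
  \<comment> \<open>After swapping the integrals each shift costs at most
    \<open>K * \<epsilon>\<close>, and the shifts range over a set of measure \<open>C / t\<close>,
    which the factor \<open>2 * t / C\<close> later cancels.\<close>
  have "(\<integral>\<^sup>+x. D x \<partial>lborel) = (\<integral>\<^sup>+h. \<integral>\<^sup>+x. ennreal \<bar>f (x + h) - f x\<bar> * indicator (ball 0 \<epsilon>) h \<partial>lborel \<partial>lborel)"
    unfolding D_def by (rule lborel_pair.Fubini') measurable
  also have "\<dots> \<le> (\<integral>\<^sup>+h. ennreal (K * \<epsilon>) * indicator (ball 0 \<epsilon>) (h::'a) \<partial>lborel)"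
  proof (rule nn_integral_mono, goal_cases)
    case (1 h)
    have "(\<integral>\<^sup>+x. ennreal \<bar>f (x + h) - f x\<bar> * indicator (ball 0 \<epsilon>) h \<partial>lborel)
      = (\<integral>\<^sup>+x. ennreal \<bar>f (x + h) - f x\<bar> \<partial>lborel) * indicator (ball 0 \<epsilon>) h"
      by (rule nn_integral_multc) measurable
    also have "\<dots> \<le> ennreal (K * norm h) * indicator (ball 0 \<epsilon>) h"
      by (intro mult_right_mono K) auto
    also have "\<dots> \<le> ennreal (K * \<epsilon>) * indicator (ball 0 \<epsilon>) h"
      using K by (auto simp: indicator_def intro!: ennreal_leI mult_left_mono)
    finally show ?case .
  qed
  also have "\<dots> = ennreal (K * \<epsilon>) * ennreal (C / t)"
    using m by (subst nn_integral_cmult_indicator) auto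
  finally have D: "(\<integral>\<^sup>+x. D x \<partial>lborel) \<le> ennreal (K * \<epsilon>) * ennreal (C / t)" .
  have "(\<integral>\<^sup>+x. ennreal (f x) * indicator {x. f x \<ge> 2 * t} x \<partial>lborel) \<le> (\<integral>\<^sup>+x. ennreal (2 * t / C) * D x \<partial>lborel)"
    by (rule nn_integral_mono) (rule ptw)
  also have "\<dots> = ennreal (2 * t / C) * (\<integral>\<^sup>+x. D x \<partial>lborel)"
    by (rule nn_integral_cmult) measurable
  also have "\<dots> \<le> ennreal (2 * t / C) * (ennreal (K * \<epsilon>) * ennreal (C / t))"
    by (intro mult_left_mono D) auto
  also have "\<dots> = ennreal (2 * K * \<epsilon>)"
    using C t K \<epsilon> by (simp add: ennreal_mult[symmetric])
  finally show ?thesis unfolding \<epsilon>_def .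
qed

text \<open>Dyadic decomposition: for \<open>f x\<close> between \<open>2 ^ j\<close> and
  \<open>2 ^ (j + 1)\<close> the extra power is at most \<open>2 powr ((j + 1) * \<delta>)\<close>,
  so level \<open>j\<close> contributes at most a constant times
  \<open>2 powr (j * (\<delta> - \<kappa>))\<close>. The geometric series converges because
  \<open>\<delta> < \<kappa>\<close>.\<close>

lemma higher_integrability_from_superlevels:
  fixes f :: "'a \<Rightarrow> real"
  assumes [measurable]: "f \<in> borel_measurable M" and nonneg: "\<And>x. f x \<ge> 0"
    and A: "\<And>s. s \<ge> 1 \<Longrightarrow> (\<integral>\<^sup>+x. ennreal (f x) * indicator {x. f x \<ge> s} x \<partial>M) \<le> ennreal (A * s powr (- \<kappa>))"
    and "A \<ge> 0" and \<delta>: "0 < \<delta>" "\<delta> < \<kappa>"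
  shows "(\<integral>\<^sup>+x. ennreal (f x powr (1 + \<delta>)) * indicator {x. f x \<ge> 1} x \<partial>M)
    \<le> ennreal (A * 2 powr \<delta> / (1 - 2 powr (\<delta> - \<kappa>)))"
proof -
  let ?g = "\<lambda>j x. ennreal (2 powr (real (Suc j) * \<delta>)) * (ennreal (f x) * indicator {x. f x \<ge> 2 ^ j} x)"
  have ptw: "ennreal (f x powr (1 + \<delta>)) * indicator {x. f x \<ge> 1} x \<le> (\<Sum>j. ?g j x)" for x
  proof (cases "f x \<ge> 1")
    case True
    define j where "j = nat \<lfloor>log 2 (f x)\<rfloor>"
    have l0: "0 \<le> log 2 (f x)" using True by simp
    have j: "real j \<le> log 2 (f x)" "log 2 (f x) \<le> real (Suc j)"
      unfolding j_def using l0 by linarith+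
    have "2 powr real j \<le> f x" using j(1) True by (simp add: le_log_iff)
    then have j1: "2 ^ j \<le> f x" by (simp add: powr_realpow)
    have j2: "f x \<le> 2 powr real (Suc j)" using j(2) True by (simp add: log_le_iff del: of_nat_Suc)
    have "f x powr (1 + \<delta>) = f x * f x powr \<delta>" using True by (simp add: powr_add)
    also have "\<dots> \<le> f x * (2 powr real (Suc j)) powr \<delta>"
      using j2 True \<delta> by (intro mult_left_mono powr_mono2) auto
    also have "(2 powr real (Suc j)) powr \<delta> = 2 powr (real (Suc j) * \<delta>)" by (rule powr_powr)
    finally have "f x powr (1 + \<delta>) \<le> 2 powr (real (Suc j) * \<delta>) * f x" using nonneg[of x] by (simp add: mult.commute)
    then have "ennreal (f x powr (1 + \<delta>)) \<le> ?g j x"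
      using j1 nonneg[of x] by (simp add: ennreal_mult[symmetric] ennreal_leI del: of_nat_Suc)
    also have "\<dots> \<le> (\<Sum>j. ?g j x)"
      using sum_le_suminf[of "\<lambda>j. ?g j x" "{j}"] by simp
    finally show ?thesis using True by simp
  qed simp
  have q: "0 < 2 powr (\<delta> - \<kappa>)" "2 powr (\<delta> - \<kappa>) < (1::real)" using \<delta> by (auto simp: powr_less_one)
  have "(\<integral>\<^sup>+x. ennreal (f x powr (1 + \<delta>)) * indicator {x. f x \<ge> 1} x \<partial>M) \<le> (\<integral>\<^sup>+x. (\<Sum>j. ?g j x) \<partial>M)"
    by (rule nn_integral_mono) (rule ptw)
  also have "\<dots> = (\<Sum>j. \<integral>\<^sup>+x. ?g j x \<partial>M)"
    by (rule nn_integral_suminf) measurable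
  also have "\<dots> \<le> (\<Sum>j. ennreal (A * 2 powr \<delta> * (2 powr (\<delta> - \<kappa>)) ^ j))"
  proof (rule suminf_le[OF _ summableI summableI], goal_cases)
    case (1 j)
    have "(\<integral>\<^sup>+x. ?g j x \<partial>M) = ennreal (2 powr (real (Suc j) * \<delta>)) * (\<integral>\<^sup>+x. ennreal (f x) * indicator {x. f x \<ge> 2 ^ j} x \<partial>M)"
      by (rule nn_integral_cmult) measurable
    also have "\<dots> \<le> ennreal (2 powr (real (Suc j) * \<delta>)) * ennreal (A * (2 ^ j) powr (- \<kappa>))"
      by (intro mult_left_mono A) auto
    also have "\<dots> = ennreal (2 powr (real (Suc j) * \<delta>) * (A * (2 ^ j) powr (- \<kappa>)))"
      using \<open>A \<ge> 0\<close> by (simp add: ennreal_mult)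
    also have "2 powr (real (Suc j) * \<delta>) * (A * (2 ^ j) powr (- \<kappa>)) = A * 2 powr \<delta> * (2 powr (\<delta> - \<kappa>)) ^ j"
    proof -
      have "(2 powr (\<delta> - \<kappa>)) ^ j = 2 powr ((\<delta> - \<kappa>) * real j)"
        by (subst powr_realpow[symmetric]) (auto simp: powr_powr)
      moreover have "((2::real) ^ j) powr (- \<kappa>) = 2 powr (- \<kappa> * real j)"
        by (subst powr_realpow[symmetric]) (auto simp: powr_powr mult.commute)
      ultimately show ?thesis by (simp add: powr_add[symmetric] algebra_simps)
    qed
    finally show ?case .
  qed
  also have "\<dots> = ennreal (\<Sum>j. A * 2 powr \<delta> * (2 powr (\<delta> - \<kappa>)) ^ j)"
    using q \<open>A \<ge> 0\<close> by (intro suminf_ennreal2) (auto intro!: summable_mult summable_geometric)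
  also have "(\<Sum>j. A * 2 powr \<delta> * (2 powr (\<delta> - \<kappa>)) ^ j) = A * 2 powr \<delta> / (1 - 2 powr (\<delta> - \<kappa>))"
    using q by (subst suminf_mult) (auto intro!: summable_geometric simp: suminf_geometric)
  finally show ?thesis .
qed

abbreviation tail_power :: "'a measure \<Rightarrow> real \<Rightarrow> real \<Rightarrow> ('a \<Rightarrow> real) \<Rightarrow> ennreal" where
  "tail_power M r b f \<equiv> (\<integral>\<^sup>+x. ennreal (f x powr r) * indicator {x. f x > b} x \<partial>M)"

text \<open>The truncation at height \<open>1\<close> confines the increments to a set of finite measure; outside it the gradient
  is not known to have an integrable \<open>P\<close>-th power.\<close>

lemma truncated_power_translation:
  fixes u :: "'a::euclidean_space \<Rightarrow> real" and g :: "'a \<Rightarrow> 'a"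
  assumes [measurable]: "u \<in> borel_measurable borel" "g \<in> borel_measurable borel"
    and wg: "has_weak_gradient u g" and P: "P \<ge> 1"
    and A: "emeasure lborel {x. \<bar>u x\<bar> > 1} \<le> ennreal C"
    and w: "(\<integral>\<^sup>+x. ennreal (max (\<bar>u x\<bar> - 1) 0 powr P) \<partial>lborel) \<le> ennreal C"
    and g: "tail_power lborel P 1 (\<lambda>x. norm (g x)) \<le> ennreal C"
    and "C > 0"
  shows "(\<integral>\<^sup>+x. ennreal \<bar>max (\<bar>u (x + h)\<bar> - 1) 0 powr P - max (\<bar>u x\<bar> - 1) 0 powr P\<bar> \<partial>lborel)
     \<le> ennreal (5 * P * C * norm h)"
proof -
  define A' where "A' = {x. \<bar>u x\<bar> > 1}"
  define w' where "w' x = max (\<bar>u x\<bar> - 1) 0" for x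
  define f where "f x = w' x powr P" for x
  define \<gamma> where "\<gamma> x = ennreal (norm (g x) powr P) * indicator {x. norm (g x) > 1} x" for x
  have [measurable]: "A' \<in> sets borel" "w' \<in> borel_measurable borel" "f \<in> borel_measurable borel" "\<gamma> \<in> borel_measurable borel"
    unfolding A'_def w'_def f_def \<gamma>_def by measurable
  \<comment> \<open>Five summands, each with integral at most \<open>C\<close>; this is the 5 in the
    bound.\<close>
  define S where "S x = indicator A' x + indicator A' (x + h) + segment_integral \<gamma> h x + ennreal (f x) + ennreal (f (x + h))" for x
  have ptw: "AE x in lborel. ennreal \<bar>f (x + h) - f x\<bar> \<le> ennreal (P * norm h) * S x"
    using weak_gradient_translation[OF assms(1-3), of h]
  proof (rule AE_mp, intro AE_I2 impI)
    fix x
    assume tr: "ennreal \<bar>u (x + h) - u x\<bar> \<le> ennreal (norm h) * segment_integral (\<lambda>y. ennreal (norm (g y))) h x"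
    show "ennreal \<bar>f (x + h) - f x\<bar> \<le> ennreal (P * norm h) * S x"
    proof (cases "x \<in> A' \<or> x + h \<in> A'")
      case False
      then have "f (x + h) = f x" by (auto simp: A'_def f_def w'_def)
      then show ?thesis by simp
    next
      case True
      define m where "m = max (w' (x + h)) (w' x)"
      have m0: "m \<ge> 0" by (simp add: m_def w'_def)
      have wn: "w' y \<ge> 0" for y by (simp add: w'_def)
      have mP: "m powr P \<le> f x + f (x + h)" unfolding m_def f_def by (simp add: max_def)
      have "\<bar>f (x + h) - f x\<bar> \<le> P * \<bar>w' (x + h) - w' x\<bar> * m powr (P - 1)"
        unfolding f_def m_def by (rule powr_diff_le) (use wn P in auto)
      also have "\<dots> \<le> P * \<bar>u (x + h) - u x\<bar> * m powr (P - 1)"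
        using P by (intro mult_right_mono mult_left_mono) (auto simp: w'_def)
      finally have "ennreal \<bar>f (x + h) - f x\<bar> \<le> ennreal (P * m powr (P - 1)) * ennreal \<bar>u (x + h) - u x\<bar>"
        using P by (simp add: ennreal_mult[symmetric] ennreal_leI ac_simps)
      also have "\<dots> \<le> ennreal (P * m powr (P - 1)) * (ennreal (norm h) * segment_integral (\<lambda>y. ennreal (norm (g y))) h x)"
        by (intro mult_left_mono tr) auto
      also have "\<dots> = ennreal (P * norm h) * (ennreal (m powr (P - 1)) * segment_integral (\<lambda>y. ennreal (norm (g y))) h x)"
        using P by (simp add: ennreal_mult ac_simps)
      also have "ennreal (m powr (P - 1)) * segment_integral (\<lambda>y. ennreal (norm (g y))) h x
          = (\<integral>\<^sup>+s. ennreal (m powr (P - 1)) * (ennreal (norm (g (x + s *\<^sub>R h))) * indicator {0..1} s) \<partial>lborel)"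
        by (rule nn_integral_cmult[symmetric]) measurable
      also have "\<dots> \<le> (\<integral>\<^sup>+s. (1 + ennreal (f x) + ennreal (f (x + h))) * indicator {0..1} s + \<gamma> (x + s *\<^sub>R h) * indicator {0..1} s \<partial>lborel)"
      proof (rule nn_integral_mono, goal_cases)
        case (1 s)
        let ?n = "norm (g (x + s *\<^sub>R h))"
        have "?n * m powr (P - 1) \<le> ?n powr P + m powr P"
          using m0 P by (intro mult_powr_le_add_powr) auto
        also have "\<dots> \<le> ?n powr P + (f x + f (x + h))" using mP by simp
        finally have "ennreal (m powr (P - 1)) * ennreal ?n \<le> ennreal (?n powr P + (f x + f (x + h)))"
          by (simp add: ennreal_mult[symmetric] ennreal_leI mult.commute)
        also have "\<dots> = ennreal (?n powr P) + (ennreal (f x) + ennreal (f (x + h)))"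
          by (simp add: f_def ennreal_plus)
        \<comment> \<open>A gradient of norm at most 1 is not seen by \<open>\<gamma>\<close>, but
          its \<open>P\<close>-th power is at most 1. That constant is charged to \<open>x\<close>
          or \<open>x + h\<close> lying in \<open>A'\<close>, which is what the two indicators in
          \<open>S\<close> are for.\<close>
        also have "\<dots> \<le> (1 + \<gamma> (x + s *\<^sub>R h)) + (ennreal (f x) + ennreal (f (x + h)))"
        proof (rule add_right_mono)
          show "ennreal (?n powr P) \<le> 1 + \<gamma> (x + s *\<^sub>R h)"
          proof (cases "?n > 1")
            case False
            then have "?n powr P \<le> 1" using P by (intro powr_le1) auto
            then show ?thesis using ennreal_leI[of "?n powr P" 1] by (simp add: add_increasing2)
          qed (simp add: \<gamma>_def)
        qed
        finally show ?case
          by (simp add: indicator_def ac_simps)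
      qed
      also have "\<dots> = (1 + ennreal (f x) + ennreal (f (x + h))) + segment_integral \<gamma> h x"
        by (subst nn_integral_add) (auto simp: nn_integral_cmult_indicator)
      also have "\<dots> \<le> S x"
      proof -
        have "(1::ennreal) \<le> indicator A' x + indicator A' (x + h)"
          using True by (auto simp: indicator_def)
        then show ?thesis unfolding S_def by (simp add: ac_simps add_left_mono add_mono)
      qed
      finally show ?thesis by (simp add: mult_left_mono)
    qed
  qed
  have tr_eq: "(\<integral>\<^sup>+x. k (x + h') \<partial>lborel) = (\<integral>\<^sup>+x. k x \<partial>lborel)" if "k \<in> borel_measurable borel" for k :: "'a \<Rightarrow> ennreal" and h'
    using that by (rule nn_integral_lborel_translate)
  \<comment> \<open>By Tonelli and translation invariance, averaging along the segment leaves the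
    integral of \<open>\<gamma>\<close> unchanged.\<close>
  have "(\<integral>\<^sup>+x. segment_integral \<gamma> h x \<partial>lborel) = (\<integral>\<^sup>+s. \<integral>\<^sup>+x. \<gamma> (x + s *\<^sub>R h) * indicator {0..1} s \<partial>lborel \<partial>lborel)"
    by (rule lborel_pair.Fubini') measurable
  also have "\<dots> = (\<integral>\<^sup>+s. (\<integral>\<^sup>+x. \<gamma> x \<partial>lborel) * indicator {0..1} (s::real) \<partial>lborel)"
    by (intro nn_integral_cong) (simp add: nn_integral_multc tr_eq)
  also have "\<dots> = (\<integral>\<^sup>+x. \<gamma> x \<partial>lborel)"
    by (simp add: nn_integral_cmult_indicator)
  finally have \<gamma>: "(\<integral>\<^sup>+x. segment_integral \<gamma> h x \<partial>lborel) = (\<integral>\<^sup>+x. \<gamma> x \<partial>lborel)" .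
  have Aeq: "(\<integral>\<^sup>+x. indicator A' x \<partial>lborel) = emeasure lborel A'" by simp
  have "(\<integral>\<^sup>+x. S x \<partial>lborel) = emeasure lborel A' + emeasure lborel A' + (\<integral>\<^sup>+x. \<gamma> x \<partial>lborel) + (\<integral>\<^sup>+x. ennreal (f x) \<partial>lborel) + (\<integral>\<^sup>+x. ennreal (f x) \<partial>lborel)"
    unfolding S_def
    by (simp add: nn_integral_add \<gamma> tr_eq[of "indicator A'"] tr_eq[of "\<lambda>x. ennreal (f x)"] Aeq del: nn_integral_indicator)
  also have "\<dots> \<le> ennreal C + ennreal C + ennreal C + ennreal C + ennreal C"
    using A w g by (intro add_mono) (auto simp: A'_def \<gamma>_def[abs_def] f_def w'_def)
  also have "\<dots> = ennreal (5 * C)" using \<open>C > 0\<close> by (simp flip: ennreal_plus)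
  finally have S: "(\<integral>\<^sup>+x. S x \<partial>lborel) \<le> ennreal (5 * C)" .
  have "(\<integral>\<^sup>+x. ennreal \<bar>f (x + h) - f x\<bar> \<partial>lborel) \<le> (\<integral>\<^sup>+x. ennreal (P * norm h) * S x \<partial>lborel)"
    using ptw by (rule nn_integral_mono_AE)
  also have "\<dots> = ennreal (P * norm h) * (\<integral>\<^sup>+x. S x \<partial>lborel)"
    unfolding S_def by (rule nn_integral_cmult) measurable
  also have "\<dots> \<le> ennreal (P * norm h) * ennreal (5 * C)"
    by (intro mult_left_mono S) auto
  also have "\<dots> = ennreal (5 * P * C * norm h)"
    using P \<open>C > 0\<close> by (simp add: ennreal_mult[symmetric] ac_simps)
  finally show ?thesis unfolding f_def w'_def .
qed

text \<open>Above height 2 the truncation \<open>|u| - 1\<close> is at least \<open>|u| / 2\<close>,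
  so \<open>f powr (1 + \<delta>)\<close> controls \<open>|u| powr r\<close> as soon as
  \<open>P * (1 + \<delta>) = r\<close>. The bound on \<open>r\<close> then says
  \<open>\<delta> < 1 / d\<close>, the range left open by the decay of the superlevel
  integrals.\<close>

lemma higher_integrability:
  fixes u :: "'i \<Rightarrow> 'a::euclidean_space \<Rightarrow> real" and g :: "'i \<Rightarrow> 'a \<Rightarrow> 'a" and P C r :: real
  assumes P: "P \<ge> 1" and C: "C > 0" and r: "P < r" "r < P * (1 + 1 / real DIM('a))"
    and u: "\<And>n. u n \<in> borel_measurable borel" and g: "\<And>n. g n \<in> borel_measurable borel"
    and wg: "\<And>n. has_weak_gradient (u n) (g n)"
    and lev: "\<And>n. emeasure lborel {x. \<bar>u n x\<bar> > 1} \<le> ennreal C"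
    and uP: "\<And>n. tail_power lborel P 1 (\<lambda>x. \<bar>u n x\<bar>) \<le> ennreal C"
    and gP: "\<And>n. tail_power lborel P 1 (\<lambda>x. norm (g n x)) \<le> ennreal C"
  obtains C' :: real where "C' \<ge> 0"
    "\<And>n. tail_power lborel r 2 (\<lambda>x. \<bar>u n x\<bar>) \<le> ennreal C'"
proof -
  define d where "d = real DIM('a)"
  define \<delta> where "\<delta> = r / P - 1"
  have d: "d > 0" by (simp add: d_def)
  have \<delta>: "0 < \<delta>" "\<delta> < 1 / d"
    using r P d by (auto simp: \<delta>_def d_def field_simps)
  define K where "K = 5 * P * C"
  \<comment> \<open>Constant of \<open>superlevel_integral_le\<close> at \<open>t = s / 2\<close>
    with the power of \<open>s\<close> split off. The \<open>2 powr r\<close> in \<open>C'\<close>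
    comes from \<open>|u| \<le> 2 * (|u| - 1)\<close> above height 2.\<close>
  define A where "A = 2 * K * (2 * C / unit_ball_vol d) powr (1 / d)"
  define C' where "C' = 2 powr r * (A * 2 powr \<delta> / (1 - 2 powr (\<delta> - 1 / d)))"
  have v: "unit_ball_vol d > 0" unfolding d_def by simp
  have K0: "K \<ge> 0" using P C by (simp add: K_def)
  then have A0: "A \<ge> 0" by (simp add: A_def)
  have q: "2 powr (\<delta> - 1 / d) < (1::real)" using \<delta> by (auto simp: powr_less_one)
  show ?thesis
  proof (rule that[of C'])
    show "C' \<ge> 0" using A0 q by (simp add: C'_def)
    fix n
    note [measurable] = u[of n] g[of n]
    define f where "f x = max (\<bar>u n x\<bar> - 1) 0 powr P" for x
    have [measurable]: "f \<in> borel_measurable borel" unfolding f_def by measurable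
    have "(\<integral>\<^sup>+x. ennreal (f x) \<partial>lborel) \<le> tail_power lborel P 1 (\<lambda>x. \<bar>u n x\<bar>)"
      unfolding f_def using P by (intro nn_integral_mono) (auto simp: indicator_def max_def intro!: ennreal_leI powr_mono2)
    also note uP[of n]
    finally have fC: "(\<integral>\<^sup>+x. ennreal (f x) \<partial>lborel) \<le> ennreal C" .
    have tr: "(\<integral>\<^sup>+x. ennreal \<bar>f (x + h) - f x\<bar> \<partial>lborel) \<le> ennreal (K * norm h)" for h
      unfolding f_def K_def using fC by (intro truncated_power_translation[OF _ _ wg P lev _ gP C]) (auto simp: f_def)
    have sup: "(\<integral>\<^sup>+x. ennreal (f x) * indicator {x. f x \<ge> s} x \<partial>lborel) \<le> ennreal (A * s powr (- (1 / d)))" if "s \<ge> 1" for s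
    proof -
      have "(\<integral>\<^sup>+x. ennreal (f x) * indicator {x. f x \<ge> 2 * (s / 2)} x \<partial>lborel)
        \<le> ennreal (2 * K * (C / (unit_ball_vol d * (s / 2))) powr (1 / d))"
        unfolding d_def using that by (intro superlevel_integral_le[OF _ _ fC C tr K0]) (auto simp: f_def)
      also have "2 * K * (C / (unit_ball_vol d * (s / 2))) powr (1 / d) = A * s powr (- (1 / d))"
      proof -
        have "C / (unit_ball_vol d * (s / 2)) = (2 * C / unit_ball_vol d) * inverse s"
          using v that by (simp add: field_simps)
        then have "(C / (unit_ball_vol d * (s / 2))) powr (1 / d) = (2 * C / unit_ball_vol d) powr (1 / d) * inverse s powr (1 / d)"
          using v that C by (simp only: powr_mult[of "2 * C / unit_ball_vol d" "inverse s" "1 / d"])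
        also have "inverse s powr (1 / d) = s powr (- (1 / d))"
          using that by (simp add: powr_minus inverse_powr)
        finally show ?thesis by (simp add: A_def)
      qed
      finally show ?thesis by simp
    qed
    have hi: "(\<integral>\<^sup>+x. ennreal (f x powr (1 + \<delta>)) * indicator {x. f x \<ge> 1} x \<partial>lborel)
      \<le> ennreal (A * 2 powr \<delta> / (1 - 2 powr (\<delta> - 1 / d)))"
      by (rule higher_integrability_from_superlevels[OF _ _ sup A0 \<delta>]) (auto simp: f_def)
    have "tail_power lborel r 2 (\<lambda>x. \<bar>u n x\<bar>)
      \<le> (\<integral>\<^sup>+x. ennreal (2 powr r) * (ennreal (f x powr (1 + \<delta>)) * indicator {x. f x \<ge> 1} x) \<partial>lborel)"
    proof (rule nn_integral_mono, goal_cases)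
      case (1 x)
      show ?case
      proof (cases "\<bar>u n x\<bar> > 2")
        case True
        have Pd: "P * (1 + \<delta>) = r" using P by (simp add: \<delta>_def)
        have fx: "f x = (\<bar>u n x\<bar> - 1) powr P" using True by (simp add: f_def)
        have "\<bar>u n x\<bar> powr r \<le> (2 * (\<bar>u n x\<bar> - 1)) powr r" using True r P by (intro powr_mono2) auto
        also have "\<dots> = 2 powr r * f x powr (1 + \<delta>)"
          using True unfolding fx powr_powr Pd by (simp only: powr_mult[of 2 "\<bar>u n x\<bar> - 1" r])
        finally have le: "\<bar>u n x\<bar> powr r \<le> 2 powr r * f x powr (1 + \<delta>)" .
        have "f x \<ge> 1" unfolding fx using True P by (simp add: ge_one_powr_ge_zero)
        then show ?thesis using le True by (simp add: ennreal_mult[symmetric] ennreal_leI)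
      qed simp
    qed
    also have "\<dots> = ennreal (2 powr r) * (\<integral>\<^sup>+x. ennreal (f x powr (1 + \<delta>)) * indicator {x. f x \<ge> 1} x \<partial>lborel)"
      by (rule nn_integral_cmult) measurable
    also have "\<dots> \<le> ennreal (2 powr r) * ennreal (A * 2 powr \<delta> / (1 - 2 powr (\<delta> - 1 / d)))"
      by (intro mult_left_mono hi) auto
    also have "\<dots> = ennreal C'" unfolding C'_def using A0 q by (subst ennreal_mult[symmetric]) (auto intro!: divide_nonneg_nonneg mult_nonneg_nonneg)
    finally show "tail_power lborel r 2 (\<lambda>x. \<bar>u n x\<bar>) \<le> ennreal C'" .
  qed
qed

section \<open>Local compactness\<close>

abbreviation L1_on :: "'a::euclidean_space set \<Rightarrow> ('a \<Rightarrow> real) \<Rightarrow> ennreal" where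
  "L1_on K f \<equiv> (\<integral>\<^sup>+x\<in>K. ennreal (f x) \<partial>lborel)"

text \<open>A segment of length at most 1 that starts in the ball of radius \<open>R\<close> stays
  in the ball of radius \<open>R + 1\<close>; Tonelli and translation invariance do the
  rest.\<close>

lemma local_translation_estimate:
  fixes u :: "'a::euclidean_space \<Rightarrow> real" and g :: "'a \<Rightarrow> 'a"
  assumes [measurable]: "u \<in> borel_measurable borel" "g \<in> borel_measurable borel"
    and wg: "has_weak_gradient u g" and h: "norm h \<le> 1"
  shows "L1_on (cball 0 R) (\<lambda>x. \<bar>u (x + h) - u x\<bar>)
    \<le> ennreal (norm h) * L1_on (cball 0 (R + 1)) (\<lambda>x. norm (g x))"
proof -
  define K where "K = cball (0::'a) R"
  define K' where "K' = cball (0::'a) (R + 1)"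
  have [measurable]: "K \<in> sets borel" "K' \<in> sets borel" by (simp_all add: K_def K'_def)
  have shift: "x + s *\<^sub>R h \<in> K'" if "x \<in> K" "s \<in> {0..1}" for x s
  proof -
    have "norm (x + s *\<^sub>R h) \<le> norm x + s * norm h" using that norm_triangle_ineq[of x "s *\<^sub>R h"] by simp
    also have "\<dots> \<le> R + 1 * 1" using that h by (intro add_mono mult_mono) (auto simp: K_def)
    finally show ?thesis by (simp add: K'_def)
  qed
  have "L1_on K (\<lambda>x. \<bar>u (x + h) - u x\<bar>)
    \<le> (\<integral>\<^sup>+x. ennreal (norm h) * (\<integral>\<^sup>+s. ennreal (norm (g (x + s *\<^sub>R h))) * indicator {0..1} s * indicator K x \<partial>lborel) \<partial>lborel)"
  proof (rule nn_integral_mono_AE, rule AE_mp[OF weak_gradient_translation[OF assms(1-3), of h]], intro AE_I2 impI)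
    fix x
    assume le: "ennreal \<bar>u (x + h) - u x\<bar> \<le> ennreal (norm h) * segment_integral (\<lambda>y. ennreal (norm (g y))) h x"
    show "ennreal \<bar>u (x + h) - u x\<bar> * indicator K x
      \<le> ennreal (norm h) * (\<integral>\<^sup>+s. ennreal (norm (g (x + s *\<^sub>R h))) * indicator {0..1} s * indicator K x \<partial>lborel)"
      using le by (cases "x \<in> K") auto
  qed
  also have "\<dots> = ennreal (norm h) * (\<integral>\<^sup>+x. (\<integral>\<^sup>+s. ennreal (norm (g (x + s *\<^sub>R h))) * indicator {0..1} s * indicator K x \<partial>lborel) \<partial>lborel)"
    by (rule nn_integral_cmult) measurable
  also have "(\<integral>\<^sup>+x. (\<integral>\<^sup>+s. ennreal (norm (g (x + s *\<^sub>R h))) * indicator {0..1} s * indicator K x \<partial>lborel) \<partial>lborel)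
     = (\<integral>\<^sup>+s. (\<integral>\<^sup>+x. ennreal (norm (g (x + s *\<^sub>R h))) * indicator {0..1} s * indicator K x \<partial>lborel) \<partial>lborel)"
    by (rule lborel_pair.Fubini') measurable
  also have "\<dots> \<le> (\<integral>\<^sup>+s. L1_on K' (\<lambda>x. norm (g x)) * indicator {0..1} (s::real) \<partial>lborel)"
  proof (rule nn_integral_mono, goal_cases)
    case (1 s)
    show ?case
    proof (cases "s \<in> {0..1}")
      case True
      have "(\<integral>\<^sup>+x. ennreal (norm (g (x + s *\<^sub>R h))) * indicator {0..1} s * indicator K x \<partial>lborel)
        \<le> (\<integral>\<^sup>+x. ennreal (norm (g (x + s *\<^sub>R h))) * indicator K' (x + s *\<^sub>R h) \<partial>lborel)"
        using shift True by (intro nn_integral_mono) (auto simp: indicator_def)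
      also have "\<dots> = L1_on K' (\<lambda>x. norm (g x))"
        by (rule nn_integral_lborel_translate[of "\<lambda>x. ennreal (norm (g x)) * indicator K' x"]) measurable
      finally show ?thesis using True by simp
    qed simp
  qed
  also have "\<dots> = L1_on K' (\<lambda>x. norm (g x))"
    by (simp add: nn_integral_cmult_indicator)
  finally show ?thesis unfolding K_def K'_def by (simp add: mult_left_mono)
qed

text \<open>Along a subsequence whose successive differences have integral at most
  \<open>(1/2) ^ k\<close> over the ball of radius \<open>k\<close>, the series of absolute
  differences is integrable over every ball, so the telescoping series converges absolutely almost
  everywhere.\<close>

lemma L1_Cauchy_subsequence_AE_convergent:
  fixes s :: "nat \<Rightarrow> 'a::euclidean_space \<Rightarrow> real"
  assumes [measurable]: "\<And>n. s n \<in> borel_measurable borel"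
    and Cauchy: "\<And>R e. e > 0 \<Longrightarrow>
      \<exists>N. \<forall>n\<ge>N. \<forall>m\<ge>N. L1_on (cball 0 R) (\<lambda>x. \<bar>s n x - s m x\<bar>) \<le> ennreal e"
  obtains r where "strict_mono r" "AE x in lborel. convergent (\<lambda>k. s (r k) x)"
proof -
  have "\<forall>k::nat. \<exists>N. \<forall>n\<ge>N. \<forall>m\<ge>N. L1_on (cball 0 (real k)) (\<lambda>x. \<bar>s n x - s m x\<bar>) \<le> ennreal ((1/2) ^ k)"
    using Cauchy by simp
  then obtain N where N: "\<And>k n m. n \<ge> N k \<Longrightarrow> m \<ge> N k \<Longrightarrow>
      L1_on (cball 0 (real k)) (\<lambda>x. \<bar>s n x - s m x\<bar>) \<le> ennreal ((1/2) ^ k)"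
    by metis
  \<comment> \<open>The sum dominates \<open>N k\<close>, and the added \<open>k\<close> makes the
    sequence strictly increasing.\<close>
  define r where "r k = (\<Sum>j\<le>k. N j) + k" for k
  have r: "strict_mono r" unfolding r_def by (rule strict_mono_Suc_iff[THEN iffD2]) simp
  have rN: "N k \<le> r k" for k unfolding r_def by (simp add: member_le_sum[of k "{..k}" N] trans_le_add1)
  have rN': "N k \<le> r (Suc k)" for k using rN[of k] r by (meson le_trans lessI less_imp_le strict_mono_less_eq)
  have "AE x in lborel. x \<in> cball 0 (real R) \<longrightarrow> convergent (\<lambda>k. s (r k) x)" for R :: nat
  proof -
    \<comment> \<open>The index shift by \<open>R\<close> makes the radius \<open>k + R\<close> at
      least \<open>R\<close>, so the geometric bounds hold on this fixed ball from the first term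
      on.\<close>
    define F where "F x = (\<Sum>k. ennreal \<bar>s (r (Suc (k + R))) x - s (r (k + R)) x\<bar> * indicator (cball 0 (real R)) x)" for x
    have [measurable]: "(cball 0 (real R) :: 'a set) \<in> sets borel" by simp
    have [measurable]: "F \<in> borel_measurable borel" unfolding F_def by measurable
    have "(\<integral>\<^sup>+x. F x \<partial>lborel) = (\<Sum>k. \<integral>\<^sup>+x\<in>cball 0 (real R). ennreal \<bar>s (r (Suc (k + R))) x - s (r (k + R)) x\<bar> \<partial>lborel)"
      unfolding F_def by (rule nn_integral_suminf) measurable
    also have "\<dots> \<le> (\<Sum>k. ennreal ((1/2) ^ k))"
    proof (rule suminf_le[OF _ summableI summableI], goal_cases)
      case (1 k)
      have "L1_on (cball 0 (real R)) (\<lambda>x. \<bar>s (r (Suc (k + R))) x - s (r (k + R)) x\<bar>)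
        \<le> L1_on (cball 0 (real (k + R))) (\<lambda>x. \<bar>s (r (Suc (k + R))) x - s (r (k + R)) x\<bar>)"
        by (intro nn_integral_mono) (auto simp: indicator_def)
      also have "\<dots> \<le> ennreal ((1/2) ^ (k + R))" by (rule N[OF rN' rN])
      also have "\<dots> \<le> ennreal ((1/2) ^ k)" by (intro ennreal_leI power_decreasing) auto
      finally show ?case .
    qed
    also have "\<dots> = ennreal (\<Sum>k. (1/2) ^ k)"
      by (rule suminf_ennreal2) (auto intro!: summable_geometric)
    also have "\<dots> < \<infinity>" by simp
    finally have "AE x in lborel. F x \<noteq> \<infinity>" by (intro nn_integral_PInf_AE) auto
    then show ?thesis
    proof (rule AE_mp, intro AE_I2 impI)
      fix x :: 'a assume F: "F x \<noteq> \<infinity>" and x: "x \<in> cball 0 (real R)"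
      let ?t = "\<lambda>k. s (r (k + R)) x"
      have "(\<Sum>k. ennreal \<bar>?t (Suc k) - ?t k\<bar>) \<noteq> top"
        using F x unfolding F_def by simp
      then have "summable (\<lambda>k. \<bar>?t (Suc k) - ?t k\<bar>)"
        by (intro summable_suminf_not_top) auto
      then have "summable (\<lambda>k. ?t (Suc k) - ?t k)" by (rule summable_rabs_cancel)
      then have "convergent (\<lambda>n. (\<Sum>k<n. ?t (Suc k) - ?t k))" by (simp add: summable_iff_convergent)
      then have "convergent (\<lambda>n. ?t n - ?t 0)" by (simp only: sum_lessThan_telescope[of ?t])
      then have "convergent (\<lambda>n. (?t n - ?t 0) + ?t 0)" by (intro convergent_add convergent_const)
      then have "convergent (\<lambda>n. s (r (n + R)) x)" by simp
      then show "convergent (\<lambda>k. s (r k) x)" using LIMSEQ_offset[of "\<lambda>k. s (r k) x" R] unfolding convergent_def by blast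
    qed
  qed
  then have "AE x in lborel. \<forall>R::nat. x \<in> cball 0 (real R) \<longrightarrow> convergent (\<lambda>k. s (r k) x)"
    by (subst AE_all_countable) blast
  then have "AE x in lborel. convergent (\<lambda>k. s (r k) x)"
  proof (rule AE_mp, intro AE_I2 impI)
    fix x :: 'a assume "\<forall>R::nat. x \<in> cball 0 (real R) \<longrightarrow> convergent (\<lambda>k. s (r k) x)"
    moreover obtain R :: nat where "norm x \<le> real R" using real_arch_simple by blast
    ultimately show "convergent (\<lambda>k. s (r k) x)" by auto
  qed
  with r show ?thesis by (rule that)
qed

text \<open>A ball mean without its normalising factor. The measure of the ball is multiplied onto
  \<open>u\<close> instead, which keeps the bounds below independent of
  \<open>\<epsilon>\<close>.\<close>

definition ball_integral :: "('a::euclidean_space \<Rightarrow> real) \<Rightarrow> real \<Rightarrow> 'a \<Rightarrow> real" where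
  "ball_integral u \<epsilon> x = (LINT h|lborel. indicator (ball 0 \<epsilon>) h * u (x + h))"

lemma ball_integral_measurable [measurable]:
  "u \<in> borel_measurable borel \<Longrightarrow> ball_integral u \<epsilon> \<in> borel_measurable borel"
proof -
  assume [measurable]: "u \<in> borel_measurable borel"
  have [measurable]: "(ball 0 \<epsilon> :: 'a set) \<in> sets borel" by simp
  show ?thesis unfolding ball_integral_def[abs_def] by measurable
qed

lemma nn_ball_shift_le:
  fixes k :: "'a::euclidean_space \<Rightarrow> ennreal"
  assumes [measurable]: "k \<in> borel_measurable borel" and "\<epsilon> \<le> 1" "norm x \<le> R"
  shows "(\<integral>\<^sup>+h\<in>ball 0 \<epsilon>. k (x + h) \<partial>lborel) \<le> (\<integral>\<^sup>+z\<in>cball 0 (R + 1). k z \<partial>lborel)"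
proof -
  define K where "K = cball (0::'a) (R + 1)"
  have [measurable]: "K \<in> sets borel" by (simp add: K_def)
  have "x + h \<in> K" if "h \<in> ball 0 \<epsilon>" for h
    using that assms norm_triangle_ineq[of x h] by (simp add: K_def)
  then have "(\<integral>\<^sup>+h\<in>ball 0 \<epsilon>. k (x + h) \<partial>lborel) \<le> (\<integral>\<^sup>+h. k (h + x) * indicator K (h + x) \<partial>lborel)"
    by (intro nn_integral_mono) (auto simp: indicator_def add.commute)
  also have "\<dots> = (\<integral>\<^sup>+z\<in>K. k z \<partial>lborel)"
    by (rule nn_integral_lborel_translate[of "\<lambda>z. k z * indicator K z"]) measurable
  finally show ?thesis unfolding K_def .
qed

lemma ball_integral_integrable:
  fixes u :: "'a::euclidean_space \<Rightarrow> real"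
  assumes [measurable]: "u \<in> borel_measurable borel" and "\<epsilon> \<le> 1" "norm x \<le> R"
    and "L1_on (cball 0 (R + 1)) (\<lambda>z. \<bar>u z\<bar>) \<le> ennreal C"
  shows "integrable lborel (\<lambda>h. indicator (ball 0 \<epsilon>) h * u (x + h))"
    and "C \<ge> 0 \<Longrightarrow> \<bar>ball_integral u \<epsilon> x\<bar> \<le> C"
proof -
  have [measurable]: "(ball 0 \<epsilon> :: 'a set) \<in> sets borel" by simp
  have "(\<integral>\<^sup>+h. ennreal (norm (indicator (ball 0 \<epsilon>) h * u (x + h))) \<partial>lborel) = (\<integral>\<^sup>+h\<in>ball 0 \<epsilon>. ennreal \<bar>u (x + h)\<bar> \<partial>lborel)"
    by (intro nn_integral_cong) (auto simp: indicator_def)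
  also have "\<dots> \<le> L1_on (cball 0 (R + 1)) (\<lambda>z. \<bar>u z\<bar>)"
    by (rule nn_ball_shift_le) (use assms in auto)
  also note assms(4)
  finally have le: "(\<integral>\<^sup>+h. ennreal (norm (indicator (ball 0 \<epsilon>) h * u (x + h))) \<partial>lborel) \<le> ennreal C" .
  then have "(\<integral>\<^sup>+h. ennreal (norm (indicator (ball 0 \<epsilon>) h * u (x + h))) \<partial>lborel) < \<infinity>"
    by (rule le_less_trans) simp
  then show I: "integrable lborel (\<lambda>h. indicator (ball 0 \<epsilon>) h * u (x + h))"
    by (intro integrableI_bounded) auto
  show "\<bar>ball_integral u \<epsilon> x\<bar> \<le> C" if "C \<ge> 0"
    using order_trans[OF integral_norm_bound_ennreal[OF I] le] that
    by (simp add: ball_integral_def)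
qed

text \<open>Equicontinuity: the difference is the ball integral of the increment of \<open>u\<close>
  in direction \<open>y - x\<close>, which the gradient controls in L^1. The Lipschitz constant is a
  local L^1 bound of the gradient, hence uniform along a sequence with such bounds.\<close>

lemma ball_integral_diff_le:
  fixes u :: "'a::euclidean_space \<Rightarrow> real" and g :: "'a \<Rightarrow> 'a"
  assumes [measurable]: "u \<in> borel_measurable borel" "g \<in> borel_measurable borel"
    and wg: "has_weak_gradient u g" and "\<epsilon> \<le> 1" "norm x \<le> R" "norm (y - x) \<le> 1"
    and CU: "L1_on (cball 0 (R + 2)) (\<lambda>z. \<bar>u z\<bar>) \<le> ennreal C"
    and CG: "L1_on (cball 0 (R + 2)) (\<lambda>z. norm (g z)) \<le> ennreal C'" "C' \<ge> 0"
  shows "\<bar>ball_integral u \<epsilon> y - ball_integral u \<epsilon> x\<bar> \<le> norm (y - x) * C'"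
proof -
  have [measurable]: "(ball 0 \<epsilon> :: 'a set) \<in> sets borel" by simp
  have ny: "norm y \<le> R + 1" using assms norm_triangle_sub[of y x] by (simp add: norm_minus_commute)
  have CU': "L1_on (cball 0 ((R + 1) + 1)) (\<lambda>z. \<bar>u z\<bar>) \<le> ennreal C" using CU by (simp add: add.assoc)
  have Iy: "integrable lborel (\<lambda>h. indicator (ball 0 \<epsilon>) h * u (y + h))"
    and Ix: "integrable lborel (\<lambda>h. indicator (ball 0 \<epsilon>) h * u (x + h))"
    using assms ny CU' by (auto intro!: ball_integral_integrable(1)[where R = "R + 1" and C = C])
  have "ball_integral u \<epsilon> y - ball_integral u \<epsilon> x = (LINT h|lborel. indicator (ball 0 \<epsilon>) h * u (y + h) - indicator (ball 0 \<epsilon>) h * u (x + h))"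
    unfolding ball_integral_def using Iy Ix by simp
  then have "ennreal \<bar>ball_integral u \<epsilon> y - ball_integral u \<epsilon> x\<bar>
     \<le> (\<integral>\<^sup>+h. ennreal (norm (indicator (ball 0 \<epsilon>) h * u (y + h) - indicator (ball 0 \<epsilon>) h * u (x + h))) \<partial>lborel)"
    using integral_norm_bound_ennreal[OF Bochner_Integration.integrable_diff[OF Iy Ix]] by simp
  also have "\<dots> = (\<integral>\<^sup>+h\<in>ball 0 \<epsilon>. (\<lambda>z. ennreal \<bar>u (z + (y - x)) - u z\<bar>) (x + h) \<partial>lborel)"
    by (intro nn_integral_cong) (auto simp: indicator_def algebra_simps)
  also have "\<dots> \<le> L1_on (cball 0 (R + 1)) (\<lambda>z. \<bar>u (z + (y - x)) - u z\<bar>)"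
    by (rule nn_ball_shift_le) (use assms in auto)
  also have "\<dots> \<le> ennreal (norm (y - x)) * L1_on (cball 0 ((R + 1) + 1)) (\<lambda>x. norm (g x))"
    by (rule local_translation_estimate) (use assms in auto)
  also have "\<dots> \<le> ennreal (norm (y - x)) * ennreal C'"
    using CG by (intro mult_left_mono) (auto simp: add.assoc)
  also have "\<dots> = ennreal (norm (y - x) * C')" using CG by (simp add: ennreal_mult)
  finally show ?thesis using CG by simp
qed

text \<open>An Arzela-Ascoli argument for the ball integrals at all radii
  \<open>\<epsilon> k\<close> simultaneously, followed by a return to the functions: these are close
  to their ball means in local L^1 uniformly in \<open>n\<close>, so convergence of the means makes
  the sequence Cauchy in L^1 on balls.\<close>

lemma weak_gradient_compactness:
  fixes u :: "nat \<Rightarrow> 'a::euclidean_space \<Rightarrow> real" and g :: "nat \<Rightarrow> 'a \<Rightarrow> 'a"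
  assumes [measurable]: "\<And>n. u n \<in> borel_measurable borel" "\<And>n. g n \<in> borel_measurable borel"
    and wg: "\<And>n. has_weak_gradient (u n) (g n)"
    and bu: "\<And>R. \<exists>C. \<forall>n. L1_on (cball 0 R) (\<lambda>x. \<bar>u n x\<bar>) \<le> ennreal C"
    and bg: "\<And>R. \<exists>C. \<forall>n. L1_on (cball 0 R) (\<lambda>x. norm (g n x)) \<le> ennreal C"
  obtains r v where "strict_mono r" "v \<in> borel_measurable borel" "AE x in lborel. (\<lambda>n. u (r n) x) \<longlonglongrightarrow> v x"
proof -
  have *: "\<exists>C\<ge>0. \<forall>n. F n \<le> ennreal C" if F: "\<exists>C. \<forall>n. F n \<le> ennreal C" for F :: "nat \<Rightarrow> ennreal"
  proof -
    obtain C where "\<forall>n. F n \<le> ennreal C" using F by blast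
    moreover have "ennreal C \<le> ennreal (max C 0)" by (rule ennreal_leI) simp
    ultimately show ?thesis by (intro exI[of _ "max C 0"]) (auto intro: order_trans)
  qed
  obtain CU where CU0: "\<And>R. CU R \<ge> 0" and CU: "\<And>R n. L1_on (cball 0 R) (\<lambda>x. \<bar>u n x\<bar>) \<le> ennreal (CU R)"
    using *[OF bu] by metis
  obtain CG where CG0: "\<And>R. CG R \<ge> 0" and CG: "\<And>R n. L1_on (cball 0 R) (\<lambda>x. norm (g n x)) \<le> ennreal (CG R)"
    using *[OF bg] by metis
  define \<epsilon> where "\<epsilon> k = 1 / real (Suc k)" for k
  have \<epsilon>: "0 < \<epsilon> k" "\<epsilon> k \<le> 1" for k by (auto simp: \<epsilon>_def)
  define I where "I n k x = ball_integral (u n) (\<epsilon> k) x" for n k x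
  have [measurable]: "I n k \<in> borel_measurable borel" for n k unfolding I_def[abs_def] by measurable
  have I_bound: "\<bar>I n k x\<bar> \<le> CU (R + 1)" if "norm x \<le> R" for n k x R
    unfolding I_def using \<epsilon> that CU0 CU by (intro ball_integral_integrable(2)) auto
  obtain D :: "'a set" where D: "countable D" "\<And>X. open X \<Longrightarrow> X \<noteq> {} \<Longrightarrow> \<exists>d\<in>D. d \<in> X"
    using countable_dense_setE by blast
  \<comment> \<open>The diagonal extraction asks for one common bound; this division makes it 1, and
    the added 1 keeps the divisor positive.\<close>
  define F where "F n = (\<lambda>(k, x). I n k x / (CU (norm x + 1) + 1))" for n
  have "norm (F n z) \<le> 1" for n z
  proof -
    obtain k x where z: "z = (k, x)" by (cases z)
    have "\<bar>I n k x\<bar> \<le> CU (norm x + 1) + 1" using I_bound[of x "norm x" n k] by simp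
    then show ?thesis using CU0[of "norm x + 1"] by (simp add: F_def z divide_le_eq)
  qed
  moreover have "countable (UNIV \<times> D :: (nat \<times> 'a) set)" using D by auto
  ultimately obtain r where r: "strict_mono r" and Fconv: "\<And>z. z \<in> UNIV \<times> D \<Longrightarrow> \<exists>l. (\<lambda>n. F (r n) z) \<longlonglongrightarrow> l"
    using function_convergent_subsequence[of "UNIV \<times> D" F 1] by metis
  have convD: "convergent (\<lambda>n. I (r n) k x)" if x: "x \<in> D" for k x
  proof -
    obtain l where "(\<lambda>n. F (r n) (k, x)) \<longlonglongrightarrow> l" using Fconv[of "(k, x)"] x by auto
    then have "(\<lambda>n. F (r n) (k, x) * (CU (norm x + 1) + 1)) \<longlonglongrightarrow> l * (CU (norm x + 1) + 1)" by (intro tendsto_intros)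
    moreover have "CU (norm x + 1) + 1 \<noteq> 0" using CU0[of "norm x + 1"] by linarith
    ultimately show ?thesis unfolding F_def convergent_def by auto
  qed
  have conv: "convergent (\<lambda>n. I (r n) k x)" for k x
  proof -
    have "Cauchy (\<lambda>n. I (r n) k x)"
    proof (rule CauchyI)
      fix e :: real assume e: "e > 0"
      define c where "c = CG (norm x + 2) + 1"
      have c: "c > 0" using CG0[of "norm x + 2"] by (simp add: c_def)
      \<comment> \<open>Moving to a dense point within this distance changes every ball integral by
        less than \<open>e / 3\<close>; the cap at 1 keeps the shift in the range of
        \<open>ball_integral_diff_le\<close>.\<close>
      define \<delta> where "\<delta> = min 1 (e / (3 * c))"
      have \<delta>: "\<delta> > 0" using e c by (simp add: \<delta>_def)
      then have "\<exists>d\<in>D. d \<in> ball x \<delta>" by (intro D) auto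
      then obtain y where y: "y \<in> D" "dist x y < \<delta>" by auto
      have yn: "norm (y - x) < \<delta>" using y by (simp add: dist_norm norm_minus_commute)
      have near: "\<bar>I n k y - I n k x\<bar> < e / 3" for n
      proof -
        have "\<bar>I n k y - I n k x\<bar> \<le> norm (y - x) * CG (norm x + 2)"
          unfolding I_def using wg \<epsilon> yn \<delta>_def CU CG CG0
          by (intro ball_integral_diff_le[OF _ _ wg, where R = "norm x"]) auto
        also have "\<dots> \<le> norm (y - x) * c" by (intro mult_left_mono) (auto simp: c_def)
        also have "\<dots> < \<delta> * c" using yn c by (intro mult_strict_right_mono) auto
        also have "\<dots> \<le> e / (3 * c) * c" using c by (intro mult_right_mono) (auto simp: \<delta>_def)
        also have "\<dots> = e / 3" using c by simp
        finally show ?thesis .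
      qed
      have "Cauchy (\<lambda>n. I (r n) k y)" using convD[OF y(1)] by (simp add: Cauchy_convergent_iff)
      then obtain M where M: "\<And>m n. m \<ge> M \<Longrightarrow> n \<ge> M \<Longrightarrow> \<bar>I (r m) k y - I (r n) k y\<bar> < e / 3"
        using CauchyD[of "\<lambda>n. I (r n) k y" "e / 3"] e by auto
      show "\<exists>M. \<forall>m\<ge>M. \<forall>n\<ge>M. norm (I (r m) k x - I (r n) k x) < e"
      proof (intro exI[of _ M] allI impI)
        fix m n assume "m \<ge> M" "n \<ge> M"
        from M[OF this] near[of "r m"] near[of "r n"]
        show "norm (I (r m) k x - I (r n) k x) < e" by (simp add: abs_less_iff) argo
      qed
    qed
    then show ?thesis by (simp add: Cauchy_convergent_iff)
  qed
  \<comment> \<open>Pointwise bound for the unnormalised error \<open>m k * u n x - I n k x\<close>,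
    written as a nonnegative integral so that Tonelli applies.\<close>
  define T where "T n k x = (\<integral>\<^sup>+h\<in>ball 0 (\<epsilon> k). ennreal \<bar>u n (x + h) - u n x\<bar> \<partial>lborel)" for n k x
  have [measurable]: "(ball 0 (\<epsilon> k) :: 'a set) \<in> sets borel" for k by simp
  have [measurable]: "T n k \<in> borel_measurable borel" for n k unfolding T_def[abs_def] by measurable
  define m where "m k = measure lborel (ball 0 (\<epsilon> k) :: 'a set)" for k
  have em: "emeasure lborel (ball 0 (\<epsilon> k) :: 'a set) = ennreal (m k)" for k
    unfolding m_def using emeasure_lborel_ball_finite[of 0 "\<epsilon> k"] by (intro emeasure_eq_ennreal_measure) (simp add: less_top)
  have m: "m k > 0" for k
    unfolding m_def using content_ball_pos[OF \<epsilon>(1)[of k], of "0::'a"] by simp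
  have T_int: "(\<integral>\<^sup>+x\<in>cball 0 R. T n k x \<partial>lborel) \<le> ennreal (m k * (\<epsilon> k * CG (R + 1)))" for n k R
  proof -
    define K where "K = cball (0::'a) R"
    have [measurable]: "K \<in> sets borel" by (simp add: K_def)
    have "(\<integral>\<^sup>+x\<in>K. T n k x \<partial>lborel) = (\<integral>\<^sup>+x. (\<integral>\<^sup>+h. ennreal \<bar>u n (x + h) - u n x\<bar> * indicator (ball 0 (\<epsilon> k)) h * indicator K x \<partial>lborel) \<partial>lborel)"
      unfolding T_def by (intro nn_integral_cong nn_integral_multc[symmetric]) measurable
    also have "\<dots> = (\<integral>\<^sup>+h. (\<integral>\<^sup>+x. ennreal \<bar>u n (x + h) - u n x\<bar> * indicator (ball 0 (\<epsilon> k)) h * indicator K x \<partial>lborel) \<partial>lborel)"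
      by (rule lborel_pair.Fubini') measurable
    also have "\<dots> \<le> (\<integral>\<^sup>+h. ennreal (\<epsilon> k * CG (R + 1)) * indicator (ball 0 (\<epsilon> k)) (h::'a) \<partial>lborel)"
    proof (rule nn_integral_mono, goal_cases)
      case (1 h)
      show ?case
      proof (cases "h \<in> ball 0 (\<epsilon> k)")
        case True
        have "L1_on K (\<lambda>x. \<bar>u n (x + h) - u n x\<bar>) \<le> ennreal (norm h) * L1_on (cball 0 (R + 1)) (\<lambda>x. norm (g n x))"
          unfolding K_def by (rule local_translation_estimate[OF _ _ wg]) (use True \<epsilon>(2)[of k] in auto)
        also have "\<dots> \<le> ennreal (\<epsilon> k) * ennreal (CG (R + 1))"
          using True by (intro mult_mono CG ennreal_leI) auto
        also have "\<dots> = ennreal (\<epsilon> k * CG (R + 1))" using CG0 \<epsilon>(1)[of k] by (simp add: ennreal_mult)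
        finally show ?thesis using True by simp
      qed simp
    qed
    also have "\<dots> = ennreal (m k * (\<epsilon> k * CG (R + 1)))"
      using em m[of k] \<epsilon>(1)[of k] CG0[of "R + 1"] by (subst nn_integral_cmult_indicator) (auto simp: ennreal_mult[symmetric] mult.commute)
    finally show ?thesis unfolding K_def .
  qed
  have u_near: "ennreal (\<bar>m k * u n x - I n k x\<bar>) \<le> T n k x" for n k x
  proof -
    have I1: "integrable lborel (\<lambda>h. indicator (ball 0 (\<epsilon> k)) h * u n (x + h))"
      by (rule ball_integral_integrable(1)[OF _ _ _ CU]) (use \<epsilon> in auto)
    have I2: "integrable lborel (\<lambda>h. indicator (ball 0 (\<epsilon> k)) h * u n x)"
      using em[of k] by (intro integrable_mult_left integrable_real_indicator) (simp_all add: emeasure_lborel_ball_finite[unfolded infinity_ennreal_def])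
    have "m k * u n x = (LINT h|lborel. indicator (ball 0 (\<epsilon> k)) (h::'a) * u n x)"
      by (simp add: m_def)
    then have "I n k x - m k * u n x = (LINT h|lborel. indicator (ball 0 (\<epsilon> k)) h * u n (x + h) - indicator (ball 0 (\<epsilon> k)) h * u n x)"
      unfolding I_def ball_integral_def by (simp only: Bochner_Integration.integral_diff[OF I1 I2])
    then have "ennreal \<bar>I n k x - m k * u n x\<bar> \<le> (\<integral>\<^sup>+h. ennreal (norm (indicator (ball 0 (\<epsilon> k)) h * u n (x + h) - indicator (ball 0 (\<epsilon> k)) h * u n x)) \<partial>lborel)"
      using integral_norm_bound_ennreal[OF Bochner_Integration.integrable_diff[OF I1 I2]] by simp
    also have "\<dots> = T n k x" unfolding T_def by (intro nn_integral_cong) (auto simp: indicator_def)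
    finally show ?thesis by (simp add: abs_minus_commute)
  qed
  have Cauchy: "\<exists>N. \<forall>n\<ge>N. \<forall>j\<ge>N. L1_on (cball 0 R) (\<lambda>x. \<bar>u (r n) x - u (r j) x\<bar>) \<le> ennreal e" if e: "e > 0" for R e
  proof -
    define K where "K = cball (0::'a) R"
    have [measurable]: "K \<in> sets borel" by (simp add: K_def)
    define c where "c = CG (R + 1) + 1"
    have c: "c > 0" using CG0[of "R + 1"] by (simp add: c_def)
    \<comment> \<open>The radius is fixed first, uniformly in \<open>n\<close>; only then is
      \<open>N\<close> chosen for the ball integrals of that radius.\<close>
    obtain k where k: "\<epsilon> k * c < e / 4"
    proof -
      obtain k where "inverse (real (Suc k)) < e / (4 * c)" using reals_Archimedean[of "e / (4 * c)"] e c by auto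
      then show ?thesis using c by (intro that[of k]) (simp add: \<epsilon>_def field_simps)
    qed
    define a where "a x = lim (\<lambda>n. I (r n) k x)" for x
    have [measurable]: "a \<in> borel_measurable borel" unfolding a_def by measurable
    have a: "(\<lambda>n. I (r n) k x) \<longlonglongrightarrow> a x" for x
      unfolding a_def using conv convergent_LIMSEQ_iff by blast
    have ab: "\<bar>a x\<bar> \<le> CU (R + 1)" if "x \<in> K" for x
    proof (rule LIMSEQ_le_const2[OF tendsto_rabs[OF a]])
      show "\<exists>N. \<forall>n\<ge>N. \<bar>I (r n) k x\<bar> \<le> CU (R + 1)" using I_bound[of x R] that by (auto simp: K_def)
    qed
    have "(\<lambda>n. \<integral>\<^sup>+x\<in>K. ennreal \<bar>I (r n) k x - a x\<bar> \<partial>lborel) \<longlonglongrightarrow> (\<integral>\<^sup>+x. 0 \<partial>(lborel :: 'a measure))"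
    proof (rule nn_integral_dominated_convergence[where w = "\<lambda>x. ennreal (2 * CU (R + 1)) * indicator K x"])
      show "AE x in lborel. ennreal \<bar>I (r n) k x - a x\<bar> * indicator K x \<le> ennreal (2 * CU (R + 1)) * indicator K x" for n
      proof (rule AE_I2, goal_cases)
        case (1 x)
        show ?case
        proof (cases "x \<in> K")
          case True
          then have "\<bar>I (r n) k x\<bar> \<le> CU (R + 1)" by (intro I_bound) (simp add: K_def)
          then have "\<bar>I (r n) k x - a x\<bar> \<le> 2 * CU (R + 1)" using ab[OF True] by linarith
          then show ?thesis using True by (simp add: ennreal_leI)
        qed simp
      qed
      show "(\<integral>\<^sup>+x. ennreal (2 * CU (R + 1)) * indicator K x \<partial>lborel) < \<infinity>"
        using emeasure_lborel_cball_finite[of "0::'a" R]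
        by (subst nn_integral_cmult_indicator) (auto simp: K_def ennreal_mult_less_top)
      show "AE x in lborel. (\<lambda>n. ennreal \<bar>I (r n) k x - a x\<bar> * indicator K x) \<longlonglongrightarrow> 0"
      proof (rule AE_I2, goal_cases)
        case (1 x)
        have "(\<lambda>n. ennreal \<bar>I (r n) k x - a x\<bar>) \<longlonglongrightarrow> ennreal \<bar>a x - a x\<bar>"
          by (intro tendsto_intros tendsto_ennrealI a)
        then show ?case
          by (cases "x \<in> K") auto
      qed
    qed measurable
    then have "(\<lambda>n. \<integral>\<^sup>+x\<in>K. ennreal \<bar>I (r n) k x - a x\<bar> \<partial>lborel) \<longlonglongrightarrow> 0" by simp
    moreover have "0 < ennreal (m k * e / 4)" using m[of k] e by simp
    ultimately have "\<forall>\<^sub>F n in sequentially. L1_on K (\<lambda>x. \<bar>I (r n) k x - a x\<bar>) < ennreal (m k * e / 4)"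
      by (rule order_tendstoD)
    then obtain N where N: "\<And>n. n \<ge> N \<Longrightarrow> L1_on K (\<lambda>x. \<bar>I (r n) k x - a x\<bar>) \<le> ennreal (m k * e / 4)"
      unfolding eventually_sequentially by (meson less_imp_le)
    have near: "L1_on K (\<lambda>x. \<bar>m k * u (r n) x - a x\<bar>) \<le> ennreal (m k * e / 2)" if "n \<ge> N" for n
    proof -
      have "L1_on K (\<lambda>x. \<bar>m k * u (r n) x - a x\<bar>) \<le> (\<integral>\<^sup>+x. T (r n) k x * indicator K x + ennreal \<bar>I (r n) k x - a x\<bar> * indicator K x \<partial>lborel)"
      proof (rule nn_integral_mono, goal_cases)
        case (1 x)
        have "ennreal \<bar>m k * u (r n) x - a x\<bar> \<le> ennreal \<bar>m k * u (r n) x - I (r n) k x\<bar> + ennreal \<bar>I (r n) k x - a x\<bar>"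
          by (simp add: ennreal_leI flip: ennreal_plus)
        also have "\<dots> \<le> T (r n) k x + ennreal \<bar>I (r n) k x - a x\<bar>"
          by (intro add_right_mono u_near)
        finally show ?case
          by (simp add: indicator_def)
      qed
      also have "\<dots> = (\<integral>\<^sup>+x\<in>K. T (r n) k x \<partial>lborel) + L1_on K (\<lambda>x. \<bar>I (r n) k x - a x\<bar>)"
        by (rule nn_integral_add) measurable
      also have "\<dots> \<le> ennreal (m k * (\<epsilon> k * CG (R + 1))) + ennreal (m k * e / 4)"
        using T_int N[OF that] by (intro add_mono) (auto simp: K_def)
      also have "\<dots> = ennreal (m k * (\<epsilon> k * CG (R + 1)) + m k * e / 4)"
        using m[of k] \<epsilon>(1)[of k] CG0 e by (intro ennreal_plus[symmetric]) auto
      also have "\<dots> \<le> ennreal (m k * e / 2)"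
      proof (rule ennreal_leI)
        have "\<epsilon> k * CG (R + 1) \<le> \<epsilon> k * c" using \<epsilon>(1)[of k] by (intro mult_left_mono) (auto simp: c_def)
        then have "m k * (\<epsilon> k * CG (R + 1)) \<le> m k * (e / 4)" using k m[of k] by (intro mult_left_mono) auto
        also have "m k * (e / 4) = m k * e / 2 - m k * e / 4" by (simp add: field_simps)
        finally show "m k * (\<epsilon> k * CG (R + 1)) + m k * e / 4 \<le> m k * e / 2" by linarith
      qed
      finally show ?thesis .
    qed
    show ?thesis
    proof (intro exI[of _ N] allI impI)
      fix n j assume n: "n \<ge> N" and j: "j \<ge> N"
      have "ennreal (m k) * L1_on K (\<lambda>x. \<bar>u (r n) x - u (r j) x\<bar>) = (\<integral>\<^sup>+x. ennreal (m k) * (ennreal \<bar>u (r n) x - u (r j) x\<bar> * indicator K x) \<partial>lborel)"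
        by (rule nn_integral_cmult[symmetric]) measurable
      also have "\<dots> \<le> (\<integral>\<^sup>+x. ennreal \<bar>m k * u (r n) x - a x\<bar> * indicator K x + ennreal \<bar>m k * u (r j) x - a x\<bar> * indicator K x \<partial>lborel)"
      proof (rule nn_integral_mono, goal_cases)
        case (1 x)
        have "m k * \<bar>u (r n) x - u (r j) x\<bar> = \<bar>m k * u (r n) x - m k * u (r j) x\<bar>"
          using m[of k] by (simp add: abs_mult flip: right_diff_distrib)
        also have "\<dots> \<le> \<bar>m k * u (r n) x - a x\<bar> + \<bar>m k * u (r j) x - a x\<bar>" by simp
        finally have "ennreal (m k) * ennreal \<bar>u (r n) x - u (r j) x\<bar> \<le> ennreal \<bar>m k * u (r n) x - a x\<bar> + ennreal \<bar>m k * u (r j) x - a x\<bar>"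
          using m[of k] by (simp add: ennreal_leI ennreal_mult[symmetric] flip: ennreal_plus)
        then show ?case
          by (simp add: indicator_def)
      qed
      also have "\<dots> = L1_on K (\<lambda>x. \<bar>m k * u (r n) x - a x\<bar>) + L1_on K (\<lambda>x. \<bar>m k * u (r j) x - a x\<bar>)"
        by (rule nn_integral_add) measurable
      also have "\<dots> \<le> ennreal (m k * e / 2) + ennreal (m k * e / 2)" by (intro add_mono near n j)
      also have "\<dots> = ennreal (m k) * ennreal e" using m[of k] e by (simp add: ennreal_mult[symmetric] flip: ennreal_plus)
      finally show "L1_on (cball 0 R) (\<lambda>x. \<bar>u (r n) x - u (r j) x\<bar>) \<le> ennreal e"
        using m[of k] unfolding K_def by (subst (asm) ennreal_mult_le_mult_iff) auto
    qed
  qed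
  obtain r' where r': "strict_mono r'" "AE x in lborel. convergent (\<lambda>k. u (r (r' k)) x)"
    using L1_Cauchy_subsequence_AE_convergent[of "\<lambda>n. u (r n)", OF _ Cauchy] by auto
  show ?thesis
  proof (rule that[of "r \<circ> r'" "\<lambda>x. lim (\<lambda>k. u (r (r' k)) x)"])
    show "strict_mono (r \<circ> r')" by (rule strict_mono_o[OF r r'(1)])
    show "(\<lambda>x. lim (\<lambda>k. u (r (r' k)) x)) \<in> borel_measurable borel" by measurable
    show "AE x in lborel. (\<lambda>n. u ((r \<circ> r') n) x) \<longlonglongrightarrow> lim (\<lambda>k. u (r (r' k)) x)"
      using r'(2) by (simp add: convergent_LIMSEQ_iff)
  qed
qed

section \<open>The double phase integrand\<close>

text \<open>The integrand at one fixed point of the space: \<open>p\<close>, \<open>q\<close> and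
  \<open>m\<close> stand for \<open>p x\<close>, \<open>q x\<close> and \<open>\<mu> x\<close>.
  \<open>P\<close> comes from \<open>p\<close> and \<open>Q\<close> from \<open>q\<close>, and both
  bound both exponents because \<open>p\<close> lies below \<open>q\<close>.\<close>

locale phase =
  fixes p q :: "real \<Rightarrow> real" and m P Q M :: real
  assumes p_cont: "continuous_on {0..} p" and q_cont: "continuous_on {0..} q"
    and p_ge: "\<And>t. t \<ge> 0 \<Longrightarrow> P \<le> p t" and p_le: "\<And>t. t \<ge> 0 \<Longrightarrow> p t \<le> Q"
    and q_ge: "\<And>t. t \<ge> 0 \<Longrightarrow> P \<le> q t" and q_le: "\<And>t. t \<ge> 0 \<Longrightarrow> q t \<le> Q"
    and p_const: "\<And>t. 0 \<le> t \<Longrightarrow> t \<le> 1 \<Longrightarrow> p t = p 0"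
    and q_const: "\<And>t. 0 \<le> t \<Longrightarrow> t \<le> 1 \<Longrightarrow> q t = q 0"
    and p_mono: "mono_on {1..} p" and q_mono: "mono_on {1..} q"
    and m: "0 \<le> m" "m \<le> M" and P: "2 \<le> P"
begin

definition h :: "real \<Rightarrow> real" where
  "h s = s powr (p s - 1) + m * s powr (q s - 1)"

definition H :: "real \<Rightarrow> real" where
  "H t = (LINT s:{0..t}|lborel. h s)"

lemma PQ: "P \<le> Q"
  using p_ge[of 0] p_le[of 0] by simp

lemma h_nonneg: "h s \<ge> 0"
  using m by (simp add: h_def)

lemma continuous_on_powr_exponent:
  assumes "continuous_on {0..} r" "\<And>t. t \<ge> 0 \<Longrightarrow> P \<le> r t"
  shows "continuous_on {0..} (\<lambda>s::real. s powr (r s - 1))"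
  using assms P by (intro continuous_on_powr' continuous_intros) (auto, force)

lemma h_cont: "continuous_on {0..} h"
  unfolding h_def
  by (intro continuous_on_add continuous_on_mult_left continuous_on_powr_exponent p_cont q_cont p_ge q_ge)

lemma h_cont_on: "a \<ge> 0 \<Longrightarrow> continuous_on {a..b} h"
  by (rule continuous_on_subset[OF h_cont]) auto

lemma h_integrable: "a \<ge> 0 \<Longrightarrow> h integrable_on {a..b}"
  by (intro integrable_continuous_interval h_cont_on)

lemma H_eq: "H t = integral {0..t} h"
  unfolding H_def by (intro set_borel_integral_eq_integral(2) borel_integrable_atLeastAtMost' h_cont_on) simp

text \<open>Below 1 the exponent is frozen, above 1 base and exponent both grow, and the value 1
  separates the two ranges. An exponent increasing below 1 could destroy monotonicity, since there a
  larger exponent gives a smaller power.\<close>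

lemma powr_exponent_mono:
  assumes "0 \<le> s" "s \<le> t" "\<And>t. t \<ge> 0 \<Longrightarrow> P \<le> r t"
    "\<And>t. 0 \<le> t \<Longrightarrow> t \<le> 1 \<Longrightarrow> r t = r 0" "mono_on {1..} r"
  shows "s powr (r s - 1) \<le> t powr (r t - 1)"
proof -
  have r: "r s - 1 \<ge> 0" "r t - 1 \<ge> 0" using assms(3)[of s] assms(3)[of t] assms(1,2) P by linarith+
  consider "t \<le> 1" | "s \<le> 1" "1 \<le> t" | "1 \<le> s" by linarith
  then show ?thesis
  proof cases
    case 1
    have "r s = r 0" "r t = r 0" using 1 assms(1,2) by (auto intro!: assms(4))
    then show ?thesis using assms(1,2) r(1) powr_mono2[of "r 0 - 1" s t] by simp
  next
    case 2
    have "s powr (r s - 1) \<le> 1" using 2 assms(1) r by (intro powr_le1) auto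
    also have "1 \<le> t powr (r t - 1)" using 2 r by (intro ge_one_powr_ge_zero) auto
    finally show ?thesis .
  next
    case 3
    then have "r s \<le> r t" using assms(2,5) by (auto simp: mono_on_def)
    have "s powr (r s - 1) \<le> t powr (r s - 1)" using assms(1,2) r by (intro powr_mono2) auto
    also have "\<dots> \<le> t powr (r t - 1)" using 3 assms(2) \<open>r s \<le> r t\<close> by (intro powr_mono) auto
    finally show ?thesis .
  qed
qed

lemma h_mono: "0 \<le> s \<Longrightarrow> s \<le> t \<Longrightarrow> h s \<le> h t"
  unfolding h_def using m
  by (intro add_mono mult_left_mono powr_exponent_mono p_ge q_ge p_const q_const p_mono q_mono) auto

lemma H_diff: "0 \<le> a \<Longrightarrow> a \<le> b \<Longrightarrow> H b - H a = integral {a..b} h"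
  unfolding H_eq using Henstock_Kurzweil_Integration.integral_combine[of 0 a b h] h_integrable[of 0 b] by simp

lemma integral_h_bounds:
  assumes "0 \<le> a" "a \<le> b"
  shows "(b - a) * h a \<le> integral {a..b} h" "integral {a..b} h \<le> (b - a) * h b"
proof -
  have "integral {a..b} (\<lambda>_. h a) \<le> integral {a..b} h"
    using assms by (intro integral_le h_integrable h_mono) auto
  then show "(b - a) * h a \<le> integral {a..b} h" using assms by simp
  have "integral {a..b} h \<le> integral {a..b} (\<lambda>_. h b)"
    using assms by (intro integral_le h_integrable h_mono) auto
  then show "integral {a..b} h \<le> (b - a) * h b" using assms by simp
qed

lemma H_0 [simp]: "H 0 = 0"
  by (simp add: H_eq)

lemma H_mono: "0 \<le> a \<Longrightarrow> a \<le> b \<Longrightarrow> H a \<le> H b"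
  using H_diff[of a b] integral_h_bounds[of a b] h_nonneg[of a] mult_nonneg_nonneg[of "b - a" "h a"] by linarith

lemma H_nonneg: "0 \<le> t \<Longrightarrow> 0 \<le> H t"
  using H_mono[of 0 t] by simp

text \<open>Convexity of \<open>H\<close> together with \<open>H 0 = 0\<close>, read off from the
  monotone derivative \<open>h\<close>. It replaces homogeneity: shrinking the argument by
  \<open>k\<close> gains at least a factor \<open>k\<close>.\<close>

lemma H_shrink:
  assumes "t \<ge> 0" "k \<ge> 1"
  shows "k * H (t / k) \<le> H t"
proof -
  define a where "a = t / k"
  have a: "0 \<le> a" "a \<le> t" "t = k * a" using assms mult_right_mono[of 1 k t] by (auto simp: a_def field_simps)
  have "H a \<le> a * h a" using H_diff[of 0 a] integral_h_bounds[of 0 a] a by simp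
  then have "(k - 1) * H a \<le> (k - 1) * (a * h a)" using assms by (intro mult_left_mono) auto
  also have "\<dots> = (t - a) * h a" by (simp add: a(3) algebra_simps)
  also have "\<dots> \<le> H t - H a" using H_diff[of a t] integral_h_bounds[of a t] a by simp
  finally show ?thesis unfolding a_def[symmetric] by (simp add: algebra_simps)
qed

lemma H_cont: "continuous_on {0..} H"
proof -
  have "continuous_on {0..b} H" for b
    unfolding H_eq by (intro indefinite_integral_continuous_1 h_integrable) simp
  then have "continuous (at x within {0..}) H" if "x \<ge> 0" for x
  proof -
    have "continuous (at x within {0..x+1}) H"
      using \<open>\<And>b. continuous_on {0..b} H\<close>[of "x+1"] that by (simp add: continuous_on_eq_continuous_within)
    moreover have "at x within {0..x+1} = at x within {0..}"
      by (rule at_within_nhd[of _ "{..<x+1}"]) auto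
    ultimately show ?thesis by simp
  qed
  then show ?thesis by (simp add: continuous_on_eq_continuous_within)
qed

text \<open>With frozen exponents \<open>H\<close> is a sum of two pure powers; the scaling
  estimates for small arguments rest on this formula.\<close>

lemma H_unit_interval:
  assumes "0 \<le> t" "t \<le> 1"
  shows "H t = t powr p 0 / p 0 + m * (t powr q 0 / q 0)"
proof -
  have "((\<lambda>s. s powr (p 0 - 1)) has_integral (t powr (p 0 - 1 + 1) / (p 0 - 1 + 1))) {0..t}"
    using assms p_ge[of 0] P by (intro has_integral_powr_from_0) auto
  moreover have "((\<lambda>s. s powr (q 0 - 1)) has_integral (t powr (q 0 - 1 + 1) / (q 0 - 1 + 1))) {0..t}"
    using assms q_ge[of 0] P by (intro has_integral_powr_from_0) auto
  ultimately have "((\<lambda>s. s powr (p 0 - 1) + m * s powr (q 0 - 1)) has_integral (t powr p 0 / p 0 + m * (t powr q 0 / q 0))) {0..t}"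
    by (intro has_integral_add has_integral_mult_right) auto
  then have "(h has_integral (t powr p 0 / p 0 + m * (t powr q 0 / q 0))) {0..t}"
  proof (rule has_integral_eq[rotated])
    fix s assume "s \<in> {0..t}"
    then have "p s = p 0" "q s = q 0" using assms by (auto intro!: p_const q_const)
    then show "s powr (p 0 - 1) + m * s powr (q 0 - 1) = h s" by (simp add: h_def)
  qed
  then show ?thesis unfolding H_eq by (rule integral_unique)
qed

lemma H_lower_small:
  assumes "0 \<le> t" "t \<le> 1"
  shows "t powr Q \<le> Q * H t"
proof -
  have p0: "2 \<le> p 0" "p 0 \<le> Q" using p_ge[of 0] p_le[of 0] P by auto
  have q0: "2 \<le> q 0" using q_ge[of 0] P by auto
  have "t powr Q \<le> t powr p 0" using assms p0 by (cases "t = 0") (auto intro!: powr_mono')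
  also have "\<dots> = p 0 * (t powr p 0 / p 0)" using p0 by simp
  also have "\<dots> \<le> Q * (t powr p 0 / p 0)" using p0 by (intro mult_right_mono) auto
  also have "\<dots> \<le> Q * H t"
    unfolding H_unit_interval[OF assms] using p0 q0 m by (intro mult_left_mono) auto
  finally show ?thesis .
qed

text \<open>A doubling estimate that holds as long as the enlarged argument stays in the unit
  interval, where only pure powers with exponents at most \<open>Q\<close> occur.\<close>

lemma H_scale_small:
  assumes "0 \<le> a" "1 \<le> k" "k * a \<le> 1"
  shows "H (k * a) \<le> k powr Q * H a"
proof -
  have a: "a \<le> 1" using assms mult_right_mono[of 1 k a] by simp
  have p0: "2 \<le> p 0" "p 0 \<le> Q" using p_ge[of 0] p_le[of 0] P by auto
  have q0: "2 \<le> q 0" "q 0 \<le> Q" using q_ge[of 0] q_le[of 0] P by auto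
  have *: "(k * a) powr r / r \<le> k powr Q * (a powr r / r)" if "2 \<le> r" "r \<le> Q" for r
  proof -
    have "k powr r * (a powr r / r) \<le> k powr Q * (a powr r / r)"
      using that assms by (intro mult_right_mono powr_mono) auto
    then show ?thesis using assms by (simp add: powr_mult)
  qed
  have "H (k * a) \<le> k powr Q * (a powr p 0 / p 0) + m * (k powr Q * (a powr q 0 / q 0))"
    unfolding H_unit_interval[of "k * a", OF mult_nonneg_nonneg[OF order_trans[OF zero_le_one assms(2)] assms(1)] assms(3)]
    using p0 q0 m by (intro add_mono mult_left_mono *) auto
  also have "\<dots> = k powr Q * H a"
    unfolding H_unit_interval[OF assms(1) a] by (simp add: algebra_simps)
  finally show ?thesis .
qed

text \<open>Integrate \<open>s powr (P - 1) \<le> h s\<close> from 1 to \<open>t\<close>. The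
  starting value comes from \<open>H_lower_small\<close> at 1, and \<open>P \<le> Q\<close> allows
  the single constant \<open>Q\<close>.\<close>

lemma H_lower_large:
  assumes "1 \<le> t"
  shows "t powr P \<le> Q * H t"
proof -
  have Q: "Q \<ge> 2" using PQ P by simp
  have "((\<lambda>s. s powr (P - 1)) has_integral (t powr P / P - 1 powr P / P)) {1..t}"
  proof (rule fundamental_theorem_of_calculus[OF assms])
    fix s assume "s \<in> {1..t}"
    then have "((\<lambda>s. s powr P / P) has_real_derivative s powr (P - 1)) (at s)"
      using P DERIV_cdivide[OF has_real_derivative_powr[of s P], of P] by simp
    then show "((\<lambda>s. s powr P / P) has_vector_derivative s powr (P - 1)) (at s within {1..t})"
      by (simp add: has_real_derivative_iff_has_vector_derivative has_vector_derivative_at_within)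
  qed
  moreover have "(h has_integral (H t - H 1)) {1..t}"
    using H_diff[of 1 t] assms h_integrable[of 1 t] by (simp add: integrable_integral)
  moreover have "s powr (P - 1) \<le> h s" if "s \<in> {1..t}" for s
  proof -
    have "s powr (P - 1) \<le> s powr (p s - 1)" using that p_ge[of s] by (intro powr_mono) auto
    also have "\<dots> \<le> h s" using m by (simp add: h_def)
    finally show ?thesis .
  qed
  ultimately have "t powr P / P - 1 powr P / P \<le> H t - H 1"
    by (rule has_integral_le)
  then have "t powr P / P - 1 / P \<le> H t - H 1" by simp
  then have "Q * (t powr P / P - 1 / P) \<le> Q * (H t - H 1)" using Q by (intro mult_left_mono) auto
  moreover have "1 \<le> Q * H 1" using H_lower_small[of 1] by simp
  moreover have "t powr P - 1 \<le> Q * (t powr P / P - 1 / P)"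
  proof -
    have "1 \<le> t powr P" using assms P by (intro ge_one_powr_ge_zero) auto
    then have "P * ((t powr P - 1) / P) \<le> Q * ((t powr P - 1) / P)"
      using P PQ by (intro mult_right_mono) auto
    moreover have "P * ((t powr P - 1) / P) = t powr P - 1" using P by simp
    ultimately show ?thesis by (simp only: diff_divide_distrib)
  qed
  ultimately show ?thesis by (simp add: right_diff_distrib)
qed

lemma H_upper_large:
  assumes "1 \<le> t"
  shows "H t \<le> (1 + M) * t powr Q"
proof -
  have "H t \<le> t * h t" using H_diff[of 0 t] integral_h_bounds[of 0 t] assms by simp
  also have "h t \<le> t powr (Q - 1) + M * t powr (Q - 1)"
    unfolding h_def using assms m p_le[of t] q_le[of t] by (intro add_mono mult_mono powr_mono) auto
  also have "\<dots> = (1 + M) * t powr (Q - 1)" by (simp add: algebra_simps)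
  also have "t * ((1 + M) * t powr (Q - 1)) = (1 + M) * t powr Q"
    using assms by (simp add: powr_diff)
  finally show ?thesis using assms by (simp add: mult_left_mono)
qed

end

section \<open>Essential bounds and measurability of the exponents\<close>

lemma ess_bound_everywhere:
  fixes f :: "'a::euclidean_space \<Rightarrow> real \<Rightarrow> real"
  assumes ae: "AE z in lebesgue_on (UNIV \<times> {0..}). f (fst z) (snd z) \<le> c"
    and cont: "AE x in lebesgue. continuous_on {0..} (f x)"
  shows "AE x in lebesgue. \<forall>t\<ge>0. f x t \<le> c"
proof -
  have "AE z in (lebesgue :: ('a \<times> real) measure). z \<in> UNIV \<times> {0..} \<longrightarrow> f (fst z) (snd z) \<le> c"
  proof -
    have "closed (UNIV \<times> {0..} :: ('a \<times> real) set)" by (intro closed_Times) auto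
    then have "(UNIV \<times> {0..} :: ('a \<times> real) set) \<in> sets lebesgue"
      by (intro sets_completionI_sets) (simp add: borel_closed)
    then show ?thesis using ae by (subst (asm) AE_restrict_space_iff) auto
  qed
  then have "AE z in (lborel \<Otimes>\<^sub>M lborel :: ('a \<times> real) measure). z \<in> UNIV \<times> {0..} \<longrightarrow> f (fst z) (snd z) \<le> c"
    unfolding lborel_prod AE_completion_iff .
  \<comment> \<open>Fubini for null sets gives, for almost every \<open>x\<close>, the bound for
    almost every \<open>t\<close>; continuity in \<open>t\<close> removes the second
    exception.\<close>
  then have "AE x in lborel. AE t in lborel. t \<ge> 0 \<longrightarrow> f x t \<le> c"
    using lborel_pair.AE_pair by fastforce
  then have "AE x in lebesgue. AE t in lborel. t \<ge> 0 \<longrightarrow> f x t \<le> c"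
    by (rule AE_completion)
  with cont show ?thesis
  proof eventually_elim
    case (elim x)
    show ?case
    proof (rule ccontr)
      assume "\<not> (\<forall>t\<ge>0. f x t \<le> c)"
      then obtain t where t: "t \<ge> 0" "f x t > c" by auto
      \<comment> \<open>Freezing the function to the left of 0 extends it continuously to the whole
        line, so \<open>t = 0\<close> needs no special treatment.\<close>
      have "isCont (\<lambda>s. f x (max s 0)) t"
      proof -
        have "continuous_on UNIV (\<lambda>s. f x (max s 0))"
          by (rule continuous_on_compose2[OF elim(1)]) (auto intro!: continuous_intros)
        then show ?thesis by (simp add: continuous_on_eq_continuous_at)
      qed
      then have "((\<lambda>s. f x (max s 0)) \<longlongrightarrow> f x (max t 0)) (nhds t)"
        using tendsto_at_iff_tendsto_nhds[of "\<lambda>s. f x (max s 0)" t] by (simp add: isCont_def)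
      moreover have "c < f x (max t 0)" using t by simp
      ultimately have "\<forall>\<^sub>F s in nhds t. f x (max s 0) > c" by (rule order_tendstoD(1))
      then obtain \<delta> where \<delta>: "\<delta> > 0" "\<And>s. dist s t < \<delta> \<Longrightarrow> f x (max s 0) > c"
        by (auto simp: eventually_nhds_metric)
      \<comment> \<open>The interval to the right of \<open>t\<close> stays in the half-line even
        for \<open>t = 0\<close>.\<close>
      have "AE s in lborel. s \<notin> {t<..<t + \<delta>}"
        using elim(2)
      proof (rule AE_mp, intro AE_I2 impI notI)
        fix s assume "s \<ge> 0 \<longrightarrow> f x s \<le> c" "s \<in> {t<..<t + \<delta>}"
        then show False using t \<delta>(2)[of s] by (simp add: dist_real_def max_def split: if_splits)
      qed
      then have "emeasure lborel {t<..<t + \<delta>} = 0"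
        by (subst (asm) AE_iff_measurable[OF _ refl]) (auto simp: greaterThanLessThan_eq Int_def)
      then show False using \<delta>(1) by simp
    qed
  qed
qed

lemma esssup_exp_bound:
  fixes f :: "'a::euclidean_space \<Rightarrow> real \<Rightarrow> real"
  assumes "caratheodory f" "ess_sup_exp f \<le> ereal c"
  shows "AE x in lebesgue. \<forall>t\<ge>0. f x t \<le> c"
proof (rule ess_bound_everywhere)
  have "AE z in lebesgue_on (UNIV \<times> {0..}). (case z of (x, t) \<Rightarrow> ereal (f x t)) \<le> ess_sup_exp f"
    unfolding ess_sup_exp_def by (rule esssup_AE)
  then show "AE z in lebesgue_on (UNIV \<times> {0..}). f (fst z) (snd z) \<le> c"
  proof (rule AE_mp, intro AE_I2 impI)
    fix z :: "'a \<times> real" assume "(case z of (x, t) \<Rightarrow> ereal (f x t)) \<le> ess_sup_exp f"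
    from order_trans[OF this assms(2)] show "f (fst z) (snd z) \<le> c" by (cases z) simp
  qed
qed (use assms in \<open>simp add: caratheodory_def\<close>)

lemma essinf_exp_bound:
  fixes f :: "'a::euclidean_space \<Rightarrow> real \<Rightarrow> real"
  assumes "caratheodory f" "ereal c \<le> ess_inf_exp f"
  shows "AE x in lebesgue. \<forall>t\<ge>0. c \<le> f x t"
proof -
  have "AE x in lebesgue. \<forall>t\<ge>0. - f x t \<le> - c"
  proof (rule ess_bound_everywhere)
    have "AE z in lebesgue_on (UNIV \<times> {0..}). (case z of (x, t) \<Rightarrow> - ereal (f x t)) \<le> - ess_inf_exp f"
      unfolding ess_inf_exp_def ereal_uminus_uminus by (rule esssup_AE)
    then show "AE z in lebesgue_on (UNIV \<times> {0..}). - f (fst z) (snd z) \<le> - c"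
    proof (rule AE_mp, intro AE_I2 impI)
      fix z :: "'a \<times> real" assume *: "(case z of (x, t) \<Rightarrow> - ereal (f x t)) \<le> - ess_inf_exp f"
      have "- ess_inf_exp f \<le> - ereal c" using assms(2) by (simp only: ereal_minus_le_minus)
      from order_trans[OF * this] show "- f (fst z) (snd z) \<le> - c" by (cases z) simp
    qed
    show "AE x in lebesgue. continuous_on {0..} (\<lambda>t. - f x t)"
    proof -
      have "AE x in lebesgue. continuous_on {0..} (f x)" using assms by (simp add: caratheodory_def)
      then show ?thesis by eventually_elim (rule continuous_on_minus)
    qed
  qed
  then show ?thesis by simp
qed

text \<open>Approximate by step functions in the second argument.\<close>

lemma caratheodory_jointly_measurable:
  fixes f :: "'a::euclidean_space \<Rightarrow> real \<Rightarrow> real"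
  assumes "caratheodory f"
  obtains f' where "(\<lambda>(x, t). f' x t) \<in> borel_measurable (lebesgue \<Otimes>\<^sub>M borel)"
    "AE x in lebesgue. \<forall>t\<ge>0. f' x t = f x t"
proof -
  define a where "a n t = real (nat \<lfloor>real (Suc n) * t\<rfloor>) / real (Suc n)" for n t
  \<comment> \<open>\<open>lim\<close> has some value at every argument, so \<open>f'\<close> is
    measurable everywhere; it represents \<open>f\<close> for \<open>t \<ge> 0\<close> and those
    \<open>x\<close> at which \<open>f x\<close> is continuous.\<close>
  define f' where "f' x t = lim (\<lambda>n. f x (a n t))" for x t
  have a: "(\<lambda>n. a n t) \<longlonglongrightarrow> t" if "t \<ge> 0" for t
  proof (rule tendsto_sandwich[of "\<lambda>n. t - 1 / real (Suc n)" _ _ "\<lambda>n. t"])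
    have *: "t - 1 / real (Suc n) \<le> a n t \<and> a n t \<le> t" for n
    proof -
      define N where "N = real (Suc n)"
      have N: "N > 0" by (simp add: N_def)
      have "a n t = real_of_int \<lfloor>N * t\<rfloor> / N" using that by (simp add: a_def N_def)
      moreover have "real_of_int \<lfloor>N * t\<rfloor> / N \<le> (N * t) / N" "(N * t - 1) / N \<le> real_of_int \<lfloor>N * t\<rfloor> / N"
        using N by (intro divide_right_mono; linarith)+
      moreover have "(N * t) / N = t" "(N * t - 1) / N = t - 1 / N" using N by (auto simp: field_simps)
      ultimately show ?thesis unfolding N_def by simp
    qed
    show "\<forall>\<^sub>F n in sequentially. t - 1 / real (Suc n) \<le> a n t" "\<forall>\<^sub>F n in sequentially. a n t \<le> t" using * by auto
    have "(\<lambda>n. t - inverse (real (Suc n))) \<longlonglongrightarrow> t - 0" by (intro tendsto_intros LIMSEQ_inverse_real_of_nat)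
    then show "(\<lambda>n. t - 1 / real (Suc n)) \<longlonglongrightarrow> t" by (simp add: inverse_eq_divide)
  qed auto
  show ?thesis
  proof (rule that[of f'])
    have meas: "(\<lambda>z. f (fst z) (a n (snd z))) \<in> borel_measurable (lebesgue \<Otimes>\<^sub>M borel)" for n
    proof -
      have "(\<lambda>z. f (fst z) (real i / real (Suc n))) \<in> borel_measurable (lebesgue \<Otimes>\<^sub>M borel)" for i :: nat
      proof -
        have "(\<lambda>x. f x (real i / real (Suc n))) \<in> borel_measurable lebesgue"
          using assms by (simp add: caratheodory_def)
        then show ?thesis by (rule measurable_compose[OF measurable_fst])
      qed
      moreover have "(\<lambda>z. nat \<lfloor>real (Suc n) * snd z\<rfloor>) \<in> (lebesgue \<Otimes>\<^sub>M borel :: ('a \<times> real) measure) \<rightarrow>\<^sub>M count_space UNIV"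
        by measurable
      ultimately show ?thesis unfolding a_def by (rule measurable_compose_countable)
    qed
    have "(\<lambda>z. lim (\<lambda>n. f (fst z) (a n (snd z)))) \<in> borel_measurable (lebesgue \<Otimes>\<^sub>M borel)"
      by (rule borel_measurable_lim_metric) (rule meas)
    then show "(\<lambda>(x, t). f' x t) \<in> borel_measurable (lebesgue \<Otimes>\<^sub>M borel)"
      by (simp add: f'_def case_prod_beta')
    have "AE x in lebesgue. continuous_on {0..} (f x)" using assms by (simp add: caratheodory_def)
    then show "AE x in lebesgue. \<forall>t\<ge>0. f' x t = f x t"
    proof eventually_elim
      case (elim x)
      show ?case
      proof (intro allI impI)
        fix t :: real assume t: "t \<ge> 0"
        have "(\<lambda>n. f x (a n t)) \<longlonglongrightarrow> f x t"
          by (rule continuous_on_tendsto_compose[OF elim a[OF t]]) (use t in \<open>auto simp: a_def\<close>)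
        then show "f' x t = f x t" unfolding f'_def by (rule limI)
      qed
    qed
  qed
qed

text \<open>The endpoint \<open>w x\<close> moves into the integrand as the condition
  \<open>s \<le> w x\<close>; then the integral depends measurably on the parameter, because the
  exponents have jointly measurable versions.\<close>

lemma double_phase_measurable:
  fixes w :: "'a::euclidean_space \<Rightarrow> real"
  assumes "caratheodory p" "caratheodory q"
    and [measurable]: "\<mu> \<in> borel_measurable lebesgue" "w \<in> borel_measurable lebesgue"
  shows "(\<lambda>x. double_phase p q \<mu> x (w x)) \<in> borel_measurable lebesgue"
proof -
  obtain p' where p'[measurable]: "(\<lambda>(x, t). p' x t) \<in> borel_measurable (lebesgue \<Otimes>\<^sub>M borel)"
    and pp: "AE x in lebesgue. \<forall>t\<ge>0. p' x t = p x t"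
    using caratheodory_jointly_measurable[OF assms(1)] by blast
  obtain q' where q'[measurable]: "(\<lambda>(x, t). q' x t) \<in> borel_measurable (lebesgue \<Otimes>\<^sub>M borel)"
    and qq: "AE x in lebesgue. \<forall>t\<ge>0. q' x t = q x t"
    using caratheodory_jointly_measurable[OF assms(2)] by blast
  define F where "F x s = (if 0 \<le> s \<and> s \<le> w x then s powr (p' x s - 1) + \<mu> x * s powr (q' x s - 1) else 0)" for x s
  have [measurable]: "(\<lambda>z. p' (fst z) (snd z)) \<in> borel_measurable (lebesgue \<Otimes>\<^sub>M borel)"
    "(\<lambda>z. q' (fst z) (snd z)) \<in> borel_measurable (lebesgue \<Otimes>\<^sub>M borel)"
    using p' q' by (simp_all add: case_prod_beta')
  have "(\<lambda>z. F (fst z) (snd z)) \<in> borel_measurable (lebesgue \<Otimes>\<^sub>M borel)"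
    unfolding F_def by measurable
  then have "(\<lambda>(x, s). F x s) \<in> borel_measurable (lebesgue \<Otimes>\<^sub>M lborel)"
    by (simp add: case_prod_beta' cong: measurable_cong_sets)
  then have "(\<lambda>x. LINT s|lborel. F x s) \<in> borel_measurable lebesgue"
    by (rule lborel.borel_measurable_lebesgue_integral)
  moreover have "AE x in lebesgue. (LINT s|lborel. F x s) = double_phase p q \<mu> x (w x)"
    using pp qq
  proof eventually_elim
    case (elim x)
    show ?case unfolding double_phase_def set_lebesgue_integral_def
    proof (rule Bochner_Integration.integral_cong[OF refl])
      fix s :: real
      show "F x s = indicator {0..w x} s *\<^sub>R (s powr (p x s - 1) + \<mu> x * s powr (q x s - 1))"
        using elim(1)[rule_format, of s] elim(2)[rule_format, of s] by (simp add: F_def indicator_def)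
    qed
  qed
  ultimately show ?thesis by (rule borel_measurable_AE)
qed

section \<open>Compactness of the embedding\<close>

text \<open>\<open>P\<close> and \<open>Q\<close> are real numbers in place of the extended-real
  essential bounds, and \<open>phase_AE\<close> collects the pointwise conditions on the exponents
  outside one null set.\<close>

locale double_phase_setting =
  fixes p q :: "'a::euclidean_space \<Rightarrow> real \<Rightarrow> real" and \<mu> V :: "'a \<Rightarrow> real" and P Q M V\<^sub>0 :: real
  assumes phase_AE: "AE x in lebesgue. phase (p x) (q x) (\<mu> x) P Q M"
    and p_carath: "caratheodory p" and q_carath: "caratheodory q"
    and \<mu>_measurable: "\<mu> \<in> borel_measurable lebesgue"
    and P_ge: "2 \<le> P" and P_le_Q: "P \<le> Q" and M_nonneg: "0 \<le> M"
    and ratio: "Q < P * (1 + 1 / real DIM('a))"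
    and V_measurable [measurable]: "V \<in> borel_measurable lebesgue"
    and V\<^sub>0_pos: "V\<^sub>0 > 0" and V_lower: "\<And>x. V\<^sub>0 \<le> V x"
    and V_sublevel: "\<And>L. L > 0 \<Longrightarrow> emeasure lebesgue {x. V x < L} < \<infinity>"
begin

abbreviation D :: "'a \<Rightarrow> real \<Rightarrow> real" where
  "D \<equiv> double_phase p q \<mu>"

abbreviation modular :: "('a \<Rightarrow> real) \<Rightarrow> ennreal" where
  "modular w \<equiv> (\<integral>\<^sup>+x. ennreal (D x (w x)) \<partial>lebesgue)"

abbreviation V_modular :: "('a \<Rightarrow> real) \<Rightarrow> ennreal" where
  "V_modular w \<equiv> (\<integral>\<^sup>+x. ennreal (V x * D x (w x)) \<partial>lebesgue)"

abbreviation good :: "'a \<Rightarrow> bool" where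
  "good x \<equiv> phase (p x) (q x) (\<mu> x) P Q M"

lemma D_measurable [measurable]:
  "w \<in> borel_measurable lebesgue \<Longrightarrow> (\<lambda>x. D x (w x)) \<in> borel_measurable lebesgue"
  using double_phase_measurable[OF p_carath q_carath \<mu>_measurable] .

lemma V_pos: "V x > 0"
  using V\<^sub>0_pos V_lower[of x] by linarith

lemma D_eq: "good x \<Longrightarrow> D x = phase.H (p x) (q x) (\<mu> x)"
proof -
  assume "good x"
  then interpret phase "p x" "q x" "\<mu> x" P Q M .
  show ?thesis unfolding double_phase_def H_def h_def ..
qed

lemma
  assumes g: "good x"
  shows D_0: "D x 0 = 0"
    and D_mono: "\<And>a b. 0 \<le> a \<Longrightarrow> a \<le> b \<Longrightarrow> D x a \<le> D x b"
    and D_nonneg: "\<And>t. 0 \<le> t \<Longrightarrow> 0 \<le> D x t"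
    and D_shrink: "\<And>t k. 0 \<le> t \<Longrightarrow> 1 \<le> k \<Longrightarrow> k * D x (t / k) \<le> D x t"
    and D_cont: "continuous_on {0..} (D x)"
    and D_lower_small: "\<And>t. 0 \<le> t \<Longrightarrow> t \<le> 1 \<Longrightarrow> t powr Q \<le> Q * D x t"
    and D_lower_large: "\<And>t. 1 \<le> t \<Longrightarrow> t powr P \<le> Q * D x t"
    and D_scale_small: "\<And>a k. 0 \<le> a \<Longrightarrow> 1 \<le> k \<Longrightarrow> k * a \<le> 1 \<Longrightarrow> D x (k * a) \<le> k powr Q * D x a"
    and D_upper_large: "\<And>t. 1 \<le> t \<Longrightarrow> D x t \<le> (1 + M) * t powr Q"
  unfolding D_eq[OF g]
  by (rule phase.H_0[OF g] phase.H_cont[OF g]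
      | (rule phase.H_mono[OF g] phase.H_nonneg[OF g] phase.H_shrink[OF g] phase.H_lower_small[OF g]
          phase.H_lower_large[OF g] phase.H_scale_small[OF g] phase.H_upper_large[OF g]; assumption))+

lemma nn_integral_mono_good:
  "(\<And>x. good x \<Longrightarrow> f x \<le> g x) \<Longrightarrow> (\<integral>\<^sup>+x. f x \<partial>lebesgue) \<le> (\<integral>\<^sup>+x. g x \<partial>lebesgue)"
  by (rule nn_integral_mono_AE, rule AE_mp[OF phase_AE]) auto

text \<open>By \<open>D_shrink\<close>, dividing the argument by \<open>k \<ge> 1\<close> divides
  the modular by at least \<open>k\<close>, so a modular finite at one scale is at most 1 at a
  larger one. Nonemptiness matters because \<open>Inf\<close> of an empty set of reals carries no
  information. The weight \<open>W\<close> will be 1 or \<open>V\<close>.\<close>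

lemma luxemburg_set_nonempty:
  fixes W :: "'a \<Rightarrow> real"
  assumes [measurable]: "W \<in> borel_measurable lebesgue" "w \<in> borel_measurable lebesgue" and W: "\<And>x. W x \<ge> 0"
    and fin: "(\<integral>\<^sup>+x. ennreal (W x * D x (\<sigma> * \<bar>w x\<bar>)) \<partial>lebesgue) < \<infinity>" and \<sigma>: "\<sigma> > 0"
  obtains \<tau> where "\<tau> > 0" "(\<integral>\<^sup>+x. ennreal (W x * D x (\<bar>w x\<bar> / \<tau>)) \<partial>lebesgue) \<le> 1"
proof -
  obtain c where c: "(\<integral>\<^sup>+x. ennreal (W x * D x (\<sigma> * \<bar>w x\<bar>)) \<partial>lebesgue) = ennreal c" "c \<ge> 0"
    using fin by (cases "\<integral>\<^sup>+x. ennreal (W x * D x (\<sigma> * \<bar>w x\<bar>)) \<partial>lebesgue") auto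
  define k where "k = max 1 c"
  have k: "k \<ge> 1" "c \<le> k" by (auto simp: k_def)
  have "(\<integral>\<^sup>+x. ennreal (W x * D x (\<bar>w x\<bar> / (k / \<sigma>))) \<partial>lebesgue) \<le> (\<integral>\<^sup>+x. ennreal (1 / k) * ennreal (W x * D x (\<sigma> * \<bar>w x\<bar>)) \<partial>lebesgue)"
  proof (rule nn_integral_mono_good, goal_cases)
    case elim: (1 x)
    have "k * D x ((\<sigma> * \<bar>w x\<bar>) / k) \<le> D x (\<sigma> * \<bar>w x\<bar>)" using \<sigma> k by (intro D_shrink[OF elim]) auto
    then have "D x (\<bar>w x\<bar> / (k / \<sigma>)) \<le> (1 / k) * D x (\<sigma> * \<bar>w x\<bar>)"
      using k by (simp add: field_simps)
    then have "W x * D x (\<bar>w x\<bar> / (k / \<sigma>)) \<le> W x * ((1 / k) * D x (\<sigma> * \<bar>w x\<bar>))"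
      by (intro mult_left_mono W)
    also have "\<dots> = (1 / k) * (W x * D x (\<sigma> * \<bar>w x\<bar>))" by simp
    finally show ?case
      using k W[of x] D_nonneg[OF elim, of "\<sigma> * \<bar>w x\<bar>"] \<sigma>
      by (subst ennreal_mult[symmetric]) (auto intro!: ennreal_leI)
  qed
  also have "\<dots> = ennreal (1 / k) * (\<integral>\<^sup>+x. ennreal (W x * D x (\<sigma> * \<bar>w x\<bar>)) \<partial>lebesgue)"
    by (rule nn_integral_cmult) measurable
  also have "\<dots> = ennreal (c / k)" using c k by (simp add: ennreal_mult[symmetric])
  also have "\<dots> \<le> 1" using k c by (simp add: divide_le_eq)
  finally show ?thesis using that[of "k / \<sigma>"] k \<sigma> by auto
qed

text \<open>The strict inequality supplies an admissible \<open>\<tau> < B\<close>, and monotonicity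
  transfers the bound to \<open>B\<close>; no limit at the infimum itself is taken.\<close>

lemma modular_le_one_if_luxemburg_less:
  fixes W :: "'a \<Rightarrow> real"
  assumes W: "\<And>x. W x \<ge> 0"
    and ne: "\<exists>\<tau>>0. (\<integral>\<^sup>+x. ennreal (W x * D x (\<bar>w x\<bar> / \<tau>)) \<partial>lebesgue) \<le> 1"
    and less: "Inf {\<tau>. \<tau> > 0 \<and> (\<integral>\<^sup>+x. ennreal (W x * D x (\<bar>w x\<bar> / \<tau>)) \<partial>lebesgue) \<le> 1} < B"
  shows "(\<integral>\<^sup>+x. ennreal (W x * D x (\<bar>w x\<bar> / B)) \<partial>lebesgue) \<le> 1"
proof -
  let ?S = "{\<tau>. \<tau> > 0 \<and> (\<integral>\<^sup>+x. ennreal (W x * D x (\<bar>w x\<bar> / \<tau>)) \<partial>lebesgue) \<le> 1}"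
  have "bdd_below ?S" by (rule bdd_belowI[of _ 0]) auto
  moreover have "?S \<noteq> {}" using ne by auto
  ultimately obtain \<tau> where \<tau>: "\<tau> > 0" "\<tau> < B" "(\<integral>\<^sup>+x. ennreal (W x * D x (\<bar>w x\<bar> / \<tau>)) \<partial>lebesgue) \<le> 1"
    using less by (subst (asm) cInf_less_iff) auto
  have "(\<integral>\<^sup>+x. ennreal (W x * D x (\<bar>w x\<bar> / B)) \<partial>lebesgue) \<le> (\<integral>\<^sup>+x. ennreal (W x * D x (\<bar>w x\<bar> / \<tau>)) \<partial>lebesgue)"
  proof (rule nn_integral_mono_good, goal_cases)
    case elim: (1 x)
    show ?case using \<tau> by (intro ennreal_leI mult_left_mono W D_mono[OF elim] divide_left_mono) auto
  qed
  also note \<tau>(3)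
  finally show ?thesis .
qed

lemma luxemburg_Inf_nonneg:
  fixes F :: "real \<Rightarrow> ennreal"
  assumes "\<exists>\<tau>>0. F \<tau> \<le> 1"
  shows "0 \<le> Inf {\<tau>. \<tau> > 0 \<and> F \<tau> \<le> 1}"
  using assms by (intro cInf_greatest) auto

lemma L_luxemburg_nonempty:
  assumes "w \<in> L_space D"
  shows "\<exists>\<tau>>0. modular (\<lambda>x. \<bar>w x\<bar> / \<tau>) \<le> 1"
proof -
  obtain \<sigma> where *: "w \<in> borel_measurable lebesgue" "\<sigma> > 0" "modular (\<lambda>x. \<sigma> * \<bar>w x\<bar>) < \<infinity>"
    using assms by (auto simp: L_space_def)
  then show ?thesis
    using luxemburg_set_nonempty[of "\<lambda>_. 1" w \<sigma>] by auto
qed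

lemma LV_luxemburg_nonempty:
  assumes "u \<in> W1V_space V D"
  shows "\<exists>\<tau>>0. V_modular (\<lambda>x. \<bar>u x\<bar> / \<tau>) \<le> 1"
proof -
  have "u \<in> borel_measurable lebesgue" "V_modular (\<lambda>x. 1 * \<bar>u x\<bar>) < \<infinity>"
    using assms by (auto simp: W1V_space_def W1_space_def L_space_def)
  then show ?thesis
    using luxemburg_set_nonempty[of V u 1] V_pos less_imp_le by (metis V_measurable zero_less_one)
qed

text \<open>The constant satisfies \<open>1 / C \<le> V x\<close>, and \<open>C \<ge> 1\<close> is
  what \<open>D_shrink\<close> needs to bring \<open>C\<close> from the argument of the integrand to
  the front. Hence every scale admissible for the weighted norm is admissible for the other one
  after multiplication by \<open>C\<close>.\<close>

lemma embedding_bound: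
  assumes u: "u \<in> W1V_space V D"
  shows "L_norm D u \<le> max 1 (1 / V\<^sub>0) * W1V_norm V D u"
proof -
  define C where "C = max 1 (1 / V\<^sub>0)"
  have C: "C \<ge> 1" "1 / C \<le> V\<^sub>0" using V\<^sub>0_pos by (auto simp: C_def max_def field_simps)
  let ?S = "{\<tau>. \<tau> > 0 \<and> V_modular (\<lambda>x. \<bar>u x\<bar> / \<tau>) \<le> 1}"
  have le: "L_norm D u \<le> C * \<tau>" if "\<tau> \<in> ?S" for \<tau>
    unfolding L_norm_def
  proof (rule cInf_lower)
    have "modular (\<lambda>x. \<bar>u x\<bar> / (C * \<tau>)) \<le> V_modular (\<lambda>x. \<bar>u x\<bar> / \<tau>)"
    proof (rule nn_integral_mono_good, goal_cases)
      case elim: (1 x)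
      have "C * D x ((\<bar>u x\<bar> / \<tau>) / C) \<le> D x (\<bar>u x\<bar> / \<tau>)" using that C by (intro D_shrink[OF elim]) auto
      then have "D x (\<bar>u x\<bar> / (C * \<tau>)) \<le> (1 / C) * D x (\<bar>u x\<bar> / \<tau>)"
        using C by (simp add: field_simps)
      also have "\<dots> \<le> V x * D x (\<bar>u x\<bar> / \<tau>)"
        using C V_lower[of x] that by (intro mult_right_mono D_nonneg[OF elim]) auto
      finally show ?case by (rule ennreal_leI)
    qed
    also have "\<dots> \<le> 1" using that by simp
    finally show "C * \<tau> \<in> {\<tau>. \<tau> > 0 \<and> modular (\<lambda>x. \<bar>u x\<bar> / \<tau>) \<le> 1}"
      using C that by simp
  qed (auto intro!: bdd_belowI[of _ 0])
  have "L_norm D u / C \<le> LV_norm V D u"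
    unfolding LV_norm_def
  proof (rule cInf_greatest)
    show "?S \<noteq> {}" using LV_luxemburg_nonempty[OF u] by auto
    show "L_norm D u / C \<le> \<tau>" if "\<tau> \<in> ?S" for \<tau>
      using le[OF that] C by (simp add: divide_le_eq mult.commute)
  qed
  moreover have "0 \<le> L_norm D (\<lambda>x. norm (weak_gradient u x))"
    unfolding L_norm_def using u L_luxemburg_nonempty[of "\<lambda>x. norm (weak_gradient u x)"]
    by (intro luxemburg_Inf_nonneg) (auto simp: W1V_space_def W1_space_def)
  ultimately have "L_norm D u / C \<le> W1V_norm V D u" by (simp add: W1V_norm_def)
  then show ?thesis using C by (simp add: C_def[symmetric] divide_le_eq mult.commute)
qed

text \<open>There is no doubling condition: \<open>D x (2 t)\<close> need not be bounded by a multiple of \<open>D x t\<close>.  Rescaling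
  is therefore only used for small arguments; intermediate values are bounded on a set whose measure
  the modular controls, large ones by the \<open>r\<close>-th power.\<close>

lemma eventually_modular_le_one:
  fixes w :: "nat \<Rightarrow> 'a \<Rightarrow> real"
  assumes [measurable]: "\<And>n. w n \<in> borel_measurable lebesgue"
    and V_bound: "\<And>n. V_modular (\<lambda>x. \<bar>w n x\<bar> / a) \<le> ennreal C\<^sub>1"
    and r_bound: "\<And>n. tail_power lebesgue r b (\<lambda>x. \<bar>w n x\<bar>) \<le> ennreal C\<^sub>2"
    and "a > 0" "C\<^sub>1 \<ge> 0" "C\<^sub>2 \<ge> 0" "Q < r"
    and lim: "AE x in lebesgue. (\<lambda>n. w n x) \<longlonglongrightarrow> 0" and \<rho>: "\<rho> > 0"
  shows "\<forall>\<^sub>F n in sequentially. modular (\<lambda>x. \<bar>w n x\<bar> / \<rho>) \<le> 1"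
proof -
  have Q: "Q \<ge> 2" using P_ge P_le_Q by simp
  \<comment> \<open>The modular is bounded at scale \<open>a\<close> and wanted at scale
    \<open>\<rho>\<close>; \<open>\<kappa>\<close> is the enlargement of the argument in between.
    Below height \<open>\<delta> = a / \<kappa>\<close> the enlarged argument is at most 1, as
    \<open>D_scale_small\<close> requires.\<close>
  define \<kappa> where "\<kappa> = max 1 (a / \<rho>)"
  have \<kappa>: "\<kappa> \<ge> 1" "a / \<rho> \<le> \<kappa>" by (auto simp: \<kappa>_def)
  define \<delta> where "\<delta> = a / \<kappa>"
  have \<delta>: "\<delta> > 0" "\<delta> / a \<le> 1" using \<open>a > 0\<close> \<kappa> by (auto simp: \<delta>_def divide_le_eq)
  \<comment> \<open>The height \<open>T\<close> is chosen so that the tail contributes less than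
    1/3, which is possible because \<open>Q < r\<close>.\<close>
  have "((\<lambda>T. ((1 + M) * \<rho> powr (- Q) * C\<^sub>2) * T powr (Q - r)) \<longlongrightarrow> ((1 + M) * \<rho> powr (- Q) * C\<^sub>2) * 0) at_top"
    using \<open>Q < r\<close> by (intro tendsto_mult tendsto_const tendsto_neg_powr filterlim_ident) auto
  then have "\<forall>\<^sub>F T in at_top. ((1 + M) * \<rho> powr (- Q) * C\<^sub>2) * T powr (Q - r) < 1 / 3"
    by (intro order_tendstoD) auto
  then have "\<forall>\<^sub>F T in at_top. ((1 + M) * \<rho> powr (- Q) * C\<^sub>2) * T powr (Q - r) < 1 / 3 \<and> T \<ge> max (max b \<rho>) 1"
    by (intro eventually_conj eventually_ge_at_top)
  then obtain T where T: "((1 + M) * \<rho> powr (- Q) * C\<^sub>2) * T powr (Q - r) < 1 / 3" "T \<ge> b" "T \<ge> \<rho>" "T \<ge> 1"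
    by (auto dest: eventually_happens simp: trivial_limit_at_top_linorder)
  define KT where "KT = (1 + M) * (T / \<rho>) powr Q"
  define c where "c = (\<delta> / a) powr Q / Q"
  have KT: "KT \<ge> 0" using M_nonneg by (simp add: KT_def)
  have c: "c > 0" using \<delta> \<open>a > 0\<close> Q by (simp add: c_def)
  \<comment> \<open>One factor for both cases in which \<open>V\<close> is large:
    \<open>\<kappa> powr Q\<close> up to height \<open>\<delta>\<close>, and \<open>KT / c\<close>
    between \<open>\<delta>\<close> and \<open>T\<close>, where the value at scale
    \<open>\<rho>\<close> is at most \<open>KT\<close> and the value at scale \<open>a\<close> at
    least \<open>c\<close>.\<close>
  define K where "K = \<kappa> powr Q + KT / c"
  have K: "K > 0" using KT c \<kappa> by (auto simp: K_def intro!: add_pos_nonneg)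
  \<comment> \<open>Chosen so that \<open>K / L * C\<^sub>1 \<le> 1 / 3\<close>; the added 1 keeps
    \<open>L\<close> positive when \<open>C\<^sub>1\<close> is 0.\<close>
  define L where "L = 3 * K * (C\<^sub>1 + 1)"
  have L: "L > 0" using K \<open>C\<^sub>1 \<ge> 0\<close> by (simp add: L_def)
  define tl where "tl = (1 + M) * \<rho> powr (- Q) * T powr (Q - r)"
  have tl: "tl \<ge> 0" using M_nonneg by (simp add: tl_def)
  let ?A = "\<lambda>n x. ennreal (D x (\<bar>w n x\<bar> / \<rho>)) * indicator {x. V x < L \<and> \<bar>w n x\<bar> \<le> T} x"
  let ?B = "\<lambda>n x. ennreal (V x * D x (\<bar>w n x\<bar> / a))"
  let ?C = "\<lambda>n x. ennreal (\<bar>w n x\<bar> powr r) * indicator {x. \<bar>w n x\<bar> > b} x"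
  have mid: "D x (\<bar>w n x\<bar> / \<rho>) \<le> KT" if "good x" "\<bar>w n x\<bar> \<le> T" for n x
  proof -
    have "D x (\<bar>w n x\<bar> / \<rho>) \<le> D x (T / \<rho>)"
      using that(2) \<rho> by (intro D_mono[OF that(1)] divide_right_mono) auto
    also have "\<dots> \<le> KT" unfolding KT_def using T \<rho> by (intro D_upper_large[OF that(1)]) auto
    finally show ?thesis .
  qed
  have ptw: "AE x in lebesgue. ennreal (D x (\<bar>w n x\<bar> / \<rho>)) \<le> ennreal (K / L) * ?B n x + ?A n x + ennreal tl * ?C n x" for n
    using phase_AE
  proof eventually_elim
    case (elim x)
    define W where "W = \<bar>w n x\<bar>"
    have W: "W \<ge> 0" by (simp add: W_def)
    have DB: "0 \<le> D x (W / a)" using W \<open>a > 0\<close> by (intro D_nonneg[OF elim]) auto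
    have deep: ?case if le: "D x (W / \<rho>) \<le> K * D x (W / a)" and VL: "V x \<ge> L"
    proof -
      note le
      also have "K * D x (W / a) \<le> K * ((V x / L) * D x (W / a))"
        using VL L K DB mult_right_mono[of 1 "V x / L" "D x (W / a)"] by (intro mult_left_mono) auto
      also have "\<dots> = (K / L) * (V x * D x (W / a))" by simp
      finally have "ennreal (D x (W / \<rho>)) \<le> ennreal (K / L) * ?B n x"
        using K L V_pos[of x] DB by (simp add: W_def ennreal_mult[symmetric] ennreal_leI)
      then show ?thesis unfolding W_def by (rule order_trans) (simp add: add_increasing2)
    qed
    \<comment> \<open>Four regions but three integrals: the last two are both absorbed by the
      weighted modular.\<close>
    consider (tail) "W > T" | (sub) "W \<le> T" "V x < L" | (small) "W \<le> \<delta>" "W \<le> T" "V x \<ge> L" | (large) "W > \<delta>" "W \<le> T" "V x \<ge> L" by linarith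
    then show ?case
    proof cases
      case tail
      have W1: "W > 0" "W / \<rho> \<ge> 1" using tail T \<rho> by auto
      have "D x (W / \<rho>) \<le> (1 + M) * (W / \<rho>) powr Q" using W1 by (intro D_upper_large[OF elim]) auto
      also have "(W / \<rho>) powr Q = \<rho> powr (- Q) * W powr Q" using \<rho> W1 by (simp add: powr_divide powr_minus_divide)
      also have "W powr Q = W powr (Q - r) * W powr r" using W1 by (simp flip: powr_add)
      also have "W powr (Q - r) \<le> T powr (Q - r)" using tail T \<open>Q < r\<close> by (intro powr_mono2') auto
      finally have "D x (W / \<rho>) \<le> (1 + M) * (\<rho> powr (- Q) * (T powr (Q - r) * W powr r))"
        using M_nonneg by (simp add: mult_left_mono mult_right_mono)
      also have "\<dots> = tl * W powr r" by (simp add: tl_def)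
      finally have "ennreal (D x (W / \<rho>)) \<le> ennreal tl * ?C n x"
        using tail T tl by (simp add: W_def ennreal_mult[symmetric] ennreal_leI)
      then show ?thesis unfolding W_def by (rule order_trans) (simp add: add_increasing)
    next
      case sub
      then have "ennreal (D x (W / \<rho>)) = ?A n x" by (simp add: W_def)
      then show ?thesis unfolding W_def by (simp add: add_increasing add_increasing2)
    next
      case small
      have "W / \<rho> \<le> \<kappa> * (W / a)"
        using \<kappa>(2) W \<open>a > 0\<close> mult_right_mono[OF \<kappa>(2), of "W / a"] by simp
      then have "D x (W / \<rho>) \<le> D x (\<kappa> * (W / a))" using W \<rho> by (intro D_mono[OF elim]) auto
      also have "\<dots> \<le> \<kappa> powr Q * D x (W / a)"
        using W \<open>a > 0\<close> \<kappa> small(1) by (intro D_scale_small[OF elim]) (auto simp: \<delta>_def field_simps)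
      also have "\<dots> \<le> K * D x (W / a)" using KT c by (intro mult_right_mono DB) (auto simp: K_def)
      finally show ?thesis using small(3) by (rule deep)
    next
      case large
      have "c \<le> D x (\<delta> / a)" using D_lower_small[OF elim, of "\<delta> / a"] \<delta> \<open>a > 0\<close> Q by (simp add: c_def divide_le_eq mult.commute)
      also have "\<dots> \<le> D x (W / a)" using large(1) \<delta> \<open>a > 0\<close> by (intro D_mono[OF elim] divide_right_mono) auto
      finally have cD: "c \<le> D x (W / a)" .
      have "D x (W / \<rho>) \<le> KT" using mid[OF elim, of n] large(2) by (simp add: W_def)
      also have "\<dots> = (KT / c) * c" using c by simp
      also have "\<dots> \<le> (KT / c) * D x (W / a)" using cD KT c by (intro mult_left_mono) auto
      also have "\<dots> \<le> K * D x (W / a)" by (intro mult_right_mono DB) (auto simp: K_def)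
      finally show ?thesis using large(3) by (rule deep)
    qed
  qed
  \<comment> \<open>What remains lives on the set where \<open>V\<close> is below \<open>L\<close>,
    of finite measure, and is bounded there by the constant \<open>KT\<close>.\<close>
  have Alim: "(\<lambda>n. \<integral>\<^sup>+x. ?A n x \<partial>lebesgue) \<longlonglongrightarrow> (\<integral>\<^sup>+x. 0 \<partial>(lebesgue :: 'a measure))"
  proof (rule nn_integral_dominated_convergence[where w = "\<lambda>x. ennreal KT * indicator {x. V x < L} x"])
    show "AE x in lebesgue. ?A n x \<le> ennreal KT * indicator {x. V x < L} x" for n
      using phase_AE by eventually_elim (use mid in \<open>auto simp: indicator_def intro!: ennreal_leI\<close>)
    have "{x. V x < L} \<in> sets lebesgue" using measurable_sets[OF V_measurable, of "{..<L}"] by (simp add: vimage_def)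
    then show "(\<integral>\<^sup>+x. ennreal KT * indicator {x. V x < L} x \<partial>lebesgue) < \<infinity>"
      using V_sublevel[OF L] by (subst nn_integral_cmult_indicator) (auto simp: ennreal_mult_less_top)
    show "AE x in lebesgue. (\<lambda>n. ?A n x) \<longlonglongrightarrow> 0"
      using phase_AE lim
    proof eventually_elim
      case (elim x)
      have "(\<lambda>n. \<bar>w n x\<bar> / \<rho>) \<longlonglongrightarrow> \<bar>0\<bar> / \<rho>" using \<rho> by (intro tendsto_intros elim) auto
      then have "(\<lambda>n. \<bar>w n x\<bar> / \<rho>) \<longlonglongrightarrow> 0" by simp
      then have "(\<lambda>n. D x (\<bar>w n x\<bar> / \<rho>)) \<longlonglongrightarrow> D x 0"
        by (rule continuous_on_tendsto_compose[OF D_cont[OF elim(1)]]) (use \<rho> in auto)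
      then have *: "(\<lambda>n. ennreal (D x (\<bar>w n x\<bar> / \<rho>))) \<longlonglongrightarrow> 0"
        using D_0[OF elim(1)] tendsto_ennrealI by fastforce
      show ?case
        by (rule tendsto_sandwich[OF _ _ tendsto_const *]) (auto simp: indicator_def)
    qed
  qed measurable
  then have "\<forall>\<^sub>F n in sequentially. (\<integral>\<^sup>+x. ?A n x \<partial>lebesgue) < ennreal (1 / 3)"
    by (intro order_tendstoD(2)[where y = 0]) auto
  then show ?thesis
  proof eventually_elim
    case (elim n)
    have "modular (\<lambda>x. \<bar>w n x\<bar> / \<rho>) \<le> (\<integral>\<^sup>+x. ennreal (K / L) * ?B n x + ?A n x + ennreal tl * ?C n x \<partial>lebesgue)"
      by (rule nn_integral_mono_AE) (rule ptw)
    also have "\<dots> = ennreal (K / L) * (\<integral>\<^sup>+x. ?B n x \<partial>lebesgue) + (\<integral>\<^sup>+x. ?A n x \<partial>lebesgue) + ennreal tl * (\<integral>\<^sup>+x. ?C n x \<partial>lebesgue)"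
      by (simp add: nn_integral_add nn_integral_cmult)
    also have "\<dots> \<le> ennreal (K / L) * ennreal C\<^sub>1 + ennreal (1 / 3) + ennreal tl * ennreal C\<^sub>2"
      using elim by (intro add_mono mult_left_mono V_bound r_bound) auto
    also have "\<dots> = ennreal (K / L * C\<^sub>1 + 1 / 3 + tl * C\<^sub>2)"
    proof -
      have "ennreal (K / L) * ennreal C\<^sub>1 = ennreal (K / L * C\<^sub>1)" "ennreal tl * ennreal C\<^sub>2 = ennreal (tl * C\<^sub>2)"
        using K L tl \<open>C\<^sub>1 \<ge> 0\<close> \<open>C\<^sub>2 \<ge> 0\<close> by (intro ennreal_mult[symmetric] divide_nonneg_nonneg; simp)+
      moreover have "0 \<le> K / L * C\<^sub>1" "0 \<le> tl * C\<^sub>2" using K L tl \<open>C\<^sub>1 \<ge> 0\<close> \<open>C\<^sub>2 \<ge> 0\<close> by auto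
      ultimately show ?thesis by (simp only: ennreal_plus add_nonneg_nonneg zero_le_divide_1_iff zero_le_numeral)
    qed
    also have "\<dots> \<le> ennreal 1"
    proof (rule ennreal_leI)
      have "K / L = 1 / (3 * (C\<^sub>1 + 1))" using K by (simp add: L_def)
      then have "K / L * C\<^sub>1 \<le> 1 / 3" using \<open>C\<^sub>1 \<ge> 0\<close> by (simp add: divide_le_eq)
      moreover have "tl * C\<^sub>2 \<le> 1 / 3" using T(1) by (simp add: tl_def ac_simps)
      ultimately show "K / L * C\<^sub>1 + 1 / 3 + tl * C\<^sub>2 \<le> 1" by linarith
    qed
    finally show ?case by simp
  qed
qed

text \<open>Above height 1, \<open>1 \<le> |u| \<le> |u| powr P \<le> Q * D x |u|\<close>, and the
  three bounds integrate different parts of this chain; values up to 1 cost only the measure of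
  \<open>K\<close>.\<close>

lemma weighted_tail_bounds:
  assumes [measurable]: "u \<in> borel_measurable lebesgue"
    and u: "modular (\<lambda>x. \<bar>u x\<bar>) \<le> ennreal c"
  shows "tail_power lebesgue P 1 (\<lambda>x. \<bar>u x\<bar>) \<le> ennreal (Q * c)"
    and "emeasure lebesgue {x. \<bar>u x\<bar> > 1} \<le> ennreal (Q * c)"
    and "K \<in> sets lebesgue \<Longrightarrow> (\<integral>\<^sup>+x\<in>K. ennreal \<bar>u x\<bar> \<partial>lebesgue) \<le> emeasure lebesgue K + ennreal (Q * c)"
proof -
  have Q: "Q \<ge> 2" using P_ge P_le_Q by simp
  have *: "(\<integral>\<^sup>+x. ennreal Q * ennreal (D x \<bar>u x\<bar>) \<partial>lebesgue) \<le> ennreal (Q * c)"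
    using u Q by (subst nn_integral_cmult) (auto simp: ennreal_mult' mult_left_mono)
  have large: "ennreal (\<bar>u x\<bar> powr P) \<le> ennreal Q * ennreal (D x \<bar>u x\<bar>)" if "good x" "\<bar>u x\<bar> > 1" for x
    using D_lower_large[OF that(1), of "\<bar>u x\<bar>"] that(2) Q D_nonneg[OF that(1), of "\<bar>u x\<bar>"]
    by (simp add: ennreal_mult[symmetric] ennreal_leI)
  have ge: "ennreal \<bar>u x\<bar> \<le> ennreal (\<bar>u x\<bar> powr P)" if "\<bar>u x\<bar> > 1" for x
    using powr_mono[of 1 P "\<bar>u x\<bar>"] that P_ge by (intro ennreal_leI) simp
  show "tail_power lebesgue P 1 (\<lambda>x. \<bar>u x\<bar>) \<le> ennreal (Q * c)"
  proof (rule order_trans[OF nn_integral_mono_AE *])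
    show "AE x in lebesgue. ennreal (\<bar>u x\<bar> powr P) * indicator {x. \<bar>u x\<bar> > 1} x \<le> ennreal Q * ennreal (D x \<bar>u x\<bar>)"
      using phase_AE by eventually_elim (use large in \<open>auto simp: indicator_def\<close>)
  qed
  have "{x \<in> space lebesgue. \<bar>u x\<bar> > 1} \<in> sets lebesgue" by measurable
  then have "emeasure lebesgue {x. \<bar>u x\<bar> > 1} = (\<integral>\<^sup>+x. indicator {x. \<bar>u x\<bar> > 1} x \<partial>lebesgue)" by simp
  also have "\<dots> \<le> (\<integral>\<^sup>+x. ennreal Q * ennreal (D x \<bar>u x\<bar>) \<partial>lebesgue)"
  proof (rule nn_integral_mono_good, goal_cases)
    case elim: (1 x)
    have "1 \<le> ennreal \<bar>u x\<bar>" if "\<bar>u x\<bar> > 1" using ennreal_leI[of 1 "\<bar>u x\<bar>"] that by simp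
    then show ?case using order_trans[OF _ order_trans[OF ge large[OF elim]]] by (auto simp: indicator_def)
  qed
  also note *
  finally show "emeasure lebesgue {x. \<bar>u x\<bar> > 1} \<le> ennreal (Q * c)" .
  assume K [measurable]: "K \<in> sets lebesgue"
  have "(\<integral>\<^sup>+x\<in>K. ennreal \<bar>u x\<bar> \<partial>lebesgue) \<le> (\<integral>\<^sup>+x. indicator K x + ennreal Q * ennreal (D x \<bar>u x\<bar>) \<partial>lebesgue)"
  proof (rule nn_integral_mono_good, goal_cases)
    case elim: (1 x)
    show ?case
    proof (cases "\<bar>u x\<bar> > 1")
      case True
      then show ?thesis using order_trans[OF ge large[OF elim]] by (simp add: indicator_def add_increasing)
    next
      case False
      then have "ennreal \<bar>u x\<bar> \<le> 1" using ennreal_leI[of "\<bar>u x\<bar>" 1] by simp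
      then show ?thesis by (auto simp: indicator_def add_increasing2)
    qed
  qed
  also have "\<dots> = emeasure lebesgue K + (\<integral>\<^sup>+x. ennreal Q * ennreal (D x \<bar>u x\<bar>) \<partial>lebesgue)"
    by (subst nn_integral_add) auto
  also have "\<dots> \<le> emeasure lebesgue K + ennreal (Q * c)" by (intro add_left_mono *)
  finally show "(\<integral>\<^sup>+x\<in>K. ennreal \<bar>u x\<bar> \<partial>lebesgue) \<le> emeasure lebesgue K + ennreal (Q * c)" .
qed

lemma modular_le_V_modular:
  assumes [measurable]: "u \<in> borel_measurable lebesgue"
    and "V_modular (\<lambda>x. \<bar>u x\<bar>) \<le> 1"
  shows "modular (\<lambda>x. \<bar>u x\<bar>) \<le> ennreal (1 / V\<^sub>0)"
proof -
  have "modular (\<lambda>x. \<bar>u x\<bar>) \<le> (\<integral>\<^sup>+x. ennreal (1 / V\<^sub>0) * ennreal (V x * D x \<bar>u x\<bar>) \<partial>lebesgue)"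
  proof (rule nn_integral_mono_good, goal_cases)
    case elim: (1 x)
    have D: "0 \<le> D x \<bar>u x\<bar>" by (rule D_nonneg[OF elim]) simp
    have "1 * D x \<bar>u x\<bar> \<le> (V x / V\<^sub>0) * D x \<bar>u x\<bar>"
      using V_lower[of x] V\<^sub>0_pos by (intro mult_right_mono D) auto
    then show ?case using V\<^sub>0_pos V_pos[of x] D by (simp add: ennreal_mult[symmetric] ennreal_leI)
  qed
  also have "\<dots> = ennreal (1 / V\<^sub>0) * V_modular (\<lambda>x. \<bar>u x\<bar>)"
    by (rule nn_integral_cmult) measurable
  also have "\<dots> \<le> ennreal (1 / V\<^sub>0) * 1" by (intro mult_left_mono assms) auto
  finally show ?thesis by simp
qed

text \<open>Unit bounds on the modulars stand for bounded norms after rescaling. Fatou's lemma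
  passes the weighted modular and the tail bound to the limit \<open>v\<close>, so that the
  differences \<open>u (r n) - v\<close> satisfy the assumptions of
  \<open>eventually_modular_le_one\<close>.\<close>

lemma bounded_sequence_converges:
  fixes u :: "nat \<Rightarrow> 'a \<Rightarrow> real" and g :: "nat \<Rightarrow> 'a \<Rightarrow> 'a"
  assumes u_borel [measurable]: "\<And>n. u n \<in> borel_measurable borel"
    and g_borel [measurable]: "\<And>n. g n \<in> borel_measurable borel"
    and wg: "\<And>n. has_weak_gradient (u n) (g n)"
    and u: "\<And>n. V_modular (\<lambda>x. \<bar>u n x\<bar>) \<le> 1"
    and g: "\<And>n. modular (\<lambda>x. norm (g n x)) \<le> 1"
  obtains r v where "strict_mono r" "v \<in> borel_measurable borel"
    "V_modular (\<lambda>x. \<bar>v x\<bar>) \<le> 1"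
    "\<And>\<rho>. \<rho> > 0 \<Longrightarrow> \<forall>\<^sub>F n in sequentially. modular (\<lambda>x. \<bar>u (r n) x - v x\<bar> / \<rho>) \<le> 1"
proof -
  have Q: "Q \<ge> 2" using P_ge P_le_Q by simp
  have u_leb [measurable]: "u n \<in> borel_measurable lebesgue" for n by (rule measurable_completion) simp
  have g_leb [measurable]: "(\<lambda>x. norm (g n x)) \<in> borel_measurable lebesgue" for n by (rule measurable_completion) simp
  define c where "c = max 1 (1 / V\<^sub>0)"
  have c: "c \<ge> 1" by (simp add: c_def)
  have uc: "modular (\<lambda>x. \<bar>u n x\<bar>) \<le> ennreal c" for n
    using order_trans[OF modular_le_V_modular[OF u_leb u] ennreal_leI[of "1 / V\<^sub>0" c]] by (simp add: c_def)
  have gc: "modular (\<lambda>x. \<bar>norm (g n x)\<bar>) \<le> ennreal c" for n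
    using order_trans[OF g[of n], of "ennreal c"] ennreal_leI[of 1 c] c by simp
  note ub = weighted_tail_bounds[OF u_leb uc]
  note gb = weighted_tail_bounds[OF g_leb gc]
  have loc: "\<exists>C. \<forall>n. L1_on (cball 0 R) (\<lambda>x. \<bar>f n x\<bar>) \<le> ennreal C"
    if "\<And>n. (\<integral>\<^sup>+x\<in>cball 0 R. ennreal \<bar>f n x\<bar> \<partial>lebesgue) \<le> emeasure lebesgue (cball 0 R :: 'a set) + ennreal (Q * c)"
    for f :: "nat \<Rightarrow> 'a \<Rightarrow> real" and R
  proof -
    have "emeasure lborel (cball 0 R :: 'a set) + ennreal (Q * c) < \<infinity>"
      using emeasure_lborel_cball_finite[of "0::'a" R] by simp
    then obtain C where C: "emeasure lborel (cball 0 R :: 'a set) + ennreal (Q * c) = ennreal C"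
      by (cases "emeasure lborel (cball 0 R :: 'a set) + ennreal (Q * c)") auto
    have "L1_on (cball 0 R) (\<lambda>x. \<bar>f n x\<bar>) \<le> emeasure lborel (cball 0 R :: 'a set) + ennreal (Q * c)" for n
      using that[of n] by (simp add: nn_integral_completion)
    then show ?thesis unfolding C by blast
  qed
  obtain r v where r: "strict_mono r" and v [measurable]: "v \<in> borel_measurable borel"
    and lim: "AE x in lborel. (\<lambda>n. u (r n) x) \<longlonglongrightarrow> v x"
  proof (rule weak_gradient_compactness[OF u_borel g_borel wg])
    show "\<exists>C. \<forall>n. L1_on (cball 0 R) (\<lambda>x. \<bar>u n x\<bar>) \<le> ennreal C" for R
      by (intro loc ub(3)) simp
    show "\<exists>C. \<forall>n. L1_on (cball 0 R) (\<lambda>x. norm (g n x)) \<le> ennreal C" for R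
      using loc[of "\<lambda>n x. norm (g n x)" R, OF gb(3)] by simp
  qed
  have v_leb [measurable]: "v \<in> borel_measurable lebesgue" by (rule measurable_completion) simp
  have lim': "AE x in lebesgue. (\<lambda>n. u (r n) x) \<longlonglongrightarrow> v x" using lim by (rule AE_completion)
  \<comment> \<open>Midpoint of the interval opened by \<open>ratio\<close>: above \<open>Q\<close>
    for the tail estimate, below the exponents that \<open>higher_integrability\<close> can
    reach.\<close>
  define s where "s = (Q + P * (1 + 1 / real DIM('a))) / 2"
  have s: "Q < s" "s < P * (1 + 1 / real DIM('a))" using ratio by (auto simp: s_def)
  have Qc: "Q * c > 0" using Q c by simp
  have Ps: "P < s" "P \<ge> 1" using s P_le_Q P_ge by auto
  obtain C' where C': "C' \<ge> 0" and hi: "\<And>n. tail_power lborel s 2 (\<lambda>x. \<bar>u n x\<bar>) \<le> ennreal C'"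
  proof (rule higher_integrability[where u = u and g = g, OF Ps(2) Qc Ps(1) s(2) u_borel g_borel wg])
    fix n
    have [measurable]: "{x. \<bar>u n x\<bar> > 1} \<in> sets borel" by measurable
    show "emeasure lborel {x. \<bar>u n x\<bar> > 1} \<le> ennreal (Q * c)"
      using ub(2)[of n] by simp
    show "tail_power lborel P 1 (\<lambda>x. \<bar>u n x\<bar>) \<le> ennreal (Q * c)"
      using ub(1)[of n] by (simp add: nn_integral_completion)
    show "tail_power lborel P 1 (\<lambda>x. norm (g n x)) \<le> ennreal (Q * c)"
      using gb(1)[of n] by (simp add: nn_integral_completion)
  qed (erule that, blast)
  have Vu_meas: "(\<lambda>x. ennreal (V x * D x \<bar>u n x\<bar>)) \<in> borel_measurable lebesgue" for n by measurable
  have "V_modular (\<lambda>x. \<bar>v x\<bar>) \<le> (\<integral>\<^sup>+x. liminf (\<lambda>n. ennreal (V x * D x \<bar>u (r n) x\<bar>)) \<partial>lebesgue)"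
  proof (rule nn_integral_mono_AE)
    show "AE x in lebesgue. ennreal (V x * D x \<bar>v x\<bar>) \<le> liminf (\<lambda>n. ennreal (V x * D x \<bar>u (r n) x\<bar>))"
      using phase_AE lim'
    proof eventually_elim
      case (elim x)
      have "(\<lambda>n. D x \<bar>u (r n) x\<bar>) \<longlonglongrightarrow> D x \<bar>v x\<bar>"
        by (rule continuous_on_tendsto_compose[OF D_cont[OF elim(1)] tendsto_rabs[OF elim(2)]]) auto
      then have "(\<lambda>n. ennreal (V x * D x \<bar>u (r n) x\<bar>)) \<longlonglongrightarrow> ennreal (V x * D x \<bar>v x\<bar>)"
        by (intro tendsto_ennrealI tendsto_intros)
      then show ?case by (simp add: lim_imp_Liminf)
    qed
  qed
  also have "\<dots> \<le> liminf (\<lambda>n. \<integral>\<^sup>+x. ennreal (V x * D x \<bar>u (r n) x\<bar>) \<partial>lebesgue)"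
    by (rule nn_integral_liminf) (rule Vu_meas)
  also have "\<dots> \<le> 1" by (rule Liminf_le) (auto simp: u)
  finally have vV: "V_modular (\<lambda>x. \<bar>v x\<bar>) \<le> 1" .
  have "tail_power lborel s 2 (\<lambda>x. \<bar>v x\<bar>)
    \<le> (\<integral>\<^sup>+x. liminf (\<lambda>n. ennreal (\<bar>u (r n) x\<bar> powr s) * indicator {x. \<bar>u (r n) x\<bar> > 2} x) \<partial>lborel)"
  proof (rule nn_integral_mono_AE)
    show "AE x in lborel. ennreal (\<bar>v x\<bar> powr s) * indicator {x. \<bar>v x\<bar> > 2} x
      \<le> liminf (\<lambda>n. ennreal (\<bar>u (r n) x\<bar> powr s) * indicator {x. \<bar>u (r n) x\<bar> > 2} x)"
      using lim
    proof eventually_elim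
      case (elim x)
      show ?case
      \<comment> \<open>Where the limit exceeds 2, so do all late terms, and their indicators are 1;
        elsewhere the left side is 0.\<close>
      proof (cases "\<bar>v x\<bar> > 2")
        case True
        have ra: "(\<lambda>n. \<bar>u (r n) x\<bar>) \<longlonglongrightarrow> \<bar>v x\<bar>" using elim by (rule tendsto_rabs)
        then have "(\<lambda>n. ennreal (\<bar>u (r n) x\<bar> powr s)) \<longlonglongrightarrow> ennreal (\<bar>v x\<bar> powr s)"
          using True by (intro tendsto_ennrealI tendsto_powr tendsto_const) auto
        moreover have "\<forall>\<^sub>F n in sequentially. ennreal (\<bar>u (r n) x\<bar> powr s) = ennreal (\<bar>u (r n) x\<bar> powr s) * indicator {x. \<bar>u (r n) x\<bar> > 2} x"
          using order_tendstoD(1)[OF ra True] by eventually_elim simp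
        ultimately have "(\<lambda>n. ennreal (\<bar>u (r n) x\<bar> powr s) * indicator {x. \<bar>u (r n) x\<bar> > 2} x) \<longlonglongrightarrow> ennreal (\<bar>v x\<bar> powr s)"
          by (rule Lim_transform_eventually)
        then show ?thesis using True by (simp add: lim_imp_Liminf)
      qed simp
    qed
  qed
  also have "\<dots> \<le> liminf (\<lambda>n. \<integral>\<^sup>+x. ennreal (\<bar>u (r n) x\<bar> powr s) * indicator {x. \<bar>u (r n) x\<bar> > 2} x \<partial>lborel)"
    by (rule nn_integral_liminf) measurable
  also have "\<dots> \<le> ennreal C'" by (rule Liminf_le) (auto simp: hi)
  finally have vs: "tail_power lborel s 2 (\<lambda>x. \<bar>v x\<bar>) \<le> ennreal C'" .
  show ?thesis
  proof (rule that[OF r v vV])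
    fix \<rho> :: real assume \<rho>: "\<rho> > 0"
    show "\<forall>\<^sub>F n in sequentially. modular (\<lambda>x. \<bar>u (r n) x - v x\<bar> / \<rho>) \<le> 1"
    \<comment> \<open>\<open>a = 2\<close> because half the difference is at most the larger of the
      two absolute values; \<open>b = 4\<close> because a difference above 4 forces that larger
      value above 2. \<open>C\<^sub>1\<close> adds two modulars, and in \<open>C\<^sub>2\<close> the
      factor \<open>2 powr s\<close> comes from the difference being at most twice the larger
      value.\<close>
    proof (rule eventually_modular_le_one[where a = 2 and b = 4 and r = s and C\<^sub>1 = 2 and C\<^sub>2 = "2 powr s * (2 * C')"])
      show "(\<lambda>x. u (r n) x - v x) \<in> borel_measurable lebesgue" for n by measurable
      show "AE x in lebesgue. (\<lambda>n. u (r n) x - v x) \<longlonglongrightarrow> 0"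
        using lim' by eventually_elim (simp add: LIM_zero)
      show "V_modular (\<lambda>x. \<bar>u (r n) x - v x\<bar> / 2) \<le> ennreal 2" for n
      proof -
        have "V_modular (\<lambda>x. \<bar>u (r n) x - v x\<bar> / 2)
          \<le> (\<integral>\<^sup>+x. ennreal (V x * D x \<bar>u (r n) x\<bar>) + ennreal (V x * D x \<bar>v x\<bar>) \<partial>lebesgue)"
        proof (rule nn_integral_mono_good, goal_cases)
          case elim: (1 x)
          have "D x (\<bar>u (r n) x - v x\<bar> / 2) \<le> D x (max \<bar>u (r n) x\<bar> \<bar>v x\<bar>)"
            by (intro D_mono[OF elim]) auto
          also have "\<dots> \<le> D x \<bar>u (r n) x\<bar> + D x \<bar>v x\<bar>"
            using D_nonneg[OF elim, of "\<bar>u (r n) x\<bar>"] D_nonneg[OF elim, of "\<bar>v x\<bar>"] by (simp add: max_def)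
          finally have "V x * D x (\<bar>u (r n) x - v x\<bar> / 2) \<le> V x * (D x \<bar>u (r n) x\<bar> + D x \<bar>v x\<bar>)"
            using V_pos[of x] by (intro mult_left_mono) auto
          then show ?case
            using V_pos[of x] D_nonneg[OF elim, of "\<bar>u (r n) x\<bar>"] D_nonneg[OF elim, of "\<bar>v x\<bar>"]
            by (simp add: ennreal_leI distrib_left flip: ennreal_plus)
        qed
        also have "\<dots> = V_modular (\<lambda>x. \<bar>u (r n) x\<bar>) + V_modular (\<lambda>x. \<bar>v x\<bar>)"
          by (rule nn_integral_add) measurable
        also have "\<dots> \<le> 1 + 1" by (intro add_mono u vV)
        finally show ?thesis by simp
      qed
      show "tail_power lebesgue s 4 (\<lambda>x. \<bar>u (r n) x - v x\<bar>) \<le> ennreal (2 powr s * (2 * C'))" for n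
      proof -
        let ?I = "\<lambda>f x. ennreal (\<bar>f x\<bar> powr s) * indicator {x. \<bar>f x :: real\<bar> > 2} x"
        have "tail_power lborel s 4 (\<lambda>x. \<bar>u (r n) x - v x\<bar>)
          \<le> (\<integral>\<^sup>+x. ennreal (2 powr s) * (?I (u (r n)) x + ?I v x) \<partial>lborel)"
        proof (rule nn_integral_mono, goal_cases)
          case (1 x)
          have *: "ennreal (\<bar>a - b\<bar> powr s) \<le> ennreal (2 powr s) * ennreal (\<bar>a\<bar> powr s)" if "\<bar>b\<bar> \<le> \<bar>a\<bar>" for a b :: real
          proof -
            have "\<bar>a - b\<bar> powr s \<le> (2 * \<bar>a\<bar>) powr s" using that s Q by (intro powr_mono2) auto
            then show ?thesis by (simp add: powr_mult ennreal_mult[symmetric] ennreal_leI)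
          qed
          show ?case
          proof (cases "\<bar>u (r n) x - v x\<bar> > 4")
            case True
            consider "\<bar>v x\<bar> \<le> \<bar>u (r n) x\<bar>" "\<bar>u (r n) x\<bar> > 2" | "\<bar>u (r n) x\<bar> \<le> \<bar>v x\<bar>" "\<bar>v x\<bar> > 2"
              using True by linarith
            then show ?thesis
            proof cases
              case 1
              then have "ennreal (\<bar>u (r n) x - v x\<bar> powr s) \<le> ennreal (2 powr s) * ?I (u (r n)) x"
                using *[OF 1(1)] by simp
              also have "\<dots> \<le> ennreal (2 powr s) * (?I (u (r n)) x + ?I v x)" by (intro mult_left_mono) auto
              finally show ?thesis using True by simp
            next
              case 2
              then have "ennreal (\<bar>u (r n) x - v x\<bar> powr s) \<le> ennreal (2 powr s) * ?I v x"
                using *[OF 2(1)] by (simp add: abs_minus_commute)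
              also have "\<dots> \<le> ennreal (2 powr s) * (?I (u (r n)) x + ?I v x)" by (intro mult_left_mono) auto
              finally show ?thesis using True by simp
            qed
          qed simp
        qed
        also have "\<dots> = ennreal (2 powr s) * ((\<integral>\<^sup>+x. ?I (u (r n)) x \<partial>lborel) + (\<integral>\<^sup>+x. ?I v x \<partial>lborel))"
          by (simp add: nn_integral_cmult nn_integral_add)
        also have "\<dots> \<le> ennreal (2 powr s) * (ennreal C' + ennreal C')"
          by (intro mult_left_mono add_mono hi vs) auto
        also have "\<dots> = ennreal (2 powr s * (2 * C'))" using C' by (simp add: ennreal_mult flip: ennreal_plus)
        finally show ?thesis by (simp add: nn_integral_completion)
      qed
    qed (use s C' \<rho> in auto)
  qed
qed

end

section \<open>Borel representatives and rescaling of weak gradients\<close>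

lemma locally_integrable_imp_measurable:
  fixes f :: "'a::euclidean_space \<Rightarrow> 'b::{banach, second_countable_topology}"
  assumes "locally_integrable f"
  shows "f \<in> borel_measurable lebesgue"
proof (rule borel_measurable_LIMSEQ_metric)
  show "(\<lambda>x. indicator (cball 0 (real n)) x *\<^sub>R f x) \<in> borel_measurable lebesgue" for n
  proof -
    have "set_integrable lebesgue (cball 0 (real n)) f"
      using assms by (simp add: locally_integrable_def)
    then show ?thesis unfolding set_integrable_def by (rule borel_measurable_integrable)
  qed
  fix x :: 'a
  obtain N :: nat where N: "norm x \<le> real N" using real_arch_simple by blast
  have "\<forall>\<^sub>F n in sequentially. f x = indicator (cball 0 (real n)) x *\<^sub>R f x"
    using eventually_ge_at_top[of N]
  proof eventually_elim
    case (elim n)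
    then have "norm x \<le> real n" using N by simp
    then show ?case by simp
  qed
  then show "(\<lambda>n. indicator (cball 0 (real n)) x *\<^sub>R f x) \<longlonglongrightarrow> f x"
    by (rule Lim_transform_eventually[OF tendsto_const])
qed

text \<open>Coordinate by coordinate, a function measurable for the completion agrees almost
  everywhere with a Borel one. The translation and Tonelli arguments are stated for Borel functions,
  so representatives have to be chosen.\<close>

lemma borel_representative:
  fixes g :: "'a::euclidean_space \<Rightarrow> 'b::euclidean_space"
  assumes [measurable]: "g \<in> borel_measurable lebesgue"
  obtains g' where "g' \<in> borel_measurable borel" "AE x in lebesgue. g' x = g x"
proof -
  have "\<exists>f\<in>borel_measurable lborel. AE x in lborel. g x \<bullet> b = f x" for b
    by (rule completion_ex_borel_measurable_real) measurable
  then obtain f where f: "\<And>b. f b \<in> borel_measurable lborel" "\<And>b. AE x in lborel. g x \<bullet> b = f b x"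
    by metis
  show ?thesis
  proof (rule that[of "\<lambda>x. \<Sum>b\<in>Basis. f b x *\<^sub>R b"])
    have [measurable]: "f b \<in> borel_measurable borel" for b using f(1)[of b] by simp
    show "(\<lambda>x. \<Sum>b\<in>Basis. f b x *\<^sub>R b) \<in> borel_measurable borel" by measurable
    have "AE x in lborel. \<forall>b\<in>Basis. g x \<bullet> b = f b x"
      by (rule AE_finite_allI) (use f(2) in auto)
    then have "AE x in lebesgue. \<forall>b\<in>Basis. g x \<bullet> b = f b x" by (rule AE_completion)
    then show "AE x in lebesgue. (\<Sum>b\<in>Basis. f b x *\<^sub>R b) = g x"
    proof eventually_elim
      case (elim x)
      then have "(\<Sum>b\<in>Basis. f b x *\<^sub>R b) = (\<Sum>b\<in>Basis. (g x \<bullet> b) *\<^sub>R b)" by (intro sum.cong) auto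
      then show ?case by (simp add: euclidean_representation)
    qed
  qed
qed

lemma scaled_borel_representative:
  fixes g :: "'a::euclidean_space \<Rightarrow> 'b::euclidean_space"
  assumes [measurable]: "g \<in> borel_measurable lebesgue"
  shows "\<exists>g'. g' \<in> borel_measurable borel \<and> (AE x in lebesgue. g' x = c *\<^sub>R g x)"
proof -
  have "(\<lambda>x. c *\<^sub>R g x) \<in> borel_measurable lebesgue" by measurable
  then show ?thesis by (rule borel_representative) blast
qed

lemma locally_integrable_scale_AE:
  fixes f f' :: "'a::euclidean_space \<Rightarrow> 'b::{banach, second_countable_topology}"
  assumes li: "locally_integrable f"
    and f': "f' \<in> borel_measurable lebesgue" "AE x in lebesgue. f' x = c *\<^sub>R f x"
  shows "locally_integrable f'"
  unfolding locally_integrable_def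
proof (intro allI impI)
  fix K :: "'a set" assume K: "compact K"
  have [measurable]: "K \<in> sets lebesgue"
    using K by (intro sets_completionI_sets) (simp add: compact_imp_closed borel_closed)
  note [measurable] = f'(1) locally_integrable_imp_measurable[OF li]
  have "integrable lebesgue (\<lambda>x. indicator K x *\<^sub>R f x)"
    using li K by (simp add: locally_integrable_def set_integrable_def)
  then have "integrable lebesgue (\<lambda>x. c *\<^sub>R (indicator K x *\<^sub>R f x))" by (rule integrable_scaleR_right)
  then show "set_integrable lebesgue K f'" unfolding set_integrable_def
    by (rule integrable_cong_AE_imp) (use f'(2) in auto)
qed

text \<open>Combines the change to Borel representatives with the division that normalises a bounded
  sequence; both sides of the weak identity are linear and blind to null sets.\<close>

lemma has_weak_gradient_scale_AE:
  fixes u :: "'a::euclidean_space \<Rightarrow> real" and g :: "'a \<Rightarrow> 'a"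
  assumes wg: "has_weak_gradient u g"
    and u': "u' \<in> borel_measurable borel" "AE x in lebesgue. u' x = c * u x"
    and g': "g' \<in> borel_measurable borel" "AE x in lebesgue. g' x = c *\<^sub>R g x"
  shows "has_weak_gradient u' g'"
proof -
  have li: "locally_integrable u" "locally_integrable g" using wg by (auto simp: has_weak_gradient_def)
  have [measurable]: "u \<in> borel_measurable lebesgue" "g \<in> borel_measurable lebesgue"
    using li by (auto intro: locally_integrable_imp_measurable)
  have [measurable]: "u' \<in> borel_measurable lebesgue" "g' \<in> borel_measurable lebesgue"
    using u' g' by (auto intro: measurable_completion)
  show ?thesis unfolding has_weak_gradient_def
  proof (intro conjI allI impI ballI)
    show "locally_integrable u'" "locally_integrable g'"
      using u'(2) g'(2) by (auto intro!: locally_integrable_scale_AE[OF li(1), of u' c] locally_integrable_scale_AE[OF li(2), of g' c])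
    fix \<phi> :: "'a \<Rightarrow> real" and b :: 'a assume \<phi>: "test_function \<phi>" and b: "b \<in> Basis"
    have "\<phi> \<in> borel_measurable lborel" "(\<lambda>x. frechet_derivative \<phi> (at x) b) \<in> borel_measurable lborel"
      using test_functionD[OF \<phi>] by (auto intro: borel_measurable_continuous_onI)
    then have [measurable]: "\<phi> \<in> borel_measurable lebesgue" "(\<lambda>x. frechet_derivative \<phi> (at x) b) \<in> borel_measurable lebesgue"
      by (auto intro: measurable_completion)
    have "(LINT x|lebesgue. u' x * frechet_derivative \<phi> (at x) b) = (LINT x|lebesgue. c * (u x * frechet_derivative \<phi> (at x) b))"
      by (rule integral_cong_AE) (use u'(2) in auto)
    also have "\<dots> = c * (LINT x|lebesgue. u x * frechet_derivative \<phi> (at x) b)" by simp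
    also have "(LINT x|lebesgue. u x * frechet_derivative \<phi> (at x) b) = - (LINT x|lebesgue. (g x \<bullet> b) * \<phi> x)"
      using wg \<phi> b by (simp add: has_weak_gradient_def)
    also have "c * - (LINT x|lebesgue. (g x \<bullet> b) * \<phi> x) = - (LINT x|lebesgue. c * ((g x \<bullet> b) * \<phi> x))" by simp
    also have "(LINT x|lebesgue. c * ((g x \<bullet> b) * \<phi> x)) = (LINT x|lebesgue. (g' x \<bullet> b) * \<phi> x)"
      by (rule integral_cong_AE) (use g'(2) in auto)
    finally show "(LINT x|lebesgue. u' x * frechet_derivative \<phi> (at x) b) = - (LINT x|lebesgue. (g' x \<bullet> b) * \<phi> x)" .
  qed
qed

section \<open>From normalised sequences to arbitrary bounded ones\<close>

context double_phase_setting
begin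

lemma sequence_compactness:
  fixes u :: "nat \<Rightarrow> 'a \<Rightarrow> real"
  assumes u: "\<And>n. u n \<in> W1V_space V D" and B: "\<And>n. W1V_norm V D (u n) \<le> B"
  shows "\<exists>r v. strict_mono r \<and> v \<in> L_space D \<and> (\<lambda>n. L_norm D (\<lambda>x. u (r n) x - v x)) \<longlonglongrightarrow> 0"
proof -
  \<comment> \<open>Positive even for negative \<open>B\<close>, and strictly above all norms, as
    \<open>modular_le_one_if_luxemburg_less\<close> requires.\<close>
  define b where "b = max B 0 + 1"
  have b: "b > 0" by (simp add: b_def)
  define g where "g n = weak_gradient (u n)" for n
  have wg: "has_weak_gradient (u n) (g n)" for n
    using u[of n] someI_ex[of "has_weak_gradient (u n)"] by (auto simp: W1V_space_def W1_space_def g_def weak_gradient_def)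
  have gL: "(\<lambda>x. norm (g n x)) \<in> L_space D" for n
    using u[of n] by (auto simp: W1V_space_def W1_space_def g_def)
  have u_meas [measurable]: "u n \<in> borel_measurable lebesgue" for n
    using u[of n] by (auto simp: W1V_space_def W1_space_def L_space_def)
  have g_meas [measurable]: "g n \<in> borel_measurable lebesgue" for n
    using wg[of n] by (auto simp: has_weak_gradient_def intro: locally_integrable_imp_measurable)
  have norms: "LV_norm V D (u n) < b" "L_norm D (\<lambda>x. norm (g n x)) < b" for n
  proof -
    have "0 \<le> LV_norm V D (u n)"
      unfolding LV_norm_def by (rule luxemburg_Inf_nonneg[OF LV_luxemburg_nonempty[OF u]])
    moreover have "0 \<le> L_norm D (\<lambda>x. norm (g n x))"
      unfolding L_norm_def by (rule luxemburg_Inf_nonneg[OF L_luxemburg_nonempty[OF gL]])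
    moreover have "L_norm D (\<lambda>x. norm (g n x)) + LV_norm V D (u n) \<le> B" using B[of n] by (simp add: W1V_norm_def g_def)
    ultimately show "LV_norm V D (u n) < b" "L_norm D (\<lambda>x. norm (g n x)) < b" by (simp_all add: b_def)
  qed
  have uV: "V_modular (\<lambda>x. \<bar>u n x\<bar> / b) \<le> 1" for n
    using V_pos norms(1)[of n] unfolding LV_norm_def
    by (intro modular_le_one_if_luxemburg_less LV_luxemburg_nonempty u) (auto intro: less_imp_le)
  have gD: "(\<integral>\<^sup>+x. ennreal (1 * D x (\<bar>norm (g n x)\<bar> / b)) \<partial>lebesgue) \<le> 1" for n
    using norms(2)[of n] L_luxemburg_nonempty[OF gL[of n]] unfolding L_norm_def
    by (intro modular_le_one_if_luxemburg_less) auto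
  obtain u' where u': "\<And>n. u' n \<in> borel_measurable borel" "\<And>n. AE x in lebesgue. u' n x = (1 / b) * u n x"
    using scaled_borel_representative[OF u_meas] unfolding real_scaleR_def by metis
  obtain g' where g': "\<And>n. g' n \<in> borel_measurable borel" "\<And>n. AE x in lebesgue. g' n x = (1 / b) *\<^sub>R g n x"
    using scaled_borel_representative[OF g_meas] by metis
  have wg': "has_weak_gradient (u' n) (g' n)" for n
    by (rule has_weak_gradient_scale_AE[OF wg u' g'])
  have u'V: "V_modular (\<lambda>x. \<bar>u' n x\<bar>) \<le> 1" for n
  proof -
    have "V_modular (\<lambda>x. \<bar>u' n x\<bar>) = V_modular (\<lambda>x. \<bar>u n x\<bar> / b)"
    proof (rule nn_integral_cong_AE)
      show "AE x in lebesgue. ennreal (V x * D x \<bar>u' n x\<bar>) = ennreal (V x * D x (\<bar>u n x\<bar> / b))"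
        using u'(2)[of n] by eventually_elim (use b in \<open>simp add: abs_mult\<close>)
    qed
    then show ?thesis using uV[of n] by simp
  qed
  have g'D: "modular (\<lambda>x. norm (g' n x)) \<le> 1" for n
  proof -
    have "modular (\<lambda>x. norm (g' n x)) = (\<integral>\<^sup>+x. ennreal (1 * D x (\<bar>norm (g n x)\<bar> / b)) \<partial>lebesgue)"
    proof (rule nn_integral_cong_AE)
      show "AE x in lebesgue. ennreal (D x (norm (g' n x))) = ennreal (1 * D x (\<bar>norm (g n x)\<bar> / b))"
        using g'(2)[of n] by eventually_elim (use b in simp)
    qed
    then show ?thesis using gD[of n] by simp
  qed
  obtain r v where r: "strict_mono r" and v: "v \<in> borel_measurable borel"
    and vV: "V_modular (\<lambda>x. \<bar>v x\<bar>) \<le> 1"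
    and lim: "\<And>\<rho>. \<rho> > 0 \<Longrightarrow> \<forall>\<^sub>F n in sequentially. modular (\<lambda>x. \<bar>u' (r n) x - v x\<bar> / \<rho>) \<le> 1"
    by (rule bounded_sequence_converges[where u = u' and g = g', OF u'(1) g'(1) wg' u'V g'D]) (erule (2) that, blast)
  have v_meas [measurable]: "v \<in> borel_measurable lebesgue" using v by (auto intro: measurable_completion)
  show ?thesis
  \<comment> \<open>Multiplication by \<open>b\<close> undoes the normalisation, so the limit is
    \<open>b * v\<close>.\<close>
  proof (intro exI[of _ r] exI[of _ "\<lambda>x. b * v x"] conjI)
    show "strict_mono r" by (rule r)
    show "(\<lambda>x. b * v x) \<in> L_space D"
      unfolding L_space_def
    proof (intro CollectI conjI exI[of _ "1 / b"])
      have "modular (\<lambda>x. 1 / b * \<bar>b * v x\<bar>) = modular (\<lambda>x. \<bar>v x\<bar>)"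
        using b by (simp add: abs_mult)
      also have "\<dots> \<le> ennreal (1 / V\<^sub>0)" by (rule modular_le_V_modular[OF v_meas vV])
      also have "\<dots> < \<infinity>" by simp
      finally show "modular (\<lambda>x. 1 / b * \<bar>b * v x\<bar>) < \<infinity>" .
    qed (use b in auto)
    show "(\<lambda>n. L_norm D (\<lambda>x. u (r n) x - b * v x)) \<longlonglongrightarrow> 0"
    proof (rule tendstoI)
      fix e :: real assume e: "e > 0"
      \<comment> \<open>Tolerance for the normalised sequence: multiplied by \<open>b\<close> it
        becomes \<open>e / 2\<close>, which leaves room for the strict inequality.\<close>
      have "e / 2 / b > 0" using e b by simp
      from lim[OF this] show "\<forall>\<^sub>F n in sequentially. dist (L_norm D (\<lambda>x. u (r n) x - b * v x)) 0 < e"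
      proof eventually_elim
        case (elim n)
        let ?S = "{\<tau>. \<tau> > 0 \<and> modular (\<lambda>x. \<bar>u (r n) x - b * v x\<bar> / \<tau>) \<le> 1}"
        have "modular (\<lambda>x. \<bar>u (r n) x - b * v x\<bar> / (e / 2))
          = modular (\<lambda>x. \<bar>u' (r n) x - v x\<bar> / (e / 2 / b))"
        proof (rule nn_integral_cong_AE)
          show "AE x in lebesgue. ennreal (D x (\<bar>u (r n) x - b * v x\<bar> / (e / 2))) = ennreal (D x (\<bar>u' (r n) x - v x\<bar> / (e / 2 / b)))"
            using u'(2)[of "r n"]
          proof eventually_elim
            case (elim x)
            have "u (r n) x - b * v x = b * (u' (r n) x - v x)" using b by (simp add: elim algebra_simps)
            then have "\<bar>u (r n) x - b * v x\<bar> = b * \<bar>u' (r n) x - v x\<bar>" using b by (simp add: abs_mult)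
            then have "\<bar>u (r n) x - b * v x\<bar> / (e / 2) = \<bar>u' (r n) x - v x\<bar> / (e / 2 / b)"
              using b e by (simp add: field_simps)
            then show ?case by (simp only:)
          qed
        qed
        then have in_S: "e / 2 \<in> ?S" using elim e by simp
        then have "L_norm D (\<lambda>x. u (r n) x - b * v x) \<le> e / 2"
          unfolding L_norm_def by (intro cInf_lower) (auto intro!: bdd_belowI[of _ 0])
        moreover have "0 \<le> L_norm D (\<lambda>x. u (r n) x - b * v x)"
          unfolding L_norm_def using in_S by (intro luxemburg_Inf_nonneg) blast
        ultimately show ?case using e by (simp add: dist_real_def)
      qed
    qed
  qed
qed

lemma compact_embedding_W1V_L:
  "compact_embedding (W1V_space V D) (W1V_norm V D) (L_space D) (L_norm D)"
  unfolding compact_embedding_def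
proof (intro conjI allI impI)
  show "W1V_space V D \<subseteq> L_space D" by (auto simp: W1V_space_def W1_space_def)
  show "\<exists>C. \<forall>u\<in>W1V_space V D. L_norm D u \<le> C * W1V_norm V D u" using embedding_bound by blast
qed (use sequence_compactness in blast)

end

theorem theorem1p3:
  fixes p q :: "'a::euclidean_space \<Rightarrow> real \<Rightarrow> real"
    and \<mu> V :: "'a \<Rightarrow> real"
    and c_p c_q V\<^sub>0 :: real
  assumes dim: "DIM('a) \<ge> 3"
    and mu_nonneg: "\<And>x. \<mu> x \<ge> 0"
    and mu_bounded: "bounded (range \<mu>)"
    and mu_lipschitz: "\<exists>L. L-lipschitz_on UNIV \<mu>"
    and p_carath: "caratheodory p"
    and q_carath: "caratheodory q"
    and p_bounds: "2 \<le> ess_inf_exp p" "ess_inf_exp p \<le> ess_sup_exp p"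
      "ess_sup_exp p < ereal (real DIM('a))"
    and q_bounds: "2 \<le> ess_inf_exp q" "ess_inf_exp q \<le> ess_sup_exp q" "ess_sup_exp q < \<infinity>"
    and p_less_q: "AE x in lebesgue. \<forall>t\<ge>0. p x t < q x t \<and>
      ereal (q x t) < sobolev_conjugate (ereal (real DIM('a))) (ess_inf_exp p)"
    and p_const: "\<And>x s t. s \<in> {0..1} \<Longrightarrow> t \<in> {0..1} \<Longrightarrow> p x s = p x t"
    and q_const: "\<And>x s t. s \<in> {0..1} \<Longrightarrow> t \<in> {0..1} \<Longrightarrow> q x s = q x t"
    and p_mono: "\<And>x. mono_on {1..} (p x)"
    and q_mono: "\<And>x. mono_on {1..} (q x)"
    and c_pos: "c_p > 0" "c_q > 0"
    and p_lipschitz: "\<And>t. t \<ge> 0 \<Longrightarrow>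
      AE x in lebesgue. AE y in lebesgue. \<bar>p x t - p y t\<bar> \<le> c_p * dist x y"
    and q_lipschitz: "\<And>t. t \<ge> 0 \<Longrightarrow>
      AE x in lebesgue. AE y in lebesgue. \<bar>q x t - q y t\<bar> \<le> c_q * dist x y"
    and ratio: "ess_sup_exp q / ess_inf_exp p < 1 + 1 / ereal (real DIM('a))"
    and V_cont: "continuous_on UNIV V"
    and V0_pos: "V\<^sub>0 > 0"
    and V_lower: "\<And>x. V x \<ge> V\<^sub>0"
    and V_sublevel: "\<And>L. L > 0 \<Longrightarrow> emeasure lebesgue {x. V x < L} < \<infinity>"
  shows "compact_embedding
    (W1V_space V (double_phase p q \<mu>)) (W1V_norm V (double_phase p q \<mu>))
    (L_space (double_phase p q \<mu>)) (L_norm (double_phase p q \<mu>))"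
proof -
  \<comment> \<open>Nothing is lost in passing to real numbers: \<open>ess_inf_exp p\<close> lies
    between 2 and the dimension, and \<open>ess_sup_exp q\<close> is at least 2 and finite.\<close>
  define P Q where "P = real_of_ereal (ess_inf_exp p)" and "Q = real_of_ereal (ess_sup_exp q)"
  have "ess_inf_exp p < \<infinity>" using p_bounds by (auto intro: le_less_trans less_trans)
  then have P: "ess_inf_exp p = ereal P" unfolding P_def using p_bounds(1) by (cases "ess_inf_exp p") auto
  have "2 \<le> ess_sup_exp q" using q_bounds by (auto intro: order_trans)
  then have Q: "ess_sup_exp q = ereal Q" unfolding Q_def using q_bounds(3) by (cases "ess_sup_exp q") auto
  have P2: "2 \<le> P" using p_bounds(1) by (simp add: P)
  have rat: "Q < P * (1 + 1 / real DIM('a))"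
  proof -
    have "ereal (Q / P) < ereal (1 + 1 / real DIM('a))"
      using ratio P2 by (simp add: P Q one_ereal_def)
    then have "Q / P < 1 + 1 / real DIM('a)" by simp
    then show ?thesis using P2 by (simp add: divide_less_eq mult.commute)
  qed
  obtain M where M: "\<And>x. \<bar>\<mu> x\<bar> \<le> M"
    using mu_bounded by (auto simp: bounded_iff)
  have M0: "0 \<le> M" using M[of undefined] by linarith
  have phase: "AE x in lebesgue. phase (p x) (q x) (\<mu> x) P Q M"
  proof -
    have "AE x in lebesgue. continuous_on {0..} (p x)" "AE x in lebesgue. continuous_on {0..} (q x)"
      using p_carath q_carath by (auto simp: caratheodory_def)
    moreover have "AE x in lebesgue. \<forall>t\<ge>0. P \<le> p x t"
      by (rule essinf_exp_bound[OF p_carath]) (simp add: P)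
    moreover have "AE x in lebesgue. \<forall>t\<ge>0. q x t \<le> Q"
      by (rule esssup_exp_bound[OF q_carath]) (simp add: Q)
    ultimately show ?thesis using p_less_q
    proof eventually_elim
      case (elim x)
      have lt: "p x t < q x t" if "t \<ge> 0" for t using elim(5) that by blast
      show ?case
      proof
        show "P \<le> p x t" "q x t \<le> Q" if "t \<ge> 0" for t using elim(3,4) that by blast+
        \<comment> \<open>The crossed bounds follow from \<open>p x t < q x t\<close>.\<close>
        then show "p x t \<le> Q" "P \<le> q x t" if "t \<ge> 0" for t
          using lt[OF that] that by (meson le_less_trans less_imp_le order_trans)+
        show "p x t = p x 0" "q x t = q x 0" if "0 \<le> t" "t \<le> 1" for t
          using p_const[of t 0 x] q_const[of t 0 x] that by auto
        show "0 \<le> \<mu> x" "\<mu> x \<le> M" using mu_nonneg[of x] M[of x] by auto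
      qed (use elim p_mono q_mono P2 in auto)
    qed
  qed
  \<comment> \<open>\<open>P \<le> Q\<close> is read off at a single point. One exists because
    Lebesgue measure is not the zero measure, so a property valid almost everywhere cannot fail
    everywhere.\<close>
  have "\<exists>x. phase (p x) (q x) (\<mu> x) P Q M"
  proof (rule ccontr)
    assume "\<not> ?thesis"
    then have "AE x in (lebesgue :: 'a measure). False" using phase by simp
    then show False by (simp add: AE_iff_null_sets[symmetric] eventually_False ae_filter_eq_bot_iff)
  qed
  then have PQ: "P \<le> Q" using phase.PQ by blast
  obtain L where "L-lipschitz_on UNIV \<mu>" using mu_lipschitz by blast
  then have "\<mu> \<in> borel_measurable lborel"
    using borel_measurable_continuous_onI[OF lipschitz_on_continuous_on] by auto
  moreover have "V \<in> borel_measurable lborel" using borel_measurable_continuous_onI[OF V_cont] by simp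
  ultimately interpret double_phase_setting p q \<mu> V P Q M V\<^sub>0
    using phase p_carath q_carath P2 PQ M0 rat V0_pos V_lower V_sublevel
    by unfold_locales (auto intro: measurable_completion)
  show ?thesis by (rule compact_embedding_W1V_L)
qed

end
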